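(* Suppose the regularity conditions (a)–(e) stated in the context hold for all $P\in\mathcal P$. Then the DML1 and DML2 estimators $\tilde\theta_0$ constructed using either score (A) or score (B) are first-order equivalent and obey $$\sigma^{-1}\sqrt N(\tilde\theta_0-\theta_0)\leadsto N(0,1)$$ uniformly over $P\in\mathcal P$, where $\sigma^2=[\mathrm E_PV^2]^{-1}\mathrm E_P[V^2U^2][\mathrm E_PV^2]^{-1}$. Moreover, the result continues to hold if $\sigma^2$ is replaced by the variance estimator $\hat\sigma^2$ defined in the context. Consequently, $$\lim_{N\to\infty}\sup_{P\in\mathcal P}\Big|\Pr_P\big(\theta_0\in[\tilde\theta_0\pm\Phi^{-1}(1-\alpha/2)\hat\sigma/\sqrt N]\big)-(1-\alpha)\Big|=0.$$
   Context: Partially linear regression model: $W=(Y,D,X)$ with $Y=D\theta_0+g_0(X)+U$, $\mathrm E_P[U\mid X,D]=0$, and $D=m_0(X)+V$, $\mathrm E_P[V\mid X]=0$, $D$ scalar. Scores: (A) $\psi(W;\theta,\eta)=\{Y-D\theta-g(X)\}(D-m(X))$, $\eta=(g,m)$, true value $\eta_0=(g_0,m_0)$; (B) $\psi(W;\theta,\eta)=\{Y-\ell(X)-\theta(D-m(X))\}(D-m(X))$, $\eta=(\ell,m)$, true value $(\ell_0,m_0)$ with $\ell_0(X)=\mathrm E_P[Y\mid X]$; here $g,m,\ell$ are $P$-square-integrable real functions on the support of $X$. Both scores are linear: $\psi=\psi^a(W;\eta)\theta+\psi^b(W;\eta)$. DML estimators: $K\ge2$ fixed integer, $N/K=n$ integer;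 random partition $(I_k)$ of $[N]$ into $K$ folds of size $n$; $\hat\eta_{0,k}$ is an estimator of $\eta_0$ computed only from $(W_i)_{i\notin I_k}$; $\mathbb E_{n,k}f=n^{-1}\sum_{i\in I_k}f(W_i)$. DML1: $\check\theta_{0,k}$ solves $\mathbb E_{n,k}[\psi(W;\theta,\hat\eta_{0,k})]=0$ (or minimizes its norm up to $\epsilon_N=o(\delta_NN^{-1/2})$) and $\tilde\theta_0=K^{-1}\sum_k\check\theta_{0,k}$; DML2: $\tilde\theta_0$ solves $K^{-1}\sum_k\mathbb E_{n,k}[\psi(W;\theta,\hat\eta_{0,k})]=0$ (up to $\epsilon_N$). Variance estimator: $\hat\sigma^2=\hat J_0^{-2}K^{-1}\sum_k\mathbb E_{n,k}[\psi(W;\tilde\theta_0,\hat\eta_{0,k})^2]$, $\hat J_0=K^{-1}\sum_k\mathbb E_{n,k}[\psi^a(W;\hat\eta_{0,k})]$. Conditions. $(\delta_N),(\Delta_N)$ positive sequences converging to $0$; $c,C>0$, $q>4$ fixed. For functions, $\|f\|_{P,q}=(\mathrm E_P|f(X)|^q)^{1/q}$; for $\eta=(\ell_1,\ell_2)$, $\|\eta\|_{P,q}=\|\ell_1\|_{P,q}\vee\|\ell_2\|_{P,q}$. $\mathcal P$ is the collection of laws $P$ of $(Y,D,X)$ such that: (a) the model equations hold; (b) $\|Y\|_{P,q}+\|D\|_{P,q}\le C$; (c) $\|UV\|_{P,2}\ge c^2$ and $\mathrm E_P[V^2]\ge c$; (d) $\|\mathrm E_P[U^2\mid X]\|_{P,\infty}\le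 C$ and $\|\mathrm E_P[V^2\mid X]\|_{P,\infty}\le C$; (e) given a random subset $I$ of $[N]$ of size $n$, the nuisance estimator $\hat\eta_0=\hat\eta_0((W_i)_{i\in I^c})$ satisfies, with $P$-probability at least $1-\Delta_N$: $\|\hat\eta_0-\eta_0\|_{P,q}\le C$, $\|\hat\eta_0-\eta_0\|_{P,2}\le\delta_N$, and (i) for score (A), with $\hat\eta_0=(\hat g_0,\hat m_0)$, $\|\hat m_0-m_0\|_{P,2}\|\hat g_0-g_0\|_{P,2}\le\delta_NN^{-1/2}$; (ii) for score (B), with $\hat\eta_0=(\hat\ell_0,\hat m_0)$, $\|\hat m_0-m_0\|_{P,2}(\|\hat m_0-m_0\|_{P,2}+\|\hat\ell_0-\ell_0\|_{P,2})\le\delta_NN^{-1/2}$. (Norms of $\hat\eta_0-\eta_0$ treat $\hat\eta_0$ as a fixed function.) "Uniformly over $P\in\mathcal P$" means the convergence holds under every sequence $P_N\in\mathcal P$. "First-order equivalent" means the estimators differ by $o_P(N^{-1/2})$. $\Phi$ is the standard normal cdf, $\alpha\in(0,1)$. *)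

theory Defs
  imports "HOL-Probability.Probability"
begin

text \<open>An observation is W = (Y, D, X) with Y, D real and X in an arbitrary
measurable space MX.  A nuisance value is a pair of real functions on the
X-space: (g, m) for score (A), (l, m) for score (B).\<close>

type_synonym 'x obs = "real \<times> real \<times> 'x"
type_synonym 'x nuis = "('x \<Rightarrow> real) \<times> ('x \<Rightarrow> real)"

definition obs_space :: "'x measure \<Rightarrow> 'x obs measure" where
  "obs_space MX = borel \<Otimes>\<^sub>M (borel \<Otimes>\<^sub>M MX)"

definition Yof :: "'x obs \<Rightarrow> real" where "Yof w = fst w"
definition Dof :: "'x obs \<Rightarrow> real" where "Dof w = fst (snd w)"
definition Xof :: "'x obs \<Rightarrow> 'x" where "Xof w = snd (snd w)"

definition sigma_X :: "'x measure \<Rightarrow> 'x obs measure" where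
  "sigma_X MX = vimage_algebra (space (obs_space MX)) Xof MX"
definition sigma_DX :: "'x measure \<Rightarrow> 'x obs measure" where
  "sigma_DX MX = vimage_algebra (space (obs_space MX)) (\<lambda>w. (Dof w, Xof w)) (borel \<Otimes>\<^sub>M MX)"

definition lawX :: "'x measure \<Rightarrow> 'x obs measure \<Rightarrow> 'x measure" where
  "lawX MX P = distr P MX Xof"

definition Lnorm :: "'a measure \<Rightarrow> real \<Rightarrow> ('a \<Rightarrow> real) \<Rightarrow> ennreal" where
  "Lnorm M q f =
     (if (\<integral>\<^sup>+x. ennreal (\<bar>f x\<bar> powr q) \<partial>M) = \<infinity> then \<infinity>
      else ennreal (enn2real (\<integral>\<^sup>+x. ennreal (\<bar>f x\<bar> powr q) \<partial>M) powr (1 / q)))"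

datatype score = ScoreA | ScoreB

text \<open>The two Neyman-orthogonal scores, psi = psi_a * theta + psi_b.\<close>
fun psi :: "score \<Rightarrow> 'x obs \<Rightarrow> real \<Rightarrow> 'x nuis \<Rightarrow> real" where
  "psi ScoreA w \<theta> (g, m) = (Yof w - Dof w * \<theta> - g (Xof w)) * (Dof w - m (Xof w))"
| "psi ScoreB w \<theta> (l, m) = (Yof w - l (Xof w) - \<theta> * (Dof w - m (Xof w))) * (Dof w - m (Xof w))"

fun psi_a :: "score \<Rightarrow> 'x obs \<Rightarrow> 'x nuis \<Rightarrow> real" where
  "psi_a ScoreA w (g, m) = - (Dof w * (Dof w - m (Xof w)))"
| "psi_a ScoreB w (l, m) = - ((Dof w - m (Xof w))\<^sup>2)"

definition Uerr :: "('p \<Rightarrow> real) \<Rightarrow> ('p \<Rightarrow> 'x \<Rightarrow> real) \<Rightarrow> 'p \<Rightarrow> 'x obs \<Rightarrow> real" where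
  "Uerr \<theta>0 g0 P w = Yof w - Dof w * \<theta>0 P - g0 P (Xof w)"

definition Verr :: "('p \<Rightarrow> 'x \<Rightarrow> real) \<Rightarrow> 'p \<Rightarrow> 'x obs \<Rightarrow> real" where
  "Verr m0 P w = Dof w - m0 P (Xof w)"

text \<open>True nuisance value: (g0, m0) for score (A); (l0, m0) for score (B),
where l0(X) = E[Y | X] = theta0 m0(X) + g0(X) (using E[U | X] = 0).\<close>
definition eta0 :: "score \<Rightarrow> ('p \<Rightarrow> real) \<Rightarrow> ('p \<Rightarrow> 'x \<Rightarrow> real) \<Rightarrow> ('p \<Rightarrow> 'x \<Rightarrow> real)
                     \<Rightarrow> 'p \<Rightarrow> 'x nuis" where
  "eta0 s \<theta>0 g0 m0 P =
     (case s of ScoreA \<Rightarrow> (g0 P, m0 P)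
              | ScoreB \<Rightarrow> ((\<lambda>x. \<theta>0 P * m0 P x + g0 P x), m0 P))"

definition sigma0 :: "('x obs measure \<Rightarrow> real) \<Rightarrow> ('x obs measure \<Rightarrow> 'x \<Rightarrow> real)
    \<Rightarrow> ('x obs measure \<Rightarrow> 'x \<Rightarrow> real) \<Rightarrow> 'x obs measure \<Rightarrow> real" where
  "sigma0 \<theta>0 g0 m0 P =
     sqrt ((\<integral>w. (Verr m0 P w)\<^sup>2 * (Uerr \<theta>0 g0 P w)\<^sup>2 \<partial>P) / (\<integral>w. (Verr m0 P w)\<^sup>2 \<partial>P)\<^sup>2)"

definition sample :: "nat \<Rightarrow> 'a measure \<Rightarrow> (nat \<Rightarrow> 'a) measure" where
  "sample N P = PiM {..<N} (\<lambda>_. P)"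

definition Parts :: "nat \<Rightarrow> nat \<Rightarrow> (nat \<Rightarrow> nat) set" where
  "Parts N K = {\<pi> \<in> PiE {..<N} (\<lambda>_. {..<K}). \<forall>k<K. card {i\<in>{..<N}. \<pi> i = k} = N div K}"

definition fold :: "nat \<Rightarrow> (nat \<Rightarrow> nat) \<Rightarrow> nat \<Rightarrow> nat set" where
  "fold N \<pi> k = {i\<in>{..<N}. \<pi> i = k}"

definition Omega :: "nat \<Rightarrow> nat \<Rightarrow> 'a measure \<Rightarrow> ((nat \<Rightarrow> nat) \<times> (nat \<Rightarrow> 'a)) measure" where
  "Omega N K P = uniform_measure (count_space (Parts N K)) (Parts N K) \<Otimes>\<^sub>M sample N P"

definition Subs :: "nat \<Rightarrow> nat \<Rightarrow> nat set set" where
  "Subs N n = {I. I \<subseteq> {..<N} \<and> card I = n}"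

definition OmegaSub :: "nat \<Rightarrow> nat \<Rightarrow> 'a measure \<Rightarrow> (nat set \<times> (nat \<Rightarrow> 'a)) measure" where
  "OmegaSub N n P = uniform_measure (count_space (Subs N n)) (Subs N n) \<Otimes>\<^sub>M sample N P"

definition eta_hat :: "(nat \<Rightarrow> nat set \<Rightarrow> (nat \<Rightarrow> 'x obs) \<Rightarrow> 'x nuis)
                       \<Rightarrow> nat \<Rightarrow> nat set \<Rightarrow> (nat \<Rightarrow> 'x obs) \<Rightarrow> 'x nuis" where
  "eta_hat est N J w = est N J (restrict w J)"

definition En :: "nat set \<Rightarrow> (nat \<Rightarrow> 'a) \<Rightarrow> ('a \<Rightarrow> real) \<Rightarrow> real" where
  "En I w f = (\<Sum>i\<in>I. f (w i)) / real (card I)"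

definition fold_score :: "score \<Rightarrow> (nat \<Rightarrow> nat set \<Rightarrow> (nat \<Rightarrow> 'x obs) \<Rightarrow> 'x nuis)
     \<Rightarrow> nat \<Rightarrow> (nat \<Rightarrow> nat) \<Rightarrow> (nat \<Rightarrow> 'x obs) \<Rightarrow> nat \<Rightarrow> real \<Rightarrow> real" where
  "fold_score s est N \<pi> w k \<theta> =
     En (fold N \<pi> k) w (\<lambda>v. psi s v \<theta> (eta_hat est N ({..<N} - fold N \<pi> k) w))"

definition is_DML1 :: "score \<Rightarrow> (nat \<Rightarrow> nat set \<Rightarrow> (nat \<Rightarrow> 'x obs) \<Rightarrow> 'x nuis) \<Rightarrow> nat \<Rightarrow> real
     \<Rightarrow> nat \<Rightarrow> (nat \<Rightarrow> nat) \<Rightarrow> (nat \<Rightarrow> 'x obs) \<Rightarrow> real \<Rightarrow> bool" where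
  "is_DML1 s est K eps N \<pi> w \<theta> \<longleftrightarrow>
     (\<exists>\<theta>k :: nat \<Rightarrow> real.
        (\<forall>k<K. \<bar>fold_score s est N \<pi> w k (\<theta>k k)\<bar>
                 \<le> (INF t. \<bar>fold_score s est N \<pi> w k t\<bar>) + eps)
      \<and> \<theta> = (\<Sum>k<K. \<theta>k k) / real K)"

definition is_DML2 :: "score \<Rightarrow> (nat \<Rightarrow> nat set \<Rightarrow> (nat \<Rightarrow> 'x obs) \<Rightarrow> 'x nuis) \<Rightarrow> nat \<Rightarrow> real
     \<Rightarrow> nat \<Rightarrow> (nat \<Rightarrow> nat) \<Rightarrow> (nat \<Rightarrow> 'x obs) \<Rightarrow> real \<Rightarrow> bool" where
  "is_DML2 s est K eps N \<pi> w \<theta> \<longleftrightarrow>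
     \<bar>(\<Sum>k<K. fold_score s est N \<pi> w k \<theta>) / real K\<bar>
        \<le> (INF t. \<bar>(\<Sum>k<K. fold_score s est N \<pi> w k t) / real K\<bar>) + eps"

definition sigma_hat :: "score \<Rightarrow> (nat \<Rightarrow> nat set \<Rightarrow> (nat \<Rightarrow> 'x obs) \<Rightarrow> 'x nuis) \<Rightarrow> nat
     \<Rightarrow> nat \<Rightarrow> (nat \<Rightarrow> nat) \<Rightarrow> (nat \<Rightarrow> 'x obs) \<Rightarrow> real \<Rightarrow> real" where
  "sigma_hat s est K N \<pi> w \<theta> =
     (let J = (\<Sum>k<K. En (fold N \<pi> k) w
                        (\<lambda>v. psi_a s v (eta_hat est N ({..<N} - fold N \<pi> k) w))) / real K;
          S = (\<Sum>k<K. En (fold N \<pi> k) w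
                        (\<lambda>v. (psi s v \<theta> (eta_hat est N ({..<N} - fold N \<pi> k) w))\<^sup>2)) / real K
      in sqrt (S / J\<^sup>2))"

definition nuisance_good :: "score \<Rightarrow> 'x measure \<Rightarrow> real \<Rightarrow> real \<Rightarrow> real \<Rightarrow> nat
     \<Rightarrow> 'x nuis \<Rightarrow> 'x nuis \<Rightarrow> bool" where
  "nuisance_good s PX C q \<delta>N N eh e0 \<longleftrightarrow>
     (let d1 = (\<lambda>x. fst eh x - fst e0 x); d2 = (\<lambda>x. snd eh x - snd e0 x) in
      max (Lnorm PX q d1) (Lnorm PX q d2) \<le> ennreal C
    \<and> max (Lnorm PX 2 d1) (Lnorm PX 2 d2) \<le> ennreal \<delta>N
    \<and> (case s of
         ScoreA \<Rightarrow> Lnorm PX 2 d2 * Lnorm PX 2 d1 \<le> ennreal (\<delta>N / sqrt (real N))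
       | ScoreB \<Rightarrow> Lnorm PX 2 d2 * (Lnorm PX 2 d2 + Lnorm PX 2 d1) \<le> ennreal (\<delta>N / sqrt (real N))))"

definition regular :: "'x measure \<Rightarrow> score \<Rightarrow> real \<Rightarrow> real \<Rightarrow> real \<Rightarrow> (nat \<Rightarrow> real) \<Rightarrow> (nat \<Rightarrow> real)
     \<Rightarrow> nat \<Rightarrow> (nat \<Rightarrow> nat set \<Rightarrow> (nat \<Rightarrow> 'x obs) \<Rightarrow> 'x nuis)
     \<Rightarrow> ('x obs measure \<Rightarrow> real) \<Rightarrow> ('x obs measure \<Rightarrow> 'x \<Rightarrow> real) \<Rightarrow> ('x obs measure \<Rightarrow> 'x \<Rightarrow> real)
     \<Rightarrow> 'x obs measure \<Rightarrow> bool" where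
  "regular MX s c C q \<delta> \<Delta> K est \<theta>0 g0 m0 P \<longleftrightarrow>
     prob_space P \<and> sets P = sets (obs_space MX)
     \<comment> \<open>(a) the model equations, with g0, m0 P-square-integrable functions of X\<close>
   \<and> g0 P \<in> borel_measurable MX \<and> m0 P \<in> borel_measurable MX
   \<and> integrable (lawX MX P) (\<lambda>x. (g0 P x)\<^sup>2) \<and> integrable (lawX MX P) (\<lambda>x. (m0 P x)\<^sup>2)
   \<and> (AE w in P. real_cond_exp P (sigma_DX MX) (Uerr \<theta>0 g0 P) w = 0)
   \<and> (AE w in P. real_cond_exp P (sigma_X MX) (Verr m0 P) w = 0)
     \<comment> \<open>(b)\<close>
   \<and> Lnorm P q Yof + Lnorm P q Dof \<le> ennreal C
     \<comment> \<open>(c)\<close>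
   \<and> Lnorm P 2 (\<lambda>w. Uerr \<theta>0 g0 P w * Verr m0 P w) \<ge> ennreal (c\<^sup>2)
   \<and> (\<integral>w. (Verr m0 P w)\<^sup>2 \<partial>P) \<ge> c
     \<comment> \<open>(d) essential-sup bounds on conditional variances\<close>
   \<and> (AE w in P. \<bar>real_cond_exp P (sigma_X MX) (\<lambda>v. (Uerr \<theta>0 g0 P v)\<^sup>2) w\<bar> \<le> C)
   \<and> (AE w in P. \<bar>real_cond_exp P (sigma_X MX) (\<lambda>v. (Verr m0 P v)\<^sup>2) w\<bar> \<le> C)
     \<comment> \<open>(e) nuisance estimation quality, for a uniformly random subset I of size n = N/K\<close>
   \<and> (\<forall>N. 0 < N \<and> K dvd N \<longrightarrow>
        measure (OmegaSub N (N div K) P)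
          {(I, w) \<in> space (OmegaSub N (N div K) P).
             nuisance_good s (lawX MX P) C q (\<delta> N) N
               (eta_hat est N ({..<N} - I) w) (eta0 s \<theta>0 g0 m0 P)}
        \<ge> 1 - \<Delta> N)"

definition Phi :: "real \<Rightarrow> real" where
  "Phi = cdf std_normal_distribution"

definition Phi_inv :: "real \<Rightarrow> real" where
  "Phi_inv p = (THE t. Phi t = p)"

end

theory Submission
  imports Defs
begin

text \<open>
For both scores the score at \<open>\<theta>0\<close> and estimated nuisances is \<open>(U - h) (V - d)\<close> with nuisance errors
\<open>h\<close> and \<open>d\<close> that are functions of \<open>X\<close>. Given the auxiliary sample these are fixed functions, so on
the main fold \<open>sqrt n E[h V]\<close> and \<open>sqrt n E[U d]\<close> have mean zero and variance at most \<open>C \<parallel>h\<parallel>\<^sup>2\<close> and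
\<open>C \<parallel>d\<parallel>\<^sup>2\<close>, while \<open>sqrt n E\<bar>h d\<bar>\<close> has mean at most \<open>sqrt n \<parallel>h\<parallel> \<parallel>d\<parallel>\<close>; all three vanish in
probability. As the score is affine in \<open>\<theta>\<close> with slope tending to \<open>- E V\<^sup>2\<close>, both DML estimators
satisfy \<open>sqrt N (\<theta> - \<theta>0) = N\<^bsup>-1/2\<^esup> \<Sum> U V / E V\<^sup>2 + o(1)\<close> in probability. The leading term obeys
a Lyapunov central limit theorem along every sequence of laws because \<open>U V\<close> has bounded moments of
order \<open>q / 2 > 2\<close>. The same bounds and a truncated law of large numbers for \<open>(U V)\<^sup>2\<close> give the
consistency of the variance estimator, and uniformity follows by considering a sequence of worst laws.
\<close>

subsection \<open>Convergence in probability along a sequence of spaces\<close>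

text \<open>The obstacles lie between these conditional computations and the statement. Condition
  (e) speaks of one uniformly random subset, while the estimators use all folds of a random
  partition. A relabelling argument shows that each single fold is again a uniform subset, so
  nuisance failures cost at most \<open>\<Delta> N\<close> per fold, but only on average over
  partitions. Conditioning is Fubini on the product sample: \<open>eta_hat\<close> reads only
  coordinates outside a fold, hence stays fixed while that fold is integrated out. Uniformity
  requires constants that depend on c, C, q alone. The conditions do not bound \<theta>0 directly; a
  bound is extracted from E[Y V] = \<theta>0 E[V^2] with E[V^2] \<ge> c. Likewise g0 is not the
  conditional mean of an observed variable, so the q-th moment of U comes from U = (Y - l0) -
  \<theta>0 V with l0 = E[Y | X] and conditional Jensen. Variances are compared through the ratio to
  the true value, because \<open>sigma0\<close> moves with the law. The same ratio shows that a
  vanishing variance estimate, where studentizing would divide by zero, has negligible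
  probability.\<close>

definition holds_except :: "'a measure \<Rightarrow> real \<Rightarrow> ('a \<Rightarrow> bool) \<Rightarrow> bool" where
  "holds_except M d X \<longleftrightarrow> (\<exists>A\<in>sets M. measure M A \<le> d \<and> (\<forall>\<omega>\<in>space M - A. X \<omega>))"

lemma holds_except_conj:
  assumes "holds_except M a X" "holds_except M b Y"
  shows "holds_except M (a + b) (\<lambda>\<omega>. X \<omega> \<and> Y \<omega>)"
proof -
  obtain A B where "A \<in> sets M" "measure M A \<le> a" "\<forall>\<omega>\<in>space M - A. X \<omega>"
    "B \<in> sets M" "measure M B \<le> b" "\<forall>\<omega>\<in>space M - B. Y \<omega>"
    using assms unfolding holds_except_def by blast
  then show ?thesis
    unfolding holds_except_def using measure_Un_le[of A M B] by (intro bexI[of _ "A \<union> B"]) auto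
qed

lemma holds_except_mono:
  "holds_except M a X \<Longrightarrow> a \<le> b \<Longrightarrow> (\<And>\<omega>. \<omega> \<in> space M \<Longrightarrow> X \<omega> \<Longrightarrow> Y \<omega>) \<Longrightarrow> holds_except M b Y"
  unfolding holds_except_def by (meson DiffD1 order_trans)

lemma holds_except_everywhere: "(\<And>\<omega>. \<omega> \<in> space M \<Longrightarrow> X \<omega>) \<Longrightarrow> 0 \<le> d \<Longrightarrow> holds_except M d X"
  unfolding holds_except_def by (auto intro!: bexI[of _ "{}"])

text \<open>A set that is not measurable has measure 0 by default, so the bound survives without a
  measurability hypothesis on \<open>X\<close>. This is the way back from exceptional sets to
  \<open>measure\<close> of an event.\<close>

lemma measure_le_of_holds_except:
  assumes M: "prob_space M" and "holds_except M d X" and "0 \<le> d"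
  shows "measure M {\<omega>\<in>space M. \<not> X \<omega>} \<le> d"
proof (cases "{\<omega>\<in>space M. \<not> X \<omega>} \<in> sets M")
  case True
  obtain A where A: "A \<in> sets M" "measure M A \<le> d" "\<forall>\<omega>\<in>space M - A. X \<omega>"
    using assms unfolding holds_except_def by blast
  have "measure M {\<omega>\<in>space M. \<not> X \<omega>} \<le> measure M A"
    using A by (intro finite_measure.finite_measure_mono prob_space.finite_measure M) auto
  with A show ?thesis by simp
qed (use assms in \<open>auto simp: measure_notin_sets\<close>)

text \<open>Making convergence in probability a filter on pairs \<open>(n, \<omega>)\<close> gives access to the calculus
of \<^const>\<open>tendsto\<close>; since exceptional sets are only required to be contained in small measurable
sets, no measurability side conditions arise.\<close>

definition in_prob :: "(nat \<Rightarrow> 'a measure) \<Rightarrow> (nat \<times> 'a) filter" where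
  "in_prob M = Abs_filter (\<lambda>X. \<forall>d>0. \<forall>\<^sub>F n in sequentially. holds_except (M n) d (\<lambda>\<omega>. X (n, \<omega>)))"

lemma eventually_in_prob:
  "eventually X (in_prob M) \<longleftrightarrow>
     (\<forall>d>0. \<forall>\<^sub>F n in sequentially. holds_except (M n) d (\<lambda>\<omega>. X (n, \<omega>)))"
  unfolding in_prob_def
proof (rule eventually_Abs_filter, unfold_locales, goal_cases)
  case 1
  then show ?case by (auto intro!: always_eventually holds_except_everywhere)
next
  case (2 X Y)
  show ?case
  proof (intro allI impI)
    fix d :: real assume "d > 0"
    then have "d / 2 > 0" by simp
    with 2 have "\<forall>\<^sub>F n in sequentially. holds_except (M n) (d / 2) (\<lambda>\<omega>. X (n, \<omega>))"
      "\<forall>\<^sub>F n in sequentially. holds_except (M n) (d / 2) (\<lambda>\<omega>. Y (n, \<omega>))" by blast+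
    then show "\<forall>\<^sub>F n in sequentially. holds_except (M n) d (\<lambda>\<omega>. X (n, \<omega>) \<and> Y (n, \<omega>))"
      by eventually_elim (use holds_except_conj in fastforce)
  qed
next
  case (3 X Y)
  then show ?case by (blast intro: eventually_mono holds_except_mono[OF _ order_refl])
qed

lemma eventually_in_probD:
  "eventually X (in_prob M) \<Longrightarrow> d > 0 \<Longrightarrow>
     \<forall>\<^sub>F n in sequentially. holds_except (M n) d (\<lambda>\<omega>. X (n, \<omega>))"
  by (simp add: eventually_in_prob)

lemma eventually_in_prob_everywhere:
  "\<forall>\<^sub>F n in sequentially. \<forall>\<omega>\<in>space (M n). X (n, \<omega>) \<Longrightarrow> eventually X (in_prob M)"
  unfolding eventually_in_prob by (auto elim!: eventually_mono intro: holds_except_everywhere)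

lemma tendsto_in_prob_I:
  fixes f :: "nat \<times> 'a \<Rightarrow> real"
  assumes "\<And>e d. e > 0 \<Longrightarrow> d > 0 \<Longrightarrow>
     \<forall>\<^sub>F n in sequentially. holds_except (M n) d (\<lambda>\<omega>. \<bar>f (n, \<omega>)\<bar> < e)"
  shows "(f \<longlongrightarrow> 0) (in_prob M)"
  by (rule tendstoI) (use assms in \<open>auto simp: eventually_in_prob\<close>)

lemma tendsto_in_prob_zeroD:
  fixes f :: "nat \<times> 'a \<Rightarrow> real"
  assumes M: "\<And>n. prob_space (M n)" and "(f \<longlongrightarrow> 0) (in_prob M)" "e > 0"
  shows "(\<lambda>n. measure (M n) {\<omega>\<in>space (M n). \<bar>f (n, \<omega>)\<bar> > e}) \<longlonglongrightarrow> 0"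
proof (rule tendstoI)
  fix d :: real assume d: "d > 0"
  from tendstoD[OF assms(2,3)] have "eventually (\<lambda>x. \<not> \<bar>f x\<bar> > e) (in_prob M)"
    by (auto elim: eventually_mono)
  from eventually_in_probD[OF this, of "d / 2"] d
  have "\<forall>\<^sub>F n in sequentially. holds_except (M n) (d / 2) (\<lambda>\<omega>. \<not> \<bar>f (n, \<omega>)\<bar> > e)" by simp
  then show "\<forall>\<^sub>F n in sequentially. dist (measure (M n) {\<omega> \<in> space (M n). e < \<bar>f (n, \<omega>)\<bar>}) 0 < d"
  proof eventually_elim
    case (elim n)
    from measure_le_of_holds_except[OF M this] d
    have "measure (M n) {\<omega> \<in> space (M n). e < \<bar>f (n, \<omega>)\<bar>} \<le> d / 2" by simp
    then show ?case using d by simp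
  qed
qed

text \<open>Boundedness in probability, O_P(1). It is not an \<open>eventually\<close> statement for
  \<open>in_prob\<close>, because the bound \<open>B\<close> may grow as the exceptional probability
  \<open>d\<close> shrinks.\<close>

definition tight_prob :: "(nat \<Rightarrow> 'a measure) \<Rightarrow> (nat \<times> 'a \<Rightarrow> real) \<Rightarrow> bool" where
  "tight_prob M f \<longleftrightarrow>
     (\<forall>d>0. \<exists>B. \<forall>\<^sub>F n in sequentially. holds_except (M n) d (\<lambda>\<omega>. \<bar>f (n, \<omega>)\<bar> \<le> B))"

text \<open>The rule O_P(1) o_P(1) = o_P(1). The product rule for limits does not cover it, since
  \<open>f\<close> need not converge: it may depend on a varying law or have a nondegenerate limit
  distribution.\<close>

lemma tendsto_zero_mult_tight:
  assumes f: "tight_prob M f" and g: "(g \<longlongrightarrow> 0) (in_prob M)"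
  shows "((\<lambda>x. f x * g x) \<longlongrightarrow> 0) (in_prob M)"
proof (rule tendsto_in_prob_I)
  fix e d :: real assume ed: "e > 0" "d > 0"
  then have "d / 2 > 0" by simp
  with f obtain B where B: "\<forall>\<^sub>F n in sequentially. holds_except (M n) (d / 2) (\<lambda>\<omega>. \<bar>f (n, \<omega>)\<bar> \<le> B)"
    unfolding tight_prob_def by blast
  have pos: "e / (\<bar>B\<bar> + 1) > 0" using ed by simp
  from tendstoD[OF g pos] have "eventually (\<lambda>x. \<bar>g x\<bar> < e / (\<bar>B\<bar> + 1)) (in_prob M)" by simp
  from B eventually_in_probD[OF this \<open>d / 2 > 0\<close>]
  show "\<forall>\<^sub>F n in sequentially. holds_except (M n) d (\<lambda>\<omega>. \<bar>f (n, \<omega>) * g (n, \<omega>)\<bar> < e)"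
  proof eventually_elim
    case (elim n)
    from holds_except_conj[OF elim] show ?case
    proof (rule holds_except_mono)
      fix \<omega> assume w: "\<bar>f (n, \<omega>)\<bar> \<le> B \<and> \<bar>g (n, \<omega>)\<bar> < e / (\<bar>B\<bar> + 1)"
      then have "\<bar>f (n, \<omega>) * g (n, \<omega>)\<bar> \<le> (\<bar>B\<bar> + 1) * \<bar>g (n, \<omega>)\<bar>"
        by (auto simp: abs_mult intro!: mult_right_mono)
      also have "\<dots> < (\<bar>B\<bar> + 1) * (e / (\<bar>B\<bar> + 1))"
        using w by (intro mult_strict_left_mono) auto
      finally show "\<bar>f (n, \<omega>) * g (n, \<omega>)\<bar> < e" by simp
    qed simp
  qed
qed

lemma tight_prob_binary:
  assumes "tight_prob M f" "tight_prob M g"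
    and H: "\<And>a b B C. \<bar>a\<bar> \<le> B \<Longrightarrow> \<bar>b\<bar> \<le> C \<Longrightarrow> \<bar>H a b\<bar> \<le> G B C"
  shows "tight_prob M (\<lambda>x. H (f x) (g x))"
  unfolding tight_prob_def
proof (intro allI impI)
  fix d :: real assume "d > 0"
  then have d: "d / 2 > 0" by simp
  from assms d obtain B C where
    "\<forall>\<^sub>F n in sequentially. holds_except (M n) (d / 2) (\<lambda>\<omega>. \<bar>f (n, \<omega>)\<bar> \<le> B)"
    "\<forall>\<^sub>F n in sequentially. holds_except (M n) (d / 2) (\<lambda>\<omega>. \<bar>g (n, \<omega>)\<bar> \<le> C)"
    unfolding tight_prob_def by meson
  then have "\<forall>\<^sub>F n in sequentially. holds_except (M n) d (\<lambda>\<omega>. \<bar>H (f (n, \<omega>)) (g (n, \<omega>))\<bar> \<le> G B C)"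
  proof eventually_elim
    case (elim n)
    from holds_except_conj[OF elim] show ?case by (rule holds_except_mono) (auto intro: H)
  qed
  then show "\<exists>B. \<forall>\<^sub>F n in sequentially. holds_except (M n) d (\<lambda>\<omega>. \<bar>H (f (n, \<omega>)) (g (n, \<omega>))\<bar> \<le> B)"
    by blast
qed

lemma tight_prob_add: "tight_prob M f \<Longrightarrow> tight_prob M g \<Longrightarrow> tight_prob M (\<lambda>x. f x + g x)"
  by (rule tight_prob_binary[where G="(+)"]) auto

lemma tight_prob_mult: "tight_prob M f \<Longrightarrow> tight_prob M g \<Longrightarrow> tight_prob M (\<lambda>x. f x * g x)"
  by (rule tight_prob_binary[where G="(*)"]) (simp_all add: abs_mult mult_mono')

lemma tight_prob_bounded: "eventually (\<lambda>x. \<bar>f x\<bar> \<le> B) (in_prob M) \<Longrightarrow> tight_prob M f"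
  unfolding tight_prob_def using eventually_in_probD by blast

lemma tight_prob_tendsto:
  assumes "(f \<longlongrightarrow> (c::real)) (in_prob M)"
  shows "tight_prob M f"
proof (rule tight_prob_bounded)
  from tendstoD[OF assms, of 1] show "eventually (\<lambda>x. \<bar>f x\<bar> \<le> \<bar>c\<bar> + 1) (in_prob M)"
    by (auto elim!: eventually_mono simp: dist_real_def)
qed

lemma isCont_cdf_std_normal: "isCont (cdf std_normal_distribution) x"
proof -
  interpret real_distribution std_normal_distribution by (rule real_dist_normal_dist)
  show ?thesis unfolding isCont_cdf
    by (simp add: measure_def emeasure_density nn_integral_null_set)
qed

text \<open>The distribution function of \<open>T n\<close> at x is squeezed between those of
  \<open>Z n\<close> at x - r and x + r, up to the probability that the two differ by r or more.
  Continuity of the normal limit makes convergence available at both shifted points. The underlying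
  spaces may vary with n.\<close>

lemma slutsky:
  fixes T Z :: "nat \<Rightarrow> 'a \<Rightarrow> real"
  assumes M: "\<And>n. prob_space (M n)"
    and T: "\<And>n. T n \<in> borel_measurable (M n)" and Z: "\<And>n. Z n \<in> borel_measurable (M n)"
    and conv: "weak_conv_m (\<lambda>n. distr (M n) borel (Z n)) std_normal_distribution"
    and diff: "((\<lambda>(n, \<omega>). T n \<omega> - Z n \<omega>) \<longlongrightarrow> 0) (in_prob M)"
  shows "weak_conv_m (\<lambda>n. distr (M n) borel (T n)) std_normal_distribution"
  unfolding weak_conv_m_def weak_conv_def
proof (intro allI impI)
  interpret M: prob_space "M n" for n by (rule M)
  note [measurable] = T Z
  let ?F = "cdf std_normal_distribution"
  have cdfT: "cdf (distr (M n) borel (T n)) x = measure (M n) {\<omega>\<in>space (M n). T n \<omega> \<le> x}"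
    and cdfZ: "cdf (distr (M n) borel (Z n)) x = measure (M n) {\<omega>\<in>space (M n). Z n \<omega> \<le> x}" for n x
    by (auto simp: cdf_def measure_distr intro!: arg_cong[where f="measure (M n)"])
  fix x
  show "(\<lambda>n. cdf (distr (M n) borel (T n)) x) \<longlonglongrightarrow> ?F x"
  proof (rule tendstoI)
    fix e :: real assume "e > 0"
    then have e4: "e/4 > 0" by simp
    from isCont_cdf_std_normal[of x, unfolded continuous_at_eps_delta, rule_format, OF e4]
    obtain h where h: "h > 0" "\<And>y. \<bar>y - x\<bar> < h \<Longrightarrow> \<bar>?F y - ?F x\<bar> < e/4"
      by (auto simp: dist_real_def)
    define r where "r = h/2"
    have r: "r > 0" "\<bar>?F (x + r) - ?F x\<bar> < e/4" "\<bar>?F (x - r) - ?F x\<bar> < e/4"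
      using h by (auto simp: r_def)
    have c: "(\<lambda>n. cdf (distr (M n) borel (Z n)) y) \<longlonglongrightarrow> ?F y" for y
      using conv isCont_cdf_std_normal unfolding weak_conv_m_def weak_conv_def by blast
    from tendstoD[OF diff r(1)]
    have d: "eventually (\<lambda>x. \<bar>case x of (n, \<omega>) \<Rightarrow> T n \<omega> - Z n \<omega>\<bar> < r) (in_prob M)"
      by (simp add: dist_real_def)
    from eventually_in_probD[OF d e4] tendstoD[OF c[of "x + r"] e4] tendstoD[OF c[of "x - r"] e4]
    show "eventually (\<lambda>n. dist (cdf (distr (M n) borel (T n)) x) (?F x) < e) sequentially"
    proof eventually_elim
      case (elim n)
      from elim(1) obtain A where A: "A \<in> sets (M n)" "measure (M n) A \<le> e/4"
        "\<forall>\<omega>\<in>space (M n) - A. \<bar>T n \<omega> - Z n \<omega>\<bar> < r"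
        by (auto simp: holds_except_def)
      note [measurable] = A(1)
      let ?T = "{\<omega>\<in>space (M n). T n \<omega> \<le> x}" and ?Z = "\<lambda>x. {\<omega>\<in>space (M n). Z n \<omega> \<le> x}"
      have "measure (M n) ?T \<le> measure (M n) (?Z (x + r) \<union> A)"
        using A by (intro M.finite_measure_mono) force+
      also have "\<dots> \<le> measure (M n) (?Z (x + r)) + measure (M n) A"
        by (rule measure_Un_le) auto
      finally have 1: "measure (M n) ?T \<le> measure (M n) (?Z (x + r)) + e/4" using A by simp
      have "measure (M n) (?Z (x - r)) \<le> measure (M n) (?T \<union> A)"
        using A by (intro M.finite_measure_mono) force+
      also have "\<dots> \<le> measure (M n) ?T + measure (M n) A"
        by (rule measure_Un_le) auto
      finally have 2: "measure (M n) (?Z (x - r)) \<le> measure (M n) ?T + e/4" using A by simp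
      from 1 2 elim(2,3) r show ?case
        unfolding cdfT cdfZ dist_real_def by linarith
    qed
  qed
qed

subsection \<open>Averages over product samples\<close>

lemma integral_PiM_component:
  fixes f :: "'a \<Rightarrow> 'b::{banach,second_countable_topology}"
  assumes Q: "prob_space Q" and I: "finite I" "i \<in> I" and f: "f \<in> borel_measurable Q"
  shows "(\<integral>y. f (y i) \<partial>PiM I (\<lambda>_. Q)) = (\<integral>v. f v \<partial>Q)"
    and "integrable (PiM I (\<lambda>_. Q)) (\<lambda>y. f (y i)) \<longleftrightarrow> integrable Q f"
proof -
  interpret Q: prob_space Q by fact
  interpret product_prob_space "\<lambda>_. Q" I by unfold_locales
  have *: "distr (PiM I (\<lambda>_. Q)) Q (\<lambda>y. y i) = Q"
    using PiM_component[OF I(2)] by simp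
  show "(\<integral>y. f (y i) \<partial>PiM I (\<lambda>_. Q)) = (\<integral>v. f v \<partial>Q)"
    by (subst *[symmetric], subst integral_distr) (use I f in auto)
  show "integrable (PiM I (\<lambda>_. Q)) (\<lambda>y. f (y i)) \<longleftrightarrow> integrable Q f"
    by (subst (2) *[symmetric], subst integrable_distr_eq) (use I f in auto)
qed

lemma second_moment_PiM_sum:
  fixes f :: "'a \<Rightarrow> real"
  assumes Q: "prob_space Q" and I: "finite I" and f[measurable]: "f \<in> borel_measurable Q"
    and sq: "integrable Q (\<lambda>v. (f v)\<^sup>2)" and zero: "(\<integral>v. f v \<partial>Q) = 0"
  shows "(\<integral>y. (\<Sum>i\<in>I. f (y i))\<^sup>2 \<partial>PiM I (\<lambda>_. Q)) = card I * (\<integral>v. (f v)\<^sup>2 \<partial>Q)" (is ?A)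
    and "integrable (PiM I (\<lambda>_. Q)) (\<lambda>y. (\<Sum>i\<in>I. f (y i))\<^sup>2)" (is ?B)
proof -
  interpret Q: prob_space Q by fact
  interpret P: product_sigma_finite "\<lambda>_. Q" by unfold_locales
  have f1: "integrable Q f" using Q.square_integrable_imp_integrable[OF f sq] .
  have *: "integrable (PiM I (\<lambda>_. Q)) (\<lambda>y. f (y i) * f (y j)) \<and>
     (\<integral>y. f (y i) * f (y j) \<partial>PiM I (\<lambda>_. Q)) = (if i = j then (\<integral>v. (f v)\<^sup>2 \<partial>Q) else 0)"
    if "i \<in> I" "j \<in> I" for i j
  proof (cases "i = j")
    case True
    then show ?thesis using integral_PiM_component[OF Q I that(1), of "\<lambda>v. (f v)\<^sup>2"] sq
      by (simp add: power2_eq_square)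
  next
    case False
    \<comment> \<open>The product of two coordinates becomes a product over all of \<open>I\<close>
      by inserting the factor 1 elsewhere. The integral then factorizes and vanishes, because factor
      \<open>i\<close> has mean zero.\<close>
    define g where "g k = (if k = i \<or> k = j then f else (\<lambda>_. 1))" for k
    have gi: "integrable Q (g k)" for k using f1 by (auto simp: g_def)
    have eq: "(\<Prod>k\<in>I. g k (y k)) = f (y i) * f (y j)" for y :: "_ \<Rightarrow> 'a"
    proof -
      have "(\<Prod>k\<in>I. g k (y k)) = (\<Prod>k\<in>{i,j}. g k (y k))"
        using that by (intro prod.mono_neutral_right I) (auto simp: g_def)
      then show ?thesis using False by (simp add: g_def)
    qed
    have "(\<Prod>k\<in>I. integral\<^sup>L Q (g k)) = 0"
      using that I zero by (auto simp: prod_zero_iff g_def intro!: bexI[of _ i])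
    then show ?thesis
      using P.product_integrable_prod[OF I, of g] P.product_integral_prod[OF I, of g] gi False
      by (simp add: eq)
  qed
  have sq_eq: "(\<Sum>i\<in>I. f (y i))\<^sup>2 = (\<Sum>i\<in>I. \<Sum>j\<in>I. f (y i) * f (y j))" for y :: "_ \<Rightarrow> 'a"
    by (simp add: power2_eq_square sum_product)
  show ?B unfolding sq_eq using * by (intro Bochner_Integration.integrable_sum) auto
  have "(\<integral>y. (\<Sum>i\<in>I. f (y i))\<^sup>2 \<partial>PiM I (\<lambda>_. Q)) = (\<Sum>i\<in>I. \<Sum>j\<in>I. \<integral>y. f (y i) * f (y j) \<partial>PiM I (\<lambda>_. Q))"
    unfolding sq_eq using *
    by (subst Bochner_Integration.integral_sum) (auto intro!: Bochner_Integration.integrable_sum sum.cong Bochner_Integration.integral_sum)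
  also have "\<dots> = (\<Sum>i\<in>I. \<Sum>j\<in>I. if i = j then (\<integral>v. (f v)\<^sup>2 \<partial>Q) else 0)"
    using * by (intro sum.cong) auto
  finally show ?A using I by simp
qed

text \<open>The variance of the average carries the factor 1 / \<open>card I\<close>, which cancels
  the scaling, so the bound does not depend on the fold size.\<close>

lemma PiM_chebyshev:
  fixes f :: "'a \<Rightarrow> real"
  assumes Q: "prob_space Q" and I: "finite I" and f[measurable]: "f \<in> borel_measurable Q"
    and sq: "integrable Q (\<lambda>v. (f v)\<^sup>2)" and zero: "(\<integral>v. f v \<partial>Q) = 0"
    and b: "(\<integral>v. (f v)\<^sup>2 \<partial>Q) \<le> b" and e: "e > 0"
  shows "emeasure (PiM I (\<lambda>_. Q)) {y\<in>space (PiM I (\<lambda>_. Q)). e \<le> sqrt (card I) * \<bar>En I y f\<bar>} \<le> ennreal (b / e\<^sup>2)"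
proof (cases "card I = 0")
  case True
  then have eq: "{y\<in>space (PiM I (\<lambda>_. Q)). e \<le> sqrt (card I) * \<bar>En I y f\<bar>} = {}" using e by auto
  show ?thesis unfolding eq by simp
next
  case False
  interpret Q: prob_space Q by fact
  interpret product_prob_space "\<lambda>_. Q" I by unfold_locales
  let ?M = "PiM I (\<lambda>_. Q)"
  have [measurable]: "(\<lambda>y. \<Sum>i\<in>I. f (y i)) \<in> borel_measurable ?M" by measurable
  let ?S = "{y\<in>space ?M. e\<^sup>2 * card I \<le> (\<Sum>i\<in>I. f (y i))\<^sup>2}"
  have eq: "{y\<in>space ?M. e \<le> sqrt (card I) * \<bar>En I y f\<bar>} = {y\<in>space ?M. e\<^sup>2 * card I \<le> (\<Sum>i\<in>I. f (y i))\<^sup>2}"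
  proof -
    have "e \<le> sqrt (card I) * \<bar>s / card I\<bar> \<longleftrightarrow> e\<^sup>2 * card I \<le> s\<^sup>2" for s :: real
    proof -
      have "e \<le> sqrt (card I) * \<bar>s / card I\<bar> \<longleftrightarrow> e\<^sup>2 \<le> (sqrt (card I) * \<bar>s / card I\<bar>)\<^sup>2"
        using e by (subst power2_le_iff_abs_le) (auto simp: abs_mult)
      also have "(sqrt (card I) * \<bar>s / card I\<bar>)\<^sup>2 = s\<^sup>2 / card I"
        using False by (simp add: power_mult_distrib power_divide) (simp add: power2_eq_square)
      finally show ?thesis using False by (simp add: pos_le_divide_eq)
    qed
    then show ?thesis by (simp add: En_def)
  qed
  have "measure ?M ?S \<le> (\<integral>y. (\<Sum>i\<in>I. f (y i))\<^sup>2 \<partial>?M) / (e\<^sup>2 * card I)"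
    using second_moment_PiM_sum(2)[OF Q I f sq zero] e False
    by (intro integral_Markov_inequality_measure[where A="space ?M"]) auto
  also have "\<dots> \<le> b / e\<^sup>2"
    using second_moment_PiM_sum(1)[OF Q I f sq zero] b e False
    by (simp add: divide_simps)
  finally show ?thesis
    unfolding eq emeasure_eq_measure by (rule ennreal_leI)
qed

text \<open>The counterpart for terms without cancellation: only a first moment enters, and any
  scaling by the square root of the fold size has to be part of \<open>f\<close>.\<close>

lemma PiM_markov:
  fixes f :: "'a \<Rightarrow> real"
  assumes Q: "prob_space Q" and I: "finite I" and f: "integrable Q f"
    and b: "(\<integral>v. \<bar>f v\<bar> \<partial>Q) \<le> b" and e: "e > 0"
  shows "emeasure (PiM I (\<lambda>_. Q)) {y\<in>space (PiM I (\<lambda>_. Q)). e \<le> En I y (\<lambda>v. \<bar>f v\<bar>)} \<le> ennreal (b / e)"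
proof (cases "card I = 0")
  case True
  then have eq: "{y\<in>space (PiM I (\<lambda>_. Q)). e \<le> En I y (\<lambda>v. \<bar>f v\<bar>)} = {}" using e by (auto simp: En_def)
  show ?thesis unfolding eq by simp
next
  case False
  interpret Q: prob_space Q by fact
  interpret product_prob_space "\<lambda>_. Q" I by unfold_locales
  let ?M = "PiM I (\<lambda>_. Q)"
  have fm[measurable]: "f \<in> borel_measurable Q" using f by simp
  have int: "integrable ?M (\<lambda>y. \<bar>f (y i)\<bar>)" "(\<integral>y. \<bar>f (y i)\<bar> \<partial>?M) = (\<integral>v. \<bar>f v\<bar> \<partial>Q)" if "i \<in> I" for i
    using integral_PiM_component[OF Q I that, of "\<lambda>v. \<bar>f v\<bar>"] f by auto
  have i2: "integrable ?M (\<lambda>y. En I y (\<lambda>v. \<bar>f v\<bar>))" unfolding En_def using int by auto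
  have "emeasure ?M {y\<in>space ?M. e \<le> En I y (\<lambda>v. \<bar>f v\<bar>)} = ennreal (measure ?M {y\<in>space ?M. e \<le> En I y (\<lambda>v. \<bar>f v\<bar>)})"
    by (rule emeasure_eq_measure)
  also have "\<dots> \<le> ennreal ((\<integral>y. En I y (\<lambda>v. \<bar>f v\<bar>) \<partial>?M) / e)"
    using i2 e by (intro ennreal_leI integral_Markov_inequality_measure[where A="space ?M"]) (auto simp: En_def intro!: AE_I2 divide_nonneg_nonneg sum_nonneg)
  also have "(\<integral>y. En I y (\<lambda>v. \<bar>f v\<bar>) \<partial>?M) = (\<integral>v. \<bar>f v\<bar> \<partial>Q)"
    unfolding En_def using int False by (simp add: Bochner_Integration.integral_sum)
  also have "ennreal ((\<integral>v. \<bar>f v\<bar> \<partial>Q) / e) \<le> ennreal (b / e)"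
    using b e by (intro ennreal_leI divide_right_mono) auto
  finally show ?thesis .
qed

text \<open>Fubini, read as conditioning on the coordinates outside \<open>I\<close>. The hypothesis
  is phrased with a full sample \<open>w\<close>, of which only the restriction matters, because the
  nuisance estimators take full samples as arguments.\<close>

lemma emeasure_sample_le_of_conditional:
  assumes Q: "prob_space Q" and I: "I \<subseteq> {..<N}" and A: "A \<in> sets (sample N Q)"
    and le: "\<And>w. w \<in> space (sample N Q) \<Longrightarrow>
       emeasure (PiM I (\<lambda>_. Q)) {y\<in>space (PiM I (\<lambda>_. Q)). merge I ({..<N} - I) (y, restrict w ({..<N} - I)) \<in> A} \<le> b"
  shows "emeasure (sample N Q) A \<le> b"
proof -
  interpret Q: prob_space Q by fact
  interpret product_sigma_finite "\<lambda>_::nat. Q" by unfold_locales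
  let ?J = "{..<N} - I"
  interpret J: product_prob_space "\<lambda>_. Q" ?J by unfold_locales
  have fin: "finite I" "finite ?J" using I finite_subset by auto
  have IJ: "?J \<union> I = {..<N}" "?J \<inter> I = {}" using I by auto
  have "emeasure (sample N Q) A = emeasure (PiM (?J \<union> I) (\<lambda>_. Q)) A" by (simp only: sample_def IJ)
  also have "\<dots> = (\<integral>\<^sup>+x. emeasure (PiM I (\<lambda>_. Q)) ((\<lambda>y. merge ?J I (x, y)) -` A \<inter> space (PiM I (\<lambda>_. Q))) \<partial>PiM ?J (\<lambda>_. Q))"
  proof (intro emeasure_fold_integral IJ fin)
    show "A \<in> sets (PiM (?J \<union> I) (\<lambda>_. Q))" using A by (simp only: IJ sample_def)
  qed
  also have "\<dots> \<le> (\<integral>\<^sup>+x. b \<partial>PiM ?J (\<lambda>_. Q))"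
  proof (rule nn_integral_mono)
    fix x assume x: "x \<in> space (PiM ?J (\<lambda>_. Q))"
    \<comment> \<open>An arbitrary observation fills the coordinates in \<open>I\<close>, turning
      the partial sample \<open>x\<close> into a full one; the restriction to \<open>?J\<close>
      discards the filling.\<close>
    obtain v where v: "v \<in> space Q" using Q.not_empty by blast
    define w where "w = (\<lambda>i\<in>{..<N}. if i \<in> ?J then x i else v)"
    have w: "w \<in> space (sample N Q)" using x v I by (auto simp: w_def sample_def space_PiM PiE_iff)
    have r: "restrict w ?J = x"
    proof
      fix i show "restrict w ?J i = x i"
        using x by (cases "i \<in> ?J") (auto simp: w_def space_PiM PiE_iff extensional_def)
    qed
    have "(\<lambda>y. merge ?J I (x, y)) -` A \<inter> space (PiM I (\<lambda>_. Q)) = {y\<in>space (PiM I (\<lambda>_. Q)). merge I ?J (y, restrict w ?J) \<in> A}"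
      unfolding r using merge_commute[OF IJ(2)] by auto
    then show "emeasure (PiM I (\<lambda>_. Q)) ((\<lambda>y. merge ?J I (x, y)) -` A \<inter> space (PiM I (\<lambda>_. Q))) \<le> b"
      using le[OF w] by simp
  qed
  also have "\<dots> = b" by (simp add: J.emeasure_space_1)
  finally show ?thesis .
qed

text \<open>The l2 norm is at most the l1 norm. Through it, averages of squared products are
  controlled by first-order averages at the price of a factor n, in place of higher moments.\<close>

lemma sum_squares_le_square_sum:
  fixes f :: "'b \<Rightarrow> real" assumes "finite I"
  shows "(\<Sum>i\<in>I. (f i)\<^sup>2) \<le> (\<Sum>i\<in>I. \<bar>f i\<bar>)\<^sup>2"
proof -
  have "(\<Sum>i\<in>I. (f i)\<^sup>2) \<le> (\<Sum>i\<in>I. \<bar>f i\<bar> * (\<Sum>i\<in>I. \<bar>f i\<bar>))"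
  proof (rule sum_mono)
    fix i assume "i \<in> I"
    then have "\<bar>f i\<bar> \<le> (\<Sum>i\<in>I. \<bar>f i\<bar>)" using assms by (intro member_le_sum) auto
    then have "\<bar>f i\<bar> * \<bar>f i\<bar> \<le> \<bar>f i\<bar> * (\<Sum>i\<in>I. \<bar>f i\<bar>)" by (intro mult_left_mono) auto
    then show "(f i)\<^sup>2 \<le> \<bar>f i\<bar> * (\<Sum>i\<in>I. \<bar>f i\<bar>)" by (simp add: power2_eq_square)
  qed
  then show ?thesis by (simp add: power2_eq_square sum_distrib_right)
qed

text \<open>Expanding the square leaves a cross term, which Cauchy-Schwarz bounds. With a vanishing
  mean square of \<open>r\<close>, tightness of the mean square of \<open>a\<close> is enough to
  make the right-hand side vanish.\<close>

lemma En_square_perturb: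
  fixes a r :: "'a \<Rightarrow> real"
  shows "\<bar>En I w (\<lambda>v. (a v + r v)\<^sup>2) - En I w (\<lambda>v. (a v)\<^sup>2)\<bar>
    \<le> 2 * sqrt (En I w (\<lambda>v. (a v)\<^sup>2) * En I w (\<lambda>v. (r v)\<^sup>2)) + En I w (\<lambda>v. (r v)\<^sup>2)"
proof -
  let ?c = "real (card I)" and ?A = "\<Sum>i\<in>I. (a (w i))\<^sup>2" and ?R = "\<Sum>i\<in>I. (r (w i))\<^sup>2" and ?X = "\<Sum>i\<in>I. a (w i) * r (w i)"
  have "?X\<^sup>2 \<le> ?A * ?R" by (rule Cauchy_Schwarz_ineq_sum)
  then have "(?X / ?c)\<^sup>2 \<le> (?A / ?c) * (?R / ?c)"
    by (simp add: power_divide power2_eq_square[of ?c] divide_right_mono)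
  then have X: "\<bar>?X / ?c\<bar> \<le> sqrt ((?A / ?c) * (?R / ?c))" by (rule real_le_rsqrt[of "\<bar>?X / ?c\<bar>", unfolded power2_abs])
  have "En I w (\<lambda>v. (a v + r v)\<^sup>2) - En I w (\<lambda>v. (a v)\<^sup>2) = 2 * (?X / ?c) + ?R / ?c"
    by (simp add: En_def power2_sum sum.distrib sum_distrib_left mult.assoc add_divide_distrib)
  moreover have "0 \<le> ?R / ?c" by (intro divide_nonneg_nonneg sum_nonneg) auto
  ultimately show ?thesis using X unfolding En_def by linarith
qed

lemma En_mono: "(\<And>v. f v \<le> g v) \<Longrightarrow> En I w f \<le> En I w g"
  by (simp add: En_def divide_right_mono sum_mono)

lemma measurable_En:
  assumes "\<And>i. i \<in> I \<Longrightarrow> (\<lambda>w. f w (w i)) \<in> borel_measurable M"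
  shows "(\<lambda>w. En I w (f w)) \<in> borel_measurable M"
  unfolding En_def using assms by (intro borel_measurable_divide borel_measurable_sum) auto

subsection \<open>Random partitions and random subsets\<close>

text \<open>All subsets of the finite set \<open>S\<close> are measurable, so measurability section
  by section suffices. The facts serve both \<open>Omega\<close>, where \<open>S\<close> consists of
  partitions, and \<open>OmegaSub\<close>, where it consists of index sets.\<close>

lemma uniform_pair:
  fixes B :: "'s \<Rightarrow> 'a set"
  assumes S: "finite S" "S \<noteq> {}" and Q: "prob_space Q"
  defines "M \<equiv> uniform_measure (count_space S) S \<Otimes>\<^sub>M Q"
  shows prob_space_uniform_pair: "prob_space M"
    and space_uniform_pair: "space M = S \<times> space Q"
    and sets_uniform_pair: "(\<And>s. s \<in> S \<Longrightarrow> B s \<in> sets Q) \<Longrightarrow> {(s, w). s \<in> S \<and> w \<in> B s} \<in> sets M"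
    and measure_uniform_pair: "(\<And>s. s \<in> S \<Longrightarrow> B s \<in> sets Q) \<Longrightarrow>
       measure M {(s, w). s \<in> S \<and> w \<in> B s} = (\<Sum>s\<in>S. measure Q (B s)) / card S"
    and measurable_uniform_pair: "(\<And>s. s \<in> S \<Longrightarrow> g s \<in> measurable Q R) \<Longrightarrow> (\<lambda>(s, w). g s w) \<in> measurable M R"
proof -
  interpret Q: prob_space Q by fact
  let ?U = "uniform_measure (count_space S) S"
  have U1: "emeasure (count_space S) S \<noteq> 0" "emeasure (count_space S) S \<noteq> \<infinity>"
    using S by (auto simp: emeasure_count_space)
  interpret U: prob_space ?U by (rule prob_space_uniform_measure[OF U1])
  interpret UQ: pair_prob_space ?U Q ..
  have sp: "space ?U = S" "sets ?U = Pow S" by auto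
  show M: "prob_space M" unfolding M_def by (rule UQ.prob_space_axioms)
  show "space M = S \<times> space Q" by (simp add: M_def space_pair_measure sp)
  have set: "{(s, w). s \<in> S \<and> w \<in> B s} \<in> sets M" if "\<And>s. s \<in> S \<Longrightarrow> B s \<in> sets Q" for B
  proof -
    have "{(s, w). s \<in> S \<and> w \<in> B s} = (\<Union>s\<in>S. {s} \<times> B s)" by auto
    also have "\<dots> \<in> sets M"
      unfolding M_def using that S by (intro sets.finite_UN pair_measureI) auto
    finally show ?thesis .
  qed
  then show "(\<And>s. s \<in> S \<Longrightarrow> B s \<in> sets Q) \<Longrightarrow> {(s, w). s \<in> S \<and> w \<in> B s} \<in> sets M" .
  show "measure M {(s, w). s \<in> S \<and> w \<in> B s} = (\<Sum>s\<in>S. measure Q (B s)) / card S"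
    if B: "\<And>s. s \<in> S \<Longrightarrow> B s \<in> sets Q"
  proof -
    interpret M: prob_space M by fact
    have eq: "{(s, w). s \<in> S \<and> w \<in> B s} = (\<Union>s\<in>S. {s} \<times> B s)" by auto
    have "measure M {(s, w). s \<in> S \<and> w \<in> B s} = (\<Sum>s\<in>S. measure M ({s} \<times> B s))"
      unfolding eq using S B
      by (intro M.finite_measure_finite_Union) (auto simp: M_def disjoint_family_on_def)
    also have "\<dots> = (\<Sum>s\<in>S. measure Q (B s) / card S)"
    proof (rule sum.cong[OF refl])
      fix s assume s: "s \<in> S"
      have "measure M ({s} \<times> B s) = measure ?U {s} * measure Q (B s)"
        unfolding M_def measure_def using s B by (subst Q.emeasure_pair_measure_Times) (auto simp: enn2real_mult)
      also have "measure ?U {s} = 1 / card S"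
        using s S by (subst measure_uniform_measure[OF U1]) (auto simp: measure_count_space)
      finally show "measure M ({s} \<times> B s) = measure Q (B s) / card S" by simp
    qed
    finally show ?thesis by (simp add: sum_divide_distrib)
  qed
  show "(\<lambda>(s, w). g s w) \<in> measurable M R" if g: "\<And>s. s \<in> S \<Longrightarrow> g s \<in> measurable Q R"
  proof (rule measurableI)
    fix x assume "x \<in> space M" then show "(case x of (s, w) \<Rightarrow> g s w) \<in> space R"
      using g by (auto simp: M_def space_pair_measure dest: measurable_space)
  next
    fix A assume A: "A \<in> sets R"
    have "(\<lambda>(s, w). g s w) -` A \<inter> space M = {(s, w). s \<in> S \<and> w \<in> g s -` A \<inter> space Q}"
      by (auto simp: M_def space_pair_measure)
    also have "\<dots> \<in> sets M" using g A by (intro set) (auto intro: measurable_sets)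
    finally show "(\<lambda>(s, w). g s w) -` A \<inter> space M \<in> sets M" .
  qed
qed

lemma finite_Parts: "finite (Parts N K)"
proof (rule finite_subset)
  show "Parts N K \<subseteq> PiE {..<N} (\<lambda>_. {..<K})" by (auto simp: Parts_def)
qed (auto intro: finite_PiE)

lemma Parts_nonempty:
  assumes "K > 0" shows "Parts (K * n) K \<noteq> {}"
proof -
  \<comment> \<open>Consecutive blocks of length n. For n = 0 the index set is empty and every block
    has the required size 0.\<close>
  define p where "p = (\<lambda>i\<in>{..<K * n}. i div n)"
  have "card {i\<in>{..<K * n}. p i = k} = n" if "k < K" for k
  proof (cases "n = 0")
    case False
    have "{i\<in>{..<K * n}. p i = k} = {k * n..<Suc k * n}"
    proof (rule set_eqI)
      fix i
      have "Suc k * n \<le> K * n" using that by (intro mult_right_mono) auto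
      moreover have "i div n = k \<longleftrightarrow> k * n \<le> i \<and> i < Suc k * n"
        using False by (auto simp: div_nat_eqI dividend_less_times_div mult.commute)
      ultimately show "i \<in> {i\<in>{..<K * n}. p i = k} \<longleftrightarrow> i \<in> {k * n..<Suc k * n}"
        by (auto simp: p_def)
    qed
    then show ?thesis by simp
  qed simp
  moreover have "p \<in> PiE {..<K * n} (\<lambda>_. {..<K})"
    by (auto simp: p_def less_mult_imp_div_less)
  ultimately have "p \<in> Parts (K * n) K" using assms by (auto simp: Parts_def)
  then show ?thesis by auto
qed

lemma finite_Subs: "finite (Subs N n)"
  by (rule finite_subset[of _ "Pow {..<N}"]) (auto simp: Subs_def)

lemma fold_in_Subs:
  "\<pi> \<in> Parts N K \<Longrightarrow> k < K \<Longrightarrow> fold N \<pi> k \<in> Subs N (N div K)"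
  by (auto simp: Parts_def Subs_def fold_def)

text \<open>Composing a partition with a permutation \<open>h\<close> of the indices that carries
  \<open>J\<close> onto \<open>I\<close> is injective and turns k-th fold \<open>I\<close> into k-th
  fold \<open>J\<close>. Exchanging the roles of \<open>I\<close> and \<open>J\<close> gives
  equality.\<close>

lemma card_Parts_with_fold_le:
  assumes I: "I \<in> Subs N n" and J: "J \<in> Subs N n"
  shows "card {\<pi>\<in>Parts N K. fold N \<pi> k = I} \<le> card {\<pi>\<in>Parts N K. fold N \<pi> k = J}"
proof -
  have fin: "finite I" "finite J" and sub: "I \<subseteq> {..<N}" "J \<subseteq> {..<N}" and card: "card I = card J"
    using I J by (auto simp: Subs_def intro: finite_subset)
  have "card ({..<N} - I) = card ({..<N} - J)"
    using fin sub card by (simp add: card_Diff_subset)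
  then obtain f g where f: "bij_betw f J I" and g: "bij_betw g ({..<N} - J) ({..<N} - I)"
    using fin card finite_same_card_bij[of J I] finite_same_card_bij[of "{..<N} - J" "{..<N} - I"] by auto
  define h where "h i = (if i \<in> J then f i else g i)" for i
  have hJ: "bij_betw h J I" using f by (rule bij_betw_cong[THEN iffD1, rotated]) (simp add: h_def)
  have hc: "bij_betw h ({..<N} - J) ({..<N} - I)" using g by (rule bij_betw_cong[THEN iffD1, rotated]) (auto simp: h_def)
  have h: "bij_betw h {..<N} {..<N}"
    using bij_betw_combine[OF hJ hc] sub by (simp add: Un_absorb1)
  have hin: "h i < N" if "i < N" for i using h that by (auto simp: bij_betw_def)
  have hJI: "h i \<in> I \<longleftrightarrow> i \<in> J" if "i < N" for i
    using hJ hc that by (auto simp: bij_betw_def)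
  define T where "T \<pi> = (\<lambda>i\<in>{..<N}. \<pi> (h i))" for \<pi> :: "nat \<Rightarrow> nat"
  have im: "h ` {i\<in>{..<N}. T \<pi> i = l} = {i\<in>{..<N}. \<pi> i = l}" for \<pi> l
  proof safe
    fix i assume "i < N" "l = \<pi> i"
    then obtain j where "j < N" "i = h j" using h by (auto simp: bij_betw_def)
    then show "i \<in> h ` {j \<in> {..<N}. T \<pi> j = \<pi> i}" using \<open>l = \<pi> i\<close> by (auto simp: T_def)
  qed (auto simp: T_def hin)
  have inj: "inj_on h A" if "A \<subseteq> {..<N}" for A
    using h that by (auto simp: bij_betw_def intro: inj_on_subset)
  have cardT: "card {i\<in>{..<N}. T \<pi> i = l} = card {i\<in>{..<N}. \<pi> i = l}" for \<pi> l
    using card_image[OF inj[of "{i\<in>{..<N}. T \<pi> i = l}"]] im[of \<pi> l] by (simp add: subset_eq)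
  show ?thesis
  proof (rule card_inj_on_le)
    show "inj_on T {\<pi>\<in>Parts N K. fold N \<pi> k = I}"
    proof (rule inj_onI, clarify)
      fix \<pi> \<rho> assume p: "\<pi> \<in> Parts N K" "\<rho> \<in> Parts N K" and eq: "T \<pi> = T \<rho>"
      show "\<pi> = \<rho>"
      proof
        fix i
        show "\<pi> i = \<rho> i"
        proof (cases "i < N")
          case True
          then obtain j where "j < N" "i = h j" using h by (auto simp: bij_betw_def)
          then show ?thesis using fun_cong[OF eq, of j] by (simp add: T_def)
        next
          case False
          then show ?thesis using p by (auto simp: Parts_def PiE_iff extensional_def)
        qed
      qed
    qed
    show "T ` {\<pi>\<in>Parts N K. fold N \<pi> k = I} \<subseteq> {\<pi>\<in>Parts N K. fold N \<pi> k = J}"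
    proof (safe)
      fix \<pi> assume "\<pi> \<in> Parts N K"
      then show "T \<pi> \<in> Parts N K"
        unfolding Parts_def mem_Collect_eq cardT using hin by (auto simp: T_def)
    next
      fix \<pi> x assume "I = fold N \<pi> k"
      then have "{i\<in>{..<N}. \<pi> i = k} = I" by (simp add: fold_def)
      then have *: "\<pi> i = k \<longleftrightarrow> i \<in> I" if "i < N" for i using that by auto
      { assume "x \<in> fold N (T \<pi>) k"
        then show "x \<in> J" using *[of "h x"] hJI hin by (auto simp: fold_def T_def) }
      { assume "x \<in> J"
        then show "x \<in> fold N (T \<pi>) k" using *[of "h x"] hJI[of x] hin[of x] sub by (auto simp: fold_def T_def) }
    qed
    show "finite {\<pi>\<in>Parts N K. fold N \<pi> k = J}" using finite_Parts by auto
  qed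
qed

text \<open>The k-th fold of a uniform partition is a uniform subset of size N / K. This connects
  condition (e), stated for a random subset, with the folds that the estimators use.\<close>

lemma average_over_folds:
  fixes f :: "nat set \<Rightarrow> real"
  assumes k: "k < K"
  shows "(\<Sum>\<pi>\<in>Parts N K. f (fold N \<pi> k)) / card (Parts N K)
     = (if Parts N K = {} then 0 else (\<Sum>I\<in>Subs N (N div K). f I) / card (Subs N (N div K)))"
proof (cases "Parts N K = {}")
  case False
  let ?S = "Subs N (N div K)"
  define c where "c I = card {\<pi>\<in>Parts N K. fold N \<pi> k = I}" for I
  obtain I0 where I0: "I0 \<in> ?S" using False fold_in_Subs k by blast
  have c: "c I = c I0" if "I \<in> ?S" for I
    unfolding c_def by (rule le_antisym card_Parts_with_fold_le[OF that I0] card_Parts_with_fold_le[OF I0 that])+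
  have *: "(\<Sum>\<pi>\<in>Parts N K. g (fold N \<pi> k)) = c I0 * (\<Sum>I\<in>?S. g I)" for g :: "nat set \<Rightarrow> real"
  proof -
    have "(\<Sum>\<pi>\<in>Parts N K. g (fold N \<pi> k)) = (\<Sum>I\<in>?S. \<Sum>\<pi>\<in>{\<pi>\<in>Parts N K. fold N \<pi> k = I}. g (fold N \<pi> k))"
      using fold_in_Subs k by (intro sum.group[symmetric] finite_Parts finite_Subs) blast
    also have "\<dots> = (\<Sum>I\<in>?S. c I * g I)" by (intro sum.cong refl) (simp add: c_def)
    also have "\<dots> = (\<Sum>I\<in>?S. c I0 * g I)" by (intro sum.cong refl) (simp add: c)
    finally show ?thesis by (simp add: sum_distrib_left)
  qed
  \<comment> \<open>The constant function shows that the common multiplicity \<open>c I0\<close> is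
    the quotient of the two cardinalities, so no multinomial count is required.\<close>
  from *[of "\<lambda>_. 1"] have card: "real (card (Parts N K)) = c I0 * card ?S" by simp
  moreover have "card (Parts N K) > 0" using False finite_Parts by (simp add: card_gt_0_iff)
  then have "c I0 \<noteq> 0" using card by (cases "c I0 = 0") auto
  ultimately show ?thesis using *[of f] False by simp
qed simp

subsection \<open>A central limit theorem for triangular arrays\<close>

text \<open>The law changes with n, so the classical theorem for a fixed distribution does not
  apply. A uniform bound on moments of order p > 2 gives a Lyapunov-type error for the
  characteristic functions, and Levy continuity concludes.\<close>

lemma triangular_clt:
  fixes f :: "nat \<Rightarrow> 'a \<Rightarrow> real" and N :: "nat \<Rightarrow> nat"
  assumes Q: "\<And>n. prob_space (Q n)" and f[measurable]: "\<And>n. f n \<in> borel_measurable (Q n)"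
    and mean: "\<And>n. (\<integral>v. f n v \<partial>Q n) = 0"
    and sq: "\<And>n. integrable (Q n) (\<lambda>v. (f n v)\<^sup>2)" "\<And>n. (\<integral>v. (f n v)\<^sup>2 \<partial>Q n) = 1"
    and p: "p > 2" "\<And>n. integrable (Q n) (\<lambda>v. \<bar>f n v\<bar> powr p)" "\<And>n. (\<integral>v. \<bar>f n v\<bar> powr p \<partial>Q n) \<le> B"
    and N: "filterlim N at_top sequentially"
  shows "weak_conv_m (\<lambda>n. distr (PiM {..<N n} (\<lambda>_. Q n)) borel (\<lambda>w. (\<Sum>i<N n. f n (w i)) / sqrt (N n))) std_normal_distribution"
proof (rule levy_continuity)
  interpret Q: prob_space "Q n" for n by (rule Q)
  interpret S: prob_space "PiM {..<N n} (\<lambda>_. Q n)" for n by (rule prob_space_PiM) (rule Q)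
  let ?D = "\<lambda>n. distr (PiM {..<N n} (\<lambda>_. Q n)) borel (\<lambda>w. (\<Sum>i<N n. f n (w i)) / sqrt (N n))"
  show "real_distribution (?D n)" for n by (rule S.real_distribution_distr) simp
  show "real_distribution std_normal_distribution" by (rule real_dist_normal_dist)
  fix t :: real
  define s where "s n = t / sqrt (N n)" for n
  define \<mu> where "\<mu> n = distr (Q n) borel (f n)" for n
  interpret mu: real_distribution "\<mu> n" for n unfolding \<mu>_def by (rule Q.real_distribution_distr) simp
  have charD: "char (?D n) t = char (\<mu> n) (s n) ^ N n" for n
  proof -
    interpret P: product_sigma_finite "\<lambda>_. Q n" by unfold_locales
    have "char (?D n) t = (CLINT w|PiM {..<N n} (\<lambda>_. Q n). iexp (t * ((\<Sum>i<N n. f n (w i)) / sqrt (N n))))"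
      unfolding char_def by (subst integral_distr) auto
    also have "\<dots> = (CLINT w|PiM {..<N n} (\<lambda>_. Q n). (\<Prod>i<N n. iexp (s n * f n (w i))))"
      by (simp add: s_def exp_sum[symmetric] sum_distrib_left sum_distrib_right sum_divide_distrib)
    also have "\<dots> = (\<Prod>i<N n. CLINT v|Q n. iexp (s n * f n v))"
      by (rule P.product_integral_prod) (auto intro!: Q.integrable_const_bound[where B=1])
    also have "\<dots> = char (\<mu> n) (s n) ^ N n"
      unfolding char_def \<mu>_def by (subst integral_distr) auto
    finally show ?thesis .
  qed
  \<comment> \<open>The Taylor remainder min(6 x^2, |u| |x|^3) interpolates only between the powers
    2 and 3, so the exponent is capped at 3.\<close>
  define p' where "p' = min p 3"
  have p': "p' > 2" "p' \<le> p" "p' \<le> 3" using p by (auto simp: p'_def)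
  have B0: "B \<ge> 0" using p(3)[of 0] by (rule order_trans[rotated]) auto
  define r where "r n = 6 * \<bar>s n\<bar> powr (p' - 2) * (1 + B)" for n
  have f1: "integrable (Q n) (f n)" for n
    by (rule Q.square_integrable_imp_integrable[OF f sq(1)])
  \<comment> \<open>With y = |u x| the minimum is at most 6 x^2 min(1, y). As 0 < p' - 2 \<le> 1,
    the factor min(1, y) is at most y to the power p' - 2, whether y is below or above 1.\<close>
  have pt: "min (6 * x\<^sup>2) (\<bar>u\<bar> * \<bar>x\<bar>^3) \<le> 6 * \<bar>u\<bar> powr (p' - 2) * (1 + \<bar>x\<bar> powr p)" for u x :: real
  proof (cases "u = 0 \<or> x = 0")
    case False
    define y where "y = \<bar>u\<bar> * \<bar>x\<bar>"
    have y: "y > 0" using False by (simp add: y_def)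
    have eq: "\<bar>u\<bar> powr (p' - 2) * \<bar>x\<bar> powr p' = x\<^sup>2 * y powr (p' - 2)"
      using False by (simp add: y_def powr_mult powr_diff powr_numeral field_simps)
    have "min (6 * x\<^sup>2) (\<bar>u\<bar> * \<bar>x\<bar>^3) \<le> 6 * (x\<^sup>2 * y powr (p' - 2))"
    proof (cases "y \<le> 1")
      case True
      have "\<bar>u\<bar> * \<bar>x\<bar>^3 = x\<^sup>2 * y" by (simp add: y_def power2_eq_square power3_eq_cube)
      also have "\<dots> \<le> 6 * (x\<^sup>2 * y powr (p' - 2))"
      proof -
        have "y powr 1 \<le> y powr (p' - 2)" using True y p' by (intro powr_mono') auto
        then have "x\<^sup>2 * y \<le> x\<^sup>2 * y powr (p' - 2)" using y by (intro mult_left_mono) auto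
        also have "\<dots> \<le> 6 * (x\<^sup>2 * y powr (p' - 2))" by simp
        finally show ?thesis .
      qed
      finally show ?thesis by simp
    next
      case False
      have "1 \<le> y powr (p' - 2)" using False p' by (intro ge_one_powr_ge_zero) auto
      then have "6 * x\<^sup>2 * 1 \<le> 6 * x\<^sup>2 * y powr (p' - 2)" by (intro mult_left_mono) auto
      then show ?thesis by simp
    qed
    also have "\<dots> = 6 * \<bar>u\<bar> powr (p' - 2) * \<bar>x\<bar> powr p'" using eq by simp
    also have "\<dots> \<le> 6 * \<bar>u\<bar> powr (p' - 2) * (1 + \<bar>x\<bar> powr p)"
    proof (intro mult_left_mono)
      show "\<bar>x\<bar> powr p' \<le> 1 + \<bar>x\<bar> powr p"
      proof (cases "\<bar>x\<bar> \<ge> 1")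
        case True then have "\<bar>x\<bar> powr p' \<le> \<bar>x\<bar> powr p" using p' by (intro powr_mono) auto
        then show ?thesis by simp
      next
        case False then have "\<bar>x\<bar> powr p' \<le> 1" using p' by (intro powr_le1) auto
        then show ?thesis by (simp add: add_increasing2)
      qed
    qed auto
    finally show ?thesis .
  qed auto
  have step: "cmod (char (\<mu> n) (s n) - (1 - (s n)\<^sup>2 / 2)) \<le> (s n)\<^sup>2 / 6 * r n" for n
  proof -
    have "cmod (char (\<mu> n) (s n) - (1 - (s n)\<^sup>2 * 1 / 2)) \<le> (s n)\<^sup>2 / 6 * Q.expectation n (\<lambda>x. min (6 * (f n x)\<^sup>2) (\<bar>s n\<bar> * \<bar>f n x\<bar>^3))"
      by (rule Q.char_approx3'[OF f f1 sq(1) mean _ \<mu>_def]) (simp add: mean sq)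
    also have "\<dots> \<le> (s n)\<^sup>2 / 6 * Q.expectation n (\<lambda>x. 6 * \<bar>s n\<bar> powr (p' - 2) * (1 + \<bar>f n x\<bar> powr p))"
    proof (intro mult_left_mono integral_mono)
      show "integrable (Q n) (\<lambda>x. min (6 * (f n x)\<^sup>2) (\<bar>s n\<bar> * \<bar>f n x\<bar>^3))"
        using sq(1)[of n] by (rule Bochner_Integration.integrable_bound[where f="\<lambda>x. 6 * (f n x)\<^sup>2", OF integrable_mult_right]) auto
    qed (use pt p(2) in auto)
    also have "Q.expectation n (\<lambda>x. 6 * \<bar>s n\<bar> powr (p' - 2) * (1 + \<bar>f n x\<bar> powr p)) = 6 * \<bar>s n\<bar> powr (p' - 2) * (1 + Q.expectation n (\<lambda>x. \<bar>f n x\<bar> powr p))"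
      using p(2) by (simp add: Q.prob_space)
    also have "(s n)\<^sup>2 / 6 * \<dots> \<le> (s n)\<^sup>2 / 6 * r n"
      unfolding r_def using p(3) by (intro mult_left_mono) auto
    finally show ?thesis by simp
  qed
  have Nr: "filterlim (\<lambda>n. real (N n)) at_top sequentially"
    using filterlim_compose[OF filterlim_real_sequentially N] .
  then have s0: "s \<longlonglongrightarrow> 0" unfolding s_def
    by (intro tendsto_divide_0[OF tendsto_const] filterlim_at_top_imp_at_infinity filterlim_compose[OF sqrt_at_top])
  \<comment> \<open>The comparison of N-th powers needs both bases in the unit disc: |1 - t^2 / (2
    N)| \<le> 1 amounts to N \<ge> t^2 / 4, and the additional 1 keeps N positive.\<close>
  have main: "\<forall>\<^sub>F n in sequentially. cmod (char (?D n) t - complex_of_real ((1 + (-(t^2) / 2) / N n)^N n)) \<le> t\<^sup>2 / 6 * r n"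
    using filterlim_at_top[THEN iffD1, rule_format, OF Nr, of "t\<^sup>2 / 4 + 1"]
  proof eventually_elim
    case (elim n)
    then have n: "real (N n) > 0" "real (N n) \<ge> t\<^sup>2/4"
      using zero_le_power2[of t] by linarith+
    have s2: "(s n)\<^sup>2 = t\<^sup>2 / N n" using n by (simp add: s_def power_divide)
    have "norm (char (\<mu> n) (s n) ^ N n - (complex_of_real (1 + (-(t^2) / 2) / N n))^N n) \<le>
         N n * norm (char (\<mu> n) (s n) - (complex_of_real (1 + (-(t^2) / 2) / N n)))"
      using n by (auto intro!: norm_power_diff mu.cmod_char_le_1 abs_leI
               simp del: of_real_diff simp: of_real_diff[symmetric] divide_le_eq)
    also have "\<dots> \<le> N n * ((s n)\<^sup>2 / 6 * r n)"
      using step[of n] by (intro mult_left_mono) (simp_all add: s2 mult_ac)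
    also have "\<dots> = t\<^sup>2 / 6 * r n" using n by (simp add: s2)
    finally show ?case by (simp add: charD)
  qed
  have "(\<lambda>n. t\<^sup>2 / 6 * r n) \<longlonglongrightarrow> t\<^sup>2 / 6 * (6 * 0 * (1 + B))"
    unfolding r_def using p' by (intro tendsto_intros tendsto_powr'[where a=0 and b="p' - 2", THEN tendsto_eq_rhs] tendsto_rabs_zero s0) auto
  then have r0: "(\<lambda>n. t\<^sup>2 / 6 * r n) \<longlonglongrightarrow> 0" by simp
  have "(\<lambda>n. complex_of_real ((1 + (-(t^2) / 2) / n)^n)) \<longlonglongrightarrow> complex_of_real (exp (-(t^2) / 2))"
    by (rule isCont_tendsto_compose [OF _ tendsto_exp_limit_sequentially]) auto
  from filterlim_compose[OF this N]
  have "(\<lambda>n. char (?D n) t) \<longlonglongrightarrow> complex_of_real (exp (-(t^2) / 2))"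
    by (rule Lim_transform) (rule Lim_null_comparison [OF main r0])
  then show "(\<lambda>n. char (?D n) t) \<longlonglongrightarrow> char std_normal_distribution t"
    by (simp add: char_std_normal_distribution)
qed

subsection \<open>Moments in a partially linear model\<close>

text \<open>Prepares conditional Jensen for q-th moments. Convexity is taken from positive
  arguments; if x or y is 0, the inequality reduces to s powr q \<le> s for s in (0, 1).\<close>

lemma convex_on_abs_powr:
  assumes q: "q \<ge> (1::real)"
  shows "convex_on UNIV (\<lambda>x::real. \<bar>x\<bar> powr q)"
proof (rule convex_onI)
  fix t x y :: real assume t: "0 < t" "t < 1"
  have tp: "(s * a) powr q \<le> s * a powr q" if "0 < s" "s < 1" "0 \<le> a" for s a :: real
  proof -
    have "s powr q \<le> s powr 1" using that q by (intro powr_mono') auto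
    then show ?thesis using that by (simp add: powr_mult mult_right_mono)
  qed
  have "\<bar>(1 - t) * x + t * y\<bar> powr q \<le> ((1 - t) * \<bar>x\<bar> + t * \<bar>y\<bar>) powr q"
    using t q by (intro powr_mono2) (auto intro!: order_trans[OF abs_triangle_ineq] simp: abs_mult)
  also have "\<dots> \<le> (1 - t) * \<bar>x\<bar> powr q + t * \<bar>y\<bar> powr q"
  proof (cases "x = 0 \<or> y = 0")
    case True then show ?thesis using tp[of t "\<bar>y\<bar>"] tp[of "1 - t" "\<bar>x\<bar>"] t by auto
  next
    case False
    then show ?thesis
      using convex_onD[OF powr_convex[OF q], of t "\<bar>x\<bar>" "\<bar>y\<bar>"] t by simp
  qed
  finally show "\<bar>(1 - t) *\<^sub>R x + t *\<^sub>R y\<bar> powr q \<le> (1 - t) * \<bar>x\<bar> powr q + t * \<bar>y\<bar> powr q" by simp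
qed simp

lemma abs_add_powr_le:
  fixes a b :: real assumes "q > 0"
  shows "\<bar>a + b\<bar> powr q \<le> 2 powr q * (\<bar>a\<bar> powr q + \<bar>b\<bar> powr q)"
proof -
  have "\<bar>a + b\<bar> powr q \<le> (2 * max \<bar>a\<bar> \<bar>b\<bar>) powr q" using assms by (intro powr_mono2) auto
  also have "\<dots> = 2 powr q * max \<bar>a\<bar> \<bar>b\<bar> powr q" by (simp add: powr_mult)
  also have "\<dots> \<le> 2 powr q * (\<bar>a\<bar> powr q + \<bar>b\<bar> powr q)" by (intro mult_left_mono) (auto simp: max_def)
  finally show ?thesis .
qed

lemma abs_mult_le_sum_squares: "\<bar>a * b\<bar> \<le> a\<^sup>2 + (b::real)\<^sup>2"
proof -
  have "2 * (\<bar>a\<bar> * \<bar>b\<bar>) \<le> a\<^sup>2 + b\<^sup>2" using sum_squares_bound[of "\<bar>a\<bar>" "\<bar>b\<bar>"] by simp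
  moreover have "0 \<le> \<bar>a\<bar> * \<bar>b\<bar>" by simp
  ultimately show ?thesis unfolding abs_mult by linarith
qed

lemma power_le_one_plus_powr:
  fixes x :: real assumes "real k \<le> q"
  shows "\<bar>x\<bar> ^ k \<le> 1 + \<bar>x\<bar> powr q"
proof (cases "\<bar>x\<bar> \<ge> 1")
  case True
  then have "\<bar>x\<bar> ^ k = \<bar>x\<bar> powr real k" by (intro powr_realpow[symmetric]) auto
  also have "\<dots> \<le> \<bar>x\<bar> powr q" using True assms by (intro powr_mono) auto
  finally show ?thesis by simp
next
  case False
  then have "\<bar>x\<bar> ^ k \<le> 1" by (intro power_le_one) auto
  then show ?thesis by (simp add: add_increasing2)
qed

text \<open>\<open>Lnorm\<close> is infinite for a divergent integral, so a finite bound carries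
  integrability with it.\<close>

lemma Lnorm_leD:
  assumes L: "Lnorm M q f \<le> ennreal b" and b: "b \<ge> 0" and q: "q > 0" and f[measurable]: "f \<in> borel_measurable M"
  shows "integrable M (\<lambda>x. \<bar>f x\<bar> powr q)" "(\<integral>x. \<bar>f x\<bar> powr q \<partial>M) \<le> b powr q"
proof -
  let ?I = "\<integral>\<^sup>+x. ennreal (\<bar>f x\<bar> powr q) \<partial>M"
  have fin: "?I \<noteq> \<infinity>" using L by (auto simp: Lnorm_def top_unique split: if_splits)
  then have "ennreal (enn2real ?I powr (1/q)) \<le> ennreal b" using L by (simp add: Lnorm_def)
  then have "enn2real ?I powr (1/q) \<le> b" using b by simp
  then have "(enn2real ?I powr (1/q)) powr q \<le> b powr q" using q by (intro powr_mono2) auto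
  then have le: "enn2real ?I \<le> b powr q" using q by (simp add: powr_powr)
  show "integrable M (\<lambda>x. \<bar>f x\<bar> powr q)"
    using fin by (intro integrableI_nonneg) (auto simp: top.not_eq_extremum)
  have "(\<integral>x. \<bar>f x\<bar> powr q \<partial>M) = enn2real ?I" by (rule integral_eq_nn_integral) auto
  with le show "(\<integral>x. \<bar>f x\<bar> powr q \<partial>M) \<le> b powr q" by simp
qed

text \<open>Conditions (a) to (d) for a single law; (e) is left out because it concerns samples. The
  bounds defined in this locale involve only c, C and q, which is the source of uniformity.\<close>

locale plr_law = prob_space P for P :: "'x obs measure" +
  fixes MX :: "'x measure" and \<theta> c C q :: real and g m :: "'x \<Rightarrow> real"
  assumes sets_P: "sets P = sets (obs_space MX)"
    and g[measurable]: "g \<in> borel_measurable MX" and m[measurable]: "m \<in> borel_measurable MX"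
    and g2': "integrable (lawX MX P) (\<lambda>x. (g x)\<^sup>2)" and m2': "integrable (lawX MX P) (\<lambda>x. (m x)\<^sup>2)"
    and U_cond: "AE w in P. real_cond_exp P (sigma_DX MX) (\<lambda>w. Yof w - Dof w * \<theta> - g (Xof w)) w = 0"
    and V_cond: "AE w in P. real_cond_exp P (sigma_X MX) (\<lambda>w. Dof w - m (Xof w)) w = 0"
    and YD: "Lnorm P q Yof + Lnorm P q Dof \<le> ennreal C"
    and UV_lower: "Lnorm P 2 (\<lambda>w. (Yof w - Dof w * \<theta> - g (Xof w)) * (Dof w - m (Xof w))) \<ge> ennreal (c\<^sup>2)"
    and V_lower': "(\<integral>w. (Dof w - m (Xof w))\<^sup>2 \<partial>P) \<ge> c"
    and U_var: "AE w in P. \<bar>real_cond_exp P (sigma_X MX) (\<lambda>w. (Yof w - Dof w * \<theta> - g (Xof w))\<^sup>2) w\<bar> \<le> C"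
    and V_var: "AE w in P. \<bar>real_cond_exp P (sigma_X MX) (\<lambda>w. (Dof w - m (Xof w))\<^sup>2) w\<bar> \<le> C"
    and cC: "c > 0" "C > 0" and q: "q > 4"
begin

definition "U w = Yof w - Dof w * \<theta> - g (Xof w)"
definition "V w = Dof w - m (Xof w)"

lemma measurable_obs[measurable]:
  "Yof \<in> borel_measurable P" "Dof \<in> borel_measurable P" "Xof \<in> measurable P MX"
  unfolding measurable_cong_sets[OF sets_P refl] by (simp_all add: obs_space_def Yof_def[abs_def] Dof_def[abs_def] Xof_def[abs_def])

lemma measurable_UV[measurable]: "U \<in> borel_measurable P" "V \<in> borel_measurable P"
  by (simp_all add: U_def[abs_def] V_def[abs_def])

lemma space_P: "space P = space (obs_space MX)"
  using sets_P by (rule sets_eq_imp_space_eq)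

lemma Xof_space: "w \<in> space P \<Longrightarrow> Xof w \<in> space MX"
  using measurable_space[OF measurable_obs(3)] .

lemma sigma_X: "finite_measure_subalgebra P (sigma_X MX)"
proof
  show "subalgebra P (sigma_X MX)"
    unfolding subalgebra_def sigma_X_def
    using measurable_obs(3) Xof_space
    by (auto simp: sets_vimage_algebra2 space_P[symmetric] intro!: measurable_sets)
qed

lemma sigma_DX: "finite_measure_subalgebra P (sigma_DX MX)"
proof
  have [measurable]: "(\<lambda>w. (Dof w, Xof w)) \<in> measurable P (borel \<Otimes>\<^sub>M MX)" by measurable
  show "subalgebra P (sigma_DX MX)"
    unfolding subalgebra_def sigma_DX_def
    by (subst sets_vimage_algebra2)
       (auto simp: space_P[symmetric] space_pair_measure dest: Xof_space intro!: measurable_sets)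
qed

sublocale X: finite_measure_subalgebra P "sigma_X MX" by (rule sigma_X)
sublocale DX: finite_measure_subalgebra P "sigma_DX MX" by (rule sigma_DX)

lemma measurable_sigma_X: "f \<in> borel_measurable MX \<Longrightarrow> (\<lambda>w. f (Xof w)) \<in> borel_measurable (sigma_X MX)"
  by (rule measurable_compose[rotated], assumption, unfold sigma_X_def, rule measurable_vimage_algebra1)
     (auto simp: space_P[symmetric] dest: Xof_space)

lemma measurable_sigma_DX:
  "f \<in> borel_measurable (borel \<Otimes>\<^sub>M MX) \<Longrightarrow> (\<lambda>w. f (Dof w, Xof w)) \<in> borel_measurable (sigma_DX MX)"
  by (rule measurable_compose[rotated], assumption, unfold sigma_DX_def, rule measurable_vimage_algebra1)
     (auto simp: space_P[symmetric] space_pair_measure dest: Xof_space)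

lemma integrable_mult_of_squares:
  fixes a b :: "'x obs \<Rightarrow> real"
  assumes [measurable]: "a \<in> borel_measurable P" "b \<in> borel_measurable P"
    and "integrable P (\<lambda>w. (a w)\<^sup>2)" "integrable P (\<lambda>w. (b w)\<^sup>2)"
  shows "integrable P (\<lambda>w. a w * b w)"
proof (rule Bochner_Integration.integrable_bound)
  show "integrable P (\<lambda>w. (a w)\<^sup>2 + (b w)\<^sup>2)" using assms by simp
  show "AE w in P. norm (a w * b w) \<le> norm ((a w)\<^sup>2 + (b w)\<^sup>2)"
    using abs_mult_le_sum_squares by (auto intro!: AE_I2)
qed simp

lemma integrable_sq_add:
  fixes a b :: "'x obs \<Rightarrow> real"
  assumes [measurable]: "a \<in> borel_measurable P" "b \<in> borel_measurable P"
    and "integrable P (\<lambda>w. (a w)\<^sup>2)" "integrable P (\<lambda>w. (b w)\<^sup>2)"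
  shows "integrable P (\<lambda>w. (a w + b w)\<^sup>2)" "integrable P (\<lambda>w. (a w - b w)\<^sup>2)"
  using assms integrable_mult_of_squares[OF assms] by (simp_all add: power2_sum power2_diff mult.assoc)

lemma YD_moments:
  "integrable P (\<lambda>w. \<bar>Yof w\<bar> powr q)" "(\<integral>w. \<bar>Yof w\<bar> powr q \<partial>P) \<le> C powr q"
  "integrable P (\<lambda>w. \<bar>Dof w\<bar> powr q)" "(\<integral>w. \<bar>Dof w\<bar> powr q \<partial>P) \<le> C powr q"
proof -
  have "Lnorm P q Yof \<le> ennreal C" "Lnorm P q Dof \<le> ennreal C"
    using YD by (auto intro: order_trans[rotated])
  then show "integrable P (\<lambda>w. \<bar>Yof w\<bar> powr q)" "(\<integral>w. \<bar>Yof w\<bar> powr q \<partial>P) \<le> C powr q"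
    "integrable P (\<lambda>w. \<bar>Dof w\<bar> powr q)" "(\<integral>w. \<bar>Dof w\<bar> powr q \<partial>P) \<le> C powr q"
    using cC q by (auto intro: Lnorm_leD)
qed

lemma power_moment:
  fixes f :: "'x obs \<Rightarrow> real"
  assumes f: "f \<in> borel_measurable P" and int: "integrable P (\<lambda>w. \<bar>f w\<bar> powr q)" and k: "k \<le> 4"
  shows "integrable P (\<lambda>w. \<bar>f w\<bar> ^ k)" "(\<integral>w. \<bar>f w\<bar> ^ k \<partial>P) \<le> 1 + (\<integral>w. \<bar>f w\<bar> powr q \<partial>P)"
proof -
  have le: "\<bar>f w\<bar> ^ k \<le> 1 + \<bar>f w\<bar> powr q" for w
    using k q by (intro power_le_one_plus_powr) auto
  show i: "integrable P (\<lambda>w. \<bar>f w\<bar> ^ k)"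
    by (rule Bochner_Integration.integrable_bound[where f="\<lambda>w. 1 + \<bar>f w\<bar> powr q"]) (use f int le in \<open>auto simp: abs_of_nonneg add_nonneg_nonneg\<close>)
  have "(\<integral>w. \<bar>f w\<bar> ^ k \<partial>P) \<le> (\<integral>w. 1 + \<bar>f w\<bar> powr q \<partial>P)" using i int le by (intro integral_mono) auto
  also have "\<dots> = 1 + (\<integral>w. \<bar>f w\<bar> powr q \<partial>P)" using int by (simp add: prob_space)
  finally show "(\<integral>w. \<bar>f w\<bar> ^ k \<partial>P) \<le> 1 + (\<integral>w. \<bar>f w\<bar> powr q \<partial>P)" .
qed

lemma square_moments:
  "integrable P (\<lambda>w. (Yof w)\<^sup>2)" "(\<integral>w. (Yof w)\<^sup>2 \<partial>P) \<le> 1 + C powr q"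
  "integrable P (\<lambda>w. (Dof w)\<^sup>2)" "(\<integral>w. (Dof w)\<^sup>2 \<partial>P) \<le> 1 + C powr q"
  using power_moment[OF _ YD_moments(1), of 2] power_moment[OF _ YD_moments(3), of 2] YD_moments(2,4) by auto

section \<open>Second moments, orthogonality of the errors, conditional variances\<close>

lemma g2: "integrable P (\<lambda>w. (g (Xof w))\<^sup>2)" and m2: "integrable P (\<lambda>w. (m (Xof w))\<^sup>2)"
  using g2' m2' unfolding lawX_def by (auto simp: integrable_distr_eq)

lemma U2: "integrable P (\<lambda>w. (U w)\<^sup>2)" and V2: "integrable P (\<lambda>w. (V w)\<^sup>2)"
proof -
  have "integrable P (\<lambda>w. (Dof w * \<theta>)\<^sup>2)" using square_moments by (simp add: power_mult_distrib)
  then show "integrable P (\<lambda>w. (U w)\<^sup>2)" unfolding U_def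
    using square_moments g2 by (intro integrable_sq_add) auto
  show "integrable P (\<lambda>w. (V w)\<^sup>2)" unfolding V_def
    using square_moments m2 by (intro integrable_sq_add) auto
qed

lemma U1: "integrable P U" and V1: "integrable P V"
  using U2 V2 by (auto intro: square_integrable_imp_integrable)

lemma integral_U_mult:
  assumes f[measurable]: "f \<in> borel_measurable (borel \<Otimes>\<^sub>M MX)" and int: "integrable P (\<lambda>w. f (Dof w, Xof w) * U w)"
  shows "(\<integral>w. f (Dof w, Xof w) * U w \<partial>P) = 0"
proof -
  have "(\<integral>w. f (Dof w, Xof w) * U w \<partial>P) = (\<integral>w. f (Dof w, Xof w) * real_cond_exp P (sigma_DX MX) U w \<partial>P)"
    using DX.real_cond_exp_intg(2)[OF int measurable_sigma_DX[OF f]] by simp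
  also have "\<dots> = (\<integral>w. 0 \<partial>P)"
    using U_cond by (intro integral_cong_AE) (auto simp: U_def[abs_def])
  finally show ?thesis by simp
qed

lemma integral_V_mult:
  assumes f[measurable]: "f \<in> borel_measurable MX" and int: "integrable P (\<lambda>w. f (Xof w) * V w)"
  shows "(\<integral>w. f (Xof w) * V w \<partial>P) = 0"
proof -
  have "(\<integral>w. f (Xof w) * V w \<partial>P) = (\<integral>w. f (Xof w) * real_cond_exp P (sigma_X MX) V w \<partial>P)"
    using X.real_cond_exp_intg(2)[OF int measurable_sigma_X[OF f]] by simp
  also have "\<dots> = (\<integral>w. 0 \<partial>P)"
    using V_cond by (intro integral_cong_AE) (auto simp: V_def[abs_def])
  finally show ?thesis by simp
qed

text \<open>Integrability of the product is itself a conclusion. The argument therefore runs through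
  nonnegative extended integrals, where the conditional expectation can be used before finiteness is
  known.\<close>

lemma square_mult_of_cond_var:
  assumes f[measurable]: "f \<in> borel_measurable MX" and f2: "integrable P (\<lambda>w. (f (Xof w))\<^sup>2)"
    and G[measurable]: "G \<in> borel_measurable P" and G2: "integrable P (\<lambda>w. (G w)\<^sup>2)"
    and var: "AE w in P. \<bar>real_cond_exp P (sigma_X MX) (\<lambda>w. (G w)\<^sup>2) w\<bar> \<le> C"
  shows "integrable P (\<lambda>w. (f (Xof w) * G w)\<^sup>2)"
    "(\<integral>w. (f (Xof w) * G w)\<^sup>2 \<partial>P) \<le> C * (\<integral>w. (f (Xof w))\<^sup>2 \<partial>P)"
proof -
  let ?N = "nn_cond_exp P (sigma_X MX) (\<lambda>w. ennreal ((G w)\<^sup>2))"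
  have "(\<integral>\<^sup>+w. 1 * ?N w \<partial>P) = (\<integral>\<^sup>+w. 1 * ennreal ((G w)\<^sup>2) \<partial>P)"
    by (rule X.nn_cond_exp_intg) auto
  also have "\<dots> < \<infinity>" using G2 by (simp add: integrable_iff_bounded)
  finally have "AE w in P. ?N w \<noteq> \<infinity>" by (intro nn_integral_PInf_AE) auto
  moreover have "AE w in P. 0 = nn_cond_exp P (sigma_X MX) (\<lambda>w. 0) w"
    by (rule X.nn_cond_exp_F_meas) auto
  \<comment> \<open>\<open>real_cond_exp\<close> is the difference of the \<open>enn2real\<close>
    values for the positive and the negative part. The negative part of a square is 0, and since
    \<open>enn2real\<close> sends infinity to 0, finiteness of \<open>?N\<close> must be known
    before the bound \<open>C\<close> can be transferred to it.\<close>
  ultimately have N: "AE w in P. ?N w \<le> ennreal C"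
    using var
  proof eventually_elim
    case (elim w)
    have "enn2real (?N w) \<le> C"
      using elim(2,3) unfolding real_cond_exp_def by (simp add: ennreal_neg)
    then show ?case using elim(1) by (metis ennreal_enn2real_if ennreal_leI infinity_ennreal_def)
  qed
  have "(\<integral>\<^sup>+w. ennreal ((f (Xof w) * G w)\<^sup>2) \<partial>P) = (\<integral>\<^sup>+w. ennreal ((f (Xof w))\<^sup>2) * ennreal ((G w)\<^sup>2) \<partial>P)"
    by (simp add: power_mult_distrib ennreal_mult)
  also have "\<dots> = (\<integral>\<^sup>+w. ennreal ((f (Xof w))\<^sup>2) * ?N w \<partial>P)"
    using measurable_sigma_X[OF f] by (intro X.nn_cond_exp_intg[symmetric]) auto
  also have "\<dots> \<le> (\<integral>\<^sup>+w. ennreal C * ennreal ((f (Xof w))\<^sup>2) \<partial>P)"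
    using N by (intro nn_integral_mono_AE) (auto elim!: eventually_mono simp: mult.commute[of "ennreal C"] intro: mult_left_mono)
  also have "\<dots> = ennreal C * ennreal (\<integral>w. (f (Xof w))\<^sup>2 \<partial>P)"
    using f2 by (simp add: nn_integral_cmult nn_integral_eq_integral)
  also have "\<dots> = ennreal (C * (\<integral>w. (f (Xof w))\<^sup>2 \<partial>P))" using cC by (simp add: ennreal_mult)
  finally have le: "(\<integral>\<^sup>+w. ennreal ((f (Xof w) * G w)\<^sup>2) \<partial>P) \<le> ennreal (C * (\<integral>w. (f (Xof w))\<^sup>2 \<partial>P))" .
  show int: "integrable P (\<lambda>w. (f (Xof w) * G w)\<^sup>2)"
    by (rule integrableI_nonneg) (auto intro: le_less_trans[OF le])
  show "(\<integral>w. (f (Xof w) * G w)\<^sup>2 \<partial>P) \<le> C * (\<integral>w. (f (Xof w))\<^sup>2 \<partial>P)"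
    using le cC int by (subst (asm) nn_integral_eq_integral) auto
qed

lemma fV:
  assumes f: "f \<in> borel_measurable MX" and f2: "integrable P (\<lambda>w. (f (Xof w))\<^sup>2)"
  shows "integrable P (\<lambda>w. (f (Xof w) * V w)\<^sup>2)"
    "(\<integral>w. (f (Xof w) * V w)\<^sup>2 \<partial>P) \<le> C * (\<integral>w. (f (Xof w))\<^sup>2 \<partial>P)"
    "(\<integral>w. f (Xof w) * V w \<partial>P) = 0"
proof -
  note [measurable] = f
  show "integrable P (\<lambda>w. (f (Xof w) * V w)\<^sup>2)"
    "(\<integral>w. (f (Xof w) * V w)\<^sup>2 \<partial>P) \<le> C * (\<integral>w. (f (Xof w))\<^sup>2 \<partial>P)"
    using square_mult_of_cond_var[OF f f2 _ V2] V_var by (auto simp: V_def[abs_def])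
  show "(\<integral>w. f (Xof w) * V w \<partial>P) = 0"
    using f2 V2 by (intro integral_V_mult f integrable_mult_of_squares) auto
qed

lemma fU:
  assumes f: "f \<in> borel_measurable MX" and f2: "integrable P (\<lambda>w. (f (Xof w))\<^sup>2)"
  shows "integrable P (\<lambda>w. (U w * f (Xof w))\<^sup>2)"
    "(\<integral>w. (U w * f (Xof w))\<^sup>2 \<partial>P) \<le> C * (\<integral>w. (f (Xof w))\<^sup>2 \<partial>P)"
    "(\<integral>w. U w * f (Xof w) \<partial>P) = 0"
proof -
  note [measurable] = f
  show "integrable P (\<lambda>w. (U w * f (Xof w))\<^sup>2)"
    "(\<integral>w. (U w * f (Xof w))\<^sup>2 \<partial>P) \<le> C * (\<integral>w. (f (Xof w))\<^sup>2 \<partial>P)"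
    using square_mult_of_cond_var[OF f f2 _ U2] U_var by (auto simp: U_def[abs_def] mult.commute)
  show "(\<integral>w. U w * f (Xof w) \<partial>P) = 0"
    using integral_U_mult[of "\<lambda>p. f (snd p)"] integrable_mult_of_squares[OF _ _ f2 U2] by (simp add: mult.commute)
qed

lemma integral_V2: "c \<le> (\<integral>w. (V w)\<^sup>2 \<partial>P)" "(\<integral>w. (V w)\<^sup>2 \<partial>P) \<le> C"
  using V_lower' fV(2)[of "\<lambda>_. 1"] by (auto simp: V_def[abs_def] prob_space)

lemma integral_UV: "(\<integral>w. U w * V w \<partial>P) = 0"
  using integral_U_mult[of "\<lambda>(d, x). d - m x"] integrable_mult_of_squares[OF _ _ V2 U2]
  by (simp add: V_def mult.commute)

text \<open>D - V = m(X) is orthogonal to V. This is why the two scores have the same limiting slope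
  although their \<open>psi_a\<close> differ.\<close>

lemma integral_DV: "(\<integral>w. Dof w * V w \<partial>P) = (\<integral>w. (V w)\<^sup>2 \<partial>P)"
proof -
  have "(\<integral>w. Dof w * V w \<partial>P) = (\<integral>w. m (Xof w) * V w + (V w)\<^sup>2 \<partial>P)"
    by (simp add: V_def power2_eq_square algebra_simps)
  also have "\<dots> = (\<integral>w. m (Xof w) * V w \<partial>P) + (\<integral>w. (V w)\<^sup>2 \<partial>P)"
    using V2 m2 integrable_mult_of_squares by (intro Bochner_Integration.integral_add) auto
  finally show ?thesis using fV(3)[OF m m2] by simp
qed

section \<open>Bound on the target parameter and moments of order q\<close>

definition "theta_bound = (1 + C powr q + C) / c"

text \<open>Multiplying the outcome equation by V and integrating removes g(X) and U, leaving E[Y V]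
  = \<theta> E[V^2]. The left side is at most E[Y^2] + E[V^2] \<le> (1 + C powr q) + C in modulus,
  and E[V^2] \<ge> c.\<close>

lemma theta_bound: "\<bar>\<theta>\<bar> \<le> theta_bound"
proof -
  let ?J = "\<integral>w. (V w)\<^sup>2 \<partial>P"
  have int: "integrable P (\<lambda>w. Yof w * V w)" "integrable P (\<lambda>w. Dof w * V w)" "integrable P (\<lambda>w. g (Xof w) * V w)" "integrable P (\<lambda>w. U w * V w)"
    using square_moments V2 g2 U2 by (auto intro!: integrable_mult_of_squares)
  have "(\<integral>w. Yof w * V w \<partial>P) = (\<integral>w. \<theta> * (Dof w * V w) + g (Xof w) * V w + U w * V w \<partial>P)"
    by (simp add: U_def algebra_simps)
  also have "\<dots> = \<theta> * ?J"
    using int by (simp add: integral_DV integral_UV fV(3)[OF g g2])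
  finally have eq: "(\<integral>w. Yof w * V w \<partial>P) = \<theta> * ?J" .
  have "\<bar>\<theta>\<bar> * c \<le> \<bar>\<theta> * ?J\<bar>" using integral_V2 cC by (simp add: abs_mult mult_left_mono)
  also have "\<dots> \<le> (\<integral>w. \<bar>Yof w * V w\<bar> \<partial>P)" unfolding eq[symmetric] by (rule integral_abs_bound)
  also have "\<dots> \<le> (\<integral>w. (Yof w)\<^sup>2 + (V w)\<^sup>2 \<partial>P)"
    using int square_moments V2 abs_mult_le_sum_squares by (intro integral_mono) auto
  also have "\<dots> \<le> 1 + C powr q + C" using square_moments V2 integral_V2 by simp
  finally show ?thesis using cC by (simp add: theta_bound_def pos_le_divide_eq)
qed

text \<open>Conditional Jensen for |x| powr q: passing to a conditional mean does not increase the
  q-th moment. It is applied to m = E[D | X] and l = E[Y | X].\<close>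

lemma cond_exp_moment:
  assumes Z[measurable]: "Z \<in> borel_measurable P" and Zq: "integrable P (\<lambda>w. \<bar>Z w\<bar> powr q)"
    and f[measurable]: "f \<in> borel_measurable MX" and ce: "AE w in P. real_cond_exp P (sigma_X MX) Z w = f (Xof w)"
  shows "integrable P (\<lambda>w. \<bar>f (Xof w)\<bar> powr q)" "(\<integral>w. \<bar>f (Xof w)\<bar> powr q \<partial>P) \<le> (\<integral>w. \<bar>Z w\<bar> powr q \<partial>P)"
proof -
  have "integrable P (\<lambda>w. \<bar>Z w\<bar>)" using power_moment(1)[OF Z Zq, of 1] by simp
  then have Z1: "integrable P Z" by (rule integrable_abs_cancel) (rule Z)
  have conv: "convex_on UNIV (\<lambda>x::real. \<bar>x\<bar> powr q)" using q by (intro convex_on_abs_powr) auto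
  let ?R = "real_cond_exp P (sigma_X MX) (\<lambda>w. \<bar>Z w\<bar> powr q)"
  have R: "integrable P ?R" "(\<integral>w. ?R w \<partial>P) = (\<integral>w. \<bar>Z w\<bar> powr q \<partial>P)"
    using X.real_cond_exp_int[OF Zq] by auto
  have "AE w in P. \<bar>real_cond_exp P (sigma_X MX) Z w\<bar> powr q \<le> ?R w"
    by (rule X.real_cond_exp_jensens_inequality(2)[OF Z1 _ _ Zq conv]) auto
  then have le: "AE w in P. \<bar>f (Xof w)\<bar> powr q \<le> ?R w"
    using ce by eventually_elim simp
  show i: "integrable P (\<lambda>w. \<bar>f (Xof w)\<bar> powr q)"
    by (rule Bochner_Integration.integrable_bound[OF R(1)]) (use le in auto)
  show "(\<integral>w. \<bar>f (Xof w)\<bar> powr q \<partial>P) \<le> (\<integral>w. \<bar>Z w\<bar> powr q \<partial>P)"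
    unfolding R(2)[symmetric] using i R le by (intro integral_mono_AE) auto
qed

text \<open>The regression of Y on X, as \<open>cond_exp_Y\<close> confirms. Unlike g it is the
  conditional mean of an observed variable, so its moments are within reach of Jensen.\<close>

definition "l x = \<theta> * m x + g x"

lemma l[measurable]: "l \<in> borel_measurable MX" by (simp add: l_def[abs_def])

lemma integrable_1: "integrable P Yof" "integrable P Dof" "integrable P (\<lambda>w. g (Xof w))" "integrable P (\<lambda>w. m (Xof w))" "integrable P (\<lambda>w. l (Xof w))"
proof -
  show *: "integrable P Yof" "integrable P Dof" "integrable P (\<lambda>w. g (Xof w))" "integrable P (\<lambda>w. m (Xof w))"
    using square_moments g2 m2 by (auto intro!: square_integrable_imp_integrable)
  then show "integrable P (\<lambda>w. l (Xof w))" by (simp add: l_def)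
qed

lemma cond_exp_D: "AE w in P. real_cond_exp P (sigma_X MX) Dof w = m (Xof w)"
proof -
  have "AE w in P. real_cond_exp P (sigma_X MX) (\<lambda>w. Dof w - m (Xof w)) w = real_cond_exp P (sigma_X MX) Dof w - real_cond_exp P (sigma_X MX) (\<lambda>w. m (Xof w)) w"
    using integrable_1 by (intro X.real_cond_exp_diff) auto
  moreover have "AE w in P. real_cond_exp P (sigma_X MX) (\<lambda>w. m (Xof w)) w = m (Xof w)"
    using integrable_1 measurable_sigma_X[OF m] by (intro X.real_cond_exp_F_meas) auto
  ultimately show ?thesis using V_cond by eventually_elim simp
qed

text \<open>Y = l(X) + U + \<theta> V, and both errors integrate to zero over every event determined
  by X.\<close>

lemma cond_exp_Y: "AE w in P. real_cond_exp P (sigma_X MX) Yof w = l (Xof w)"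
proof (rule X.real_cond_exp_charact)
  fix A assume A: "A \<in> sets (sigma_X MX)"
  then have [measurable]: "A \<in> sets P" using X.subalg by (auto simp: subalgebra_def)
  obtain B where B[measurable]: "B \<in> sets MX" and AB: "A = Xof -` B \<inter> space P"
    using A unfolding sigma_X_def by (subst (asm) sets_vimage_algebra2) (auto simp: space_P[symmetric] dest: Xof_space)
  have ind_eq: "indicator A w = (indicator B (Xof w) :: real)" if "w \<in> space P" for w
    using that by (simp add: AB indicator_def)
  have eq: "(\<integral>w. indicator A w * G w \<partial>P) = (\<integral>w. indicator B (Xof w) * G w \<partial>P)"
    and int: "integrable P (\<lambda>w. indicator B (Xof w) * G w)" if "integrable P G" for G :: "'x obs \<Rightarrow> real"
  proof -
    have "integrable P (\<lambda>w. indicator A w * G w)"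
      using integrable_mult_indicator[OF \<open>A \<in> sets P\<close> that] by simp
    then show "integrable P (\<lambda>w. indicator B (Xof w) * G w)"
      by (rule Bochner_Integration.integrable_cong[OF refl, THEN iffD1, rotated]) (simp add: ind_eq)
    show "(\<integral>w. indicator A w * G w \<partial>P) = (\<integral>w. indicator B (Xof w) * G w \<partial>P)"
      by (rule Bochner_Integration.integral_cong) (simp_all add: ind_eq)
  qed
  have 1: "(\<integral>w. indicator B (Xof w) * U w \<partial>P) = 0"
    using integral_U_mult[of "\<lambda>p. indicator B (snd p)"] int[OF U1] by simp
  have 2: "(\<integral>w. indicator B (Xof w) * V w \<partial>P) = 0"
    using integral_V_mult[of "indicator B"] int[OF V1] by simp
  have "(\<integral>w. indicator B (Xof w) * Yof w \<partial>P) = (\<integral>w. indicator B (Xof w) * l (Xof w) + indicator B (Xof w) * U w + \<theta> * (indicator B (Xof w) * V w) \<partial>P)"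
    by (simp add: U_def V_def l_def algebra_simps)
  also have "\<dots> = (\<integral>w. indicator B (Xof w) * l (Xof w) \<partial>P) + (\<integral>w. indicator B (Xof w) * U w \<partial>P) + \<theta> * (\<integral>w. indicator B (Xof w) * V w \<partial>P)"
    using int[OF U1] int[OF V1] int[OF integrable_1(5)] by simp
  finally show "(\<integral>w\<in>A. Yof w \<partial>P) = (\<integral>w\<in>A. l (Xof w) \<partial>P)"
    using 1 2 by (simp add: set_lebesgue_integral_def eq integrable_1)
qed (use integrable_1 measurable_sigma_X[OF l] in auto)

text \<open>V = D - m(X) has two summands whose q-th moments are at most C powr q; the factor 2 powr
  q is the one in \<open>abs_add_powr_le\<close>.\<close>

definition "V_bound = 2 powr q * (2 * C powr q)"
definition "U_bound = 2 powr q * (V_bound + theta_bound powr q * V_bound)"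

lemma add_moment:
  fixes a b :: "'x obs \<Rightarrow> real"
  assumes [measurable]: "a \<in> borel_measurable P" "b \<in> borel_measurable P"
    and a: "integrable P (\<lambda>w. \<bar>a w\<bar> powr q)" "(\<integral>w. \<bar>a w\<bar> powr q \<partial>P) \<le> A"
    and b: "integrable P (\<lambda>w. \<bar>b w\<bar> powr q)" "(\<integral>w. \<bar>b w\<bar> powr q \<partial>P) \<le> B"
  shows "integrable P (\<lambda>w. \<bar>a w + b w\<bar> powr q)" "(\<integral>w. \<bar>a w + b w\<bar> powr q \<partial>P) \<le> 2 powr q * (A + B)"
proof -
  have le: "\<bar>a w + b w\<bar> powr q \<le> 2 powr q * (\<bar>a w\<bar> powr q + \<bar>b w\<bar> powr q)" for w
    using q by (intro abs_add_powr_le) auto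
  show i: "integrable P (\<lambda>w. \<bar>a w + b w\<bar> powr q)"
    by (rule Bochner_Integration.integrable_bound[where f="\<lambda>w. 2 powr q * (\<bar>a w\<bar> powr q + \<bar>b w\<bar> powr q)"])
       (use a b le in \<open>auto simp: abs_of_nonneg\<close>)
  have "(\<integral>w. \<bar>a w + b w\<bar> powr q \<partial>P) \<le> (\<integral>w. 2 powr q * (\<bar>a w\<bar> powr q + \<bar>b w\<bar> powr q) \<partial>P)"
    using i a b le by (intro integral_mono) auto
  also have "\<dots> \<le> 2 powr q * (A + B)" using a b by (simp add: add_mono)
  finally show "(\<integral>w. \<bar>a w + b w\<bar> powr q \<partial>P) \<le> 2 powr q * (A + B)" .
qed

lemma V_moment: "integrable P (\<lambda>w. \<bar>V w\<bar> powr q)" "(\<integral>w. \<bar>V w\<bar> powr q \<partial>P) \<le> V_bound"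
proof -
  note mm = cond_exp_moment[OF _ YD_moments(3) m cond_exp_D]
  show "integrable P (\<lambda>w. \<bar>V w\<bar> powr q)" "(\<integral>w. \<bar>V w\<bar> powr q \<partial>P) \<le> V_bound"
    using add_moment[of Dof "\<lambda>w. - m (Xof w)", OF _ _ YD_moments(3,4), of "C powr q"] mm YD_moments(4)
    by (auto simp: V_def[abs_def] V_bound_def)
qed

text \<open>U = (Y - l(X)) - \<theta> V avoids g: the first summand is bounded in the same way as V,
  the second through \<open>theta_bound\<close>. This is the origin of the shape of
  \<open>U_bound\<close>.\<close>

lemma U_moment: "integrable P (\<lambda>w. \<bar>U w\<bar> powr q)" "(\<integral>w. \<bar>U w\<bar> powr q \<partial>P) \<le> U_bound"
proof -
  have eq: "U = (\<lambda>w. (Yof w - l (Xof w)) + (- \<theta> * V w))" by (auto simp: U_def V_def l_def algebra_simps)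
  note ll = cond_exp_moment[OF _ YD_moments(1) l cond_exp_Y]
  have 1: "integrable P (\<lambda>w. \<bar>Yof w - l (Xof w)\<bar> powr q)" "(\<integral>w. \<bar>Yof w - l (Xof w)\<bar> powr q \<partial>P) \<le> V_bound"
    using add_moment[of Yof "\<lambda>w. - l (Xof w)", OF _ _ YD_moments(1,2), of "C powr q"] ll YD_moments(2)
    by (auto simp: V_bound_def)
  have 2: "integrable P (\<lambda>w. \<bar>- \<theta> * V w\<bar> powr q)" "(\<integral>w. \<bar>- \<theta> * V w\<bar> powr q \<partial>P) \<le> theta_bound powr q * V_bound"
  proof -
    have e: "\<bar>- \<theta> * V w\<bar> powr q = \<bar>\<theta>\<bar> powr q * \<bar>V w\<bar> powr q" for w by (simp add: abs_mult powr_mult)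
    show "integrable P (\<lambda>w. \<bar>- \<theta> * V w\<bar> powr q)" unfolding e using V_moment by simp
    have "\<bar>\<theta>\<bar> powr q * (\<integral>w. \<bar>V w\<bar> powr q \<partial>P) \<le> theta_bound powr q * V_bound"
      using V_moment theta_bound q by (intro mult_mono powr_mono2) auto
    then show "(\<integral>w. \<bar>- \<theta> * V w\<bar> powr q \<partial>P) \<le> theta_bound powr q * V_bound"
      unfolding e by simp
  qed
  show "integrable P (\<lambda>w. \<bar>U w\<bar> powr q)" "(\<integral>w. \<bar>U w\<bar> powr q \<partial>P) \<le> U_bound"
    unfolding eq U_bound_def by (rule add_moment[OF _ _ 1 2]; measurable)+
qed

text \<open>Both bounds are x y \<le> x^2 + y^2, with x and y the squares of the factors or the
  powers q / 2 of their moduli. The fourth moments exist because q > 4, and 2 + A + B arises from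
  estimating |x|^4 by 1 + |x| powr q twice.\<close>

lemma sq_mult_moment:
  fixes a b :: "'x obs \<Rightarrow> real"
  assumes [measurable]: "a \<in> borel_measurable P" "b \<in> borel_measurable P"
    and a: "integrable P (\<lambda>w. \<bar>a w\<bar> powr q)" "(\<integral>w. \<bar>a w\<bar> powr q \<partial>P) \<le> A"
    and b: "integrable P (\<lambda>w. \<bar>b w\<bar> powr q)" "(\<integral>w. \<bar>b w\<bar> powr q \<partial>P) \<le> B"
  shows "integrable P (\<lambda>w. (a w * b w)\<^sup>2)" "(\<integral>w. (a w * b w)\<^sup>2 \<partial>P) \<le> 2 + A + B"
    "integrable P (\<lambda>w. \<bar>a w * b w\<bar> powr (q / 2))" "(\<integral>w. \<bar>a w * b w\<bar> powr (q / 2) \<partial>P) \<le> A + B"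
proof -
  note a4 = power_moment[OF _ a(1), of 4] and b4 = power_moment[OF _ b(1), of 4]
  have le: "(a w * b w)\<^sup>2 \<le> \<bar>a w\<bar> ^ 4 + \<bar>b w\<bar> ^ 4" for w
  proof -
    have "0 \<le> ((a w)\<^sup>2 - (b w)\<^sup>2)\<^sup>2 + (a w)^4 + (b w)^4" by (intro add_nonneg_nonneg) auto
    then show ?thesis by (simp add: power2_eq_square power4_eq_xxxx algebra_simps)
  qed
  show i: "integrable P (\<lambda>w. (a w * b w)\<^sup>2)"
    by (rule Bochner_Integration.integrable_bound[where f="\<lambda>w. \<bar>a w\<bar> ^ 4 + \<bar>b w\<bar> ^ 4"])
       (use a4 b4 le in \<open>auto simp: abs_of_nonneg\<close>)
  have "(\<integral>w. (a w * b w)\<^sup>2 \<partial>P) \<le> (\<integral>w. \<bar>a w\<bar> ^ 4 + \<bar>b w\<bar> ^ 4 \<partial>P)"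
    using i a4 b4 le by (intro integral_mono) auto
  also have "\<dots> \<le> 2 + A + B" using a4 b4 a b by simp
  finally show "(\<integral>w. (a w * b w)\<^sup>2 \<partial>P) \<le> 2 + A + B" .
  have le: "\<bar>a w * b w\<bar> powr (q / 2) \<le> \<bar>a w\<bar> powr q + \<bar>b w\<bar> powr q" for w
  proof -
    define x where "x = \<bar>a w\<bar> powr (q/2)" define y where "y = \<bar>b w\<bar> powr (q/2)"
    have "\<bar>a w\<bar> powr q = x\<^sup>2" "\<bar>b w\<bar> powr q = y\<^sup>2" by (simp_all add: x_def y_def power2_eq_square powr_add[symmetric])
    moreover have "\<bar>a w * b w\<bar> powr (q / 2) = x * y" by (simp add: x_def y_def abs_mult powr_mult)
    moreover have "x * y \<le> x\<^sup>2 + y\<^sup>2" using abs_mult_le_sum_squares[of x y] by simp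
    ultimately show ?thesis by simp
  qed
  show i: "integrable P (\<lambda>w. \<bar>a w * b w\<bar> powr (q / 2))"
    by (rule Bochner_Integration.integrable_bound[where f="\<lambda>w. \<bar>a w\<bar> powr q + \<bar>b w\<bar> powr q"])
       (use a b le in \<open>auto simp: abs_of_nonneg\<close>)
  have "(\<integral>w. \<bar>a w * b w\<bar> powr (q / 2) \<partial>P) \<le> (\<integral>w. \<bar>a w\<bar> powr q + \<bar>b w\<bar> powr q \<partial>P)"
    using i a b le by (intro integral_mono) auto
  also have "\<dots> \<le> A + B" using a b by simp
  finally show "(\<integral>w. \<bar>a w * b w\<bar> powr (q / 2) \<partial>P) \<le> A + B" .
qed

text \<open>One constant that dominates the sums 2 + A + B from \<open>sq_mult_moment\<close> for
  the pairs (U, V), (D, V) and (V, V).\<close>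

definition "moment_bound = 2 + C powr q + U_bound + 2 * V_bound"

lemma bounds_nonneg: "0 \<le> V_bound" "0 \<le> U_bound" "0 \<le> theta_bound" "0 \<le> moment_bound"
proof -
  show V: "0 \<le> V_bound" by (simp add: V_bound_def)
  show "0 \<le> theta_bound" using cC by (simp add: theta_bound_def)
  show U: "0 \<le> U_bound" using V by (simp add: U_bound_def)
  show "0 \<le> moment_bound" using U V by (simp add: moment_bound_def)
qed

lemma UV_moments:
  "integrable P (\<lambda>w. (U w * V w)\<^sup>2)" "(\<integral>w. (U w * V w)\<^sup>2 \<partial>P) \<le> moment_bound"
  "integrable P (\<lambda>w. \<bar>U w * V w\<bar> powr (q / 2))" "(\<integral>w. \<bar>U w * V w\<bar> powr (q / 2) \<partial>P) \<le> moment_bound"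
  "integrable P (\<lambda>w. (Dof w * V w)\<^sup>2)" "(\<integral>w. (Dof w * V w)\<^sup>2 \<partial>P) \<le> moment_bound"
  "integrable P (\<lambda>w. (V w * V w)\<^sup>2)" "(\<integral>w. (V w * V w)\<^sup>2 \<partial>P) \<le> moment_bound"
proof -
  note * = sq_mult_moment[OF measurable_UV U_moment V_moment] sq_mult_moment[OF measurable_obs(2) measurable_UV(2) YD_moments(3,4) V_moment]
    sq_mult_moment[OF measurable_UV(2,2) V_moment V_moment] bounds_nonneg powr_ge_zero[of C q]
  show "integrable P (\<lambda>w. (U w * V w)\<^sup>2)" "integrable P (\<lambda>w. \<bar>U w * V w\<bar> powr (q / 2))"
    "integrable P (\<lambda>w. (Dof w * V w)\<^sup>2)" "integrable P (\<lambda>w. (V w * V w)\<^sup>2)"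
    by (rule *)+
  show "(\<integral>w. (U w * V w)\<^sup>2 \<partial>P) \<le> moment_bound" "(\<integral>w. \<bar>U w * V w\<bar> powr (q / 2) \<partial>P) \<le> moment_bound"
    "(\<integral>w. (Dof w * V w)\<^sup>2 \<partial>P) \<le> moment_bound" "(\<integral>w. (V w * V w)\<^sup>2 \<partial>P) \<le> moment_bound"
    using * unfolding moment_bound_def by linarith+
qed

text \<open>Condition (c) keeps the variance of the leading term away from zero uniformly in the
  law, so standardizing by it is harmless.\<close>

lemma integral_UV2_lower: "c ^ 4 \<le> (\<integral>w. (U w * V w)\<^sup>2 \<partial>P)"
proof -
  let ?I = "\<integral>w. (U w * V w)\<^sup>2 \<partial>P"
  have e: "\<bar>x\<bar> powr 2 = x\<^sup>2" for x :: real by (cases "x = 0") (auto simp: powr_numeral)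
  have nn: "(\<integral>\<^sup>+w. ennreal (\<bar>U w * V w\<bar> powr 2) \<partial>P) = ennreal ?I"
    unfolding e using UV_moments(1) by (intro nn_integral_eq_integral) auto
  have "Lnorm P 2 (\<lambda>w. U w * V w) = ennreal (?I powr (1/2))"
    unfolding Lnorm_def nn by (simp add: integral_nonneg_AE)
  then have "ennreal (c\<^sup>2) \<le> ennreal (?I powr (1/2))" using UV_lower by (simp add: U_def[abs_def] V_def[abs_def])
  then have "c\<^sup>2 \<le> sqrt ?I" by (simp add: powr_half_sqrt integral_nonneg_AE)
  then have "(c\<^sup>2)\<^sup>2 \<le> (sqrt ?I)\<^sup>2" by (intro power_mono) auto
  also have "\<dots> = ?I" by (simp add: integral_nonneg_AE)
  finally show ?thesis by simp
qed

lemma cauchy_schwarz: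
  fixes a b :: "'x obs \<Rightarrow> real"
  assumes [measurable]: "a \<in> borel_measurable P" "b \<in> borel_measurable P"
    and a: "integrable P (\<lambda>w. (a w)\<^sup>2)" and b: "integrable P (\<lambda>w. (b w)\<^sup>2)"
  shows "(\<integral>w. \<bar>a w * b w\<bar> \<partial>P)\<^sup>2 \<le> (\<integral>w. (a w)\<^sup>2 \<partial>P) * (\<integral>w. (b w)\<^sup>2 \<partial>P)"
proof -
  have "(\<integral>\<^sup>+w. ennreal \<bar>a w\<bar> * ennreal \<bar>b w\<bar> \<partial>P)\<^sup>2 \<le> (\<integral>\<^sup>+w. (ennreal \<bar>a w\<bar>)\<^sup>2 \<partial>P) * (\<integral>\<^sup>+w. (ennreal \<bar>b w\<bar>)\<^sup>2 \<partial>P)"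
    by (rule Cauchy_Schwarz_nn_integral) auto
  also have "(\<integral>\<^sup>+w. ennreal \<bar>a w\<bar> * ennreal \<bar>b w\<bar> \<partial>P) = ennreal (\<integral>w. \<bar>a w * b w\<bar> \<partial>P)"
    using integrable_abs[OF integrable_mult_of_squares[OF _ _ a b]] by (subst nn_integral_eq_integral[symmetric]) (auto simp: abs_mult ennreal_mult)
  also have "(\<integral>\<^sup>+w. (ennreal \<bar>a w\<bar>)\<^sup>2 \<partial>P) = ennreal (\<integral>w. (a w)\<^sup>2 \<partial>P)"
    using a by (subst nn_integral_eq_integral[symmetric]) (auto simp: ennreal_power)
  also have "(\<integral>\<^sup>+w. (ennreal \<bar>b w\<bar>)\<^sup>2 \<partial>P) = ennreal (\<integral>w. (b w)\<^sup>2 \<partial>P)"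
    using b by (subst nn_integral_eq_integral[symmetric]) (auto simp: ennreal_power)
  finally show ?thesis
    by (simp add: ennreal_power ennreal_mult[symmetric] integral_nonneg_AE)
qed

end

subsection \<open>Cross-fitted averages along a sequence of laws\<close>

text \<open>The error \<open>h\<close> of the outcome regression, chosen such that for both scores the score at
\<open>\<theta>0\<close> equals \<open>(U - h) (V - d)\<close> with \<open>d = m - m0\<close>. For score (B) it is
\<open>(l - l0) - \<theta>0 (m - m0)\<close>, where \<open>l0 = \<theta>0 m0 + g0\<close>.\<close>

fun nuis_err :: "score \<Rightarrow> real \<Rightarrow> ('x \<Rightarrow> real) \<Rightarrow> 'x nuis \<Rightarrow> 'x \<Rightarrow> real" where
  "nuis_err ScoreA \<theta> g \<eta> x = fst \<eta> x - g x"
| "nuis_err ScoreB \<theta> g \<eta> x = fst \<eta> x - \<theta> * snd \<eta> x - g x"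

text \<open>An affine function with nonzero slope has a root. Minimal up to \<epsilon> therefore
  means a residual of at most \<epsilon>.\<close>

lemma INF_affine_eq_0:
  assumes "a \<noteq> (0::real)"
  shows "(INF t. \<bar>b + a * (t - t0)\<bar>) \<le> 0"
proof -
  have "(INF t. \<bar>b + a * (t - t0)\<bar>) \<le> \<bar>b + a * ((t0 - b / a) - t0)\<bar>"
    by (rule cINF_lower) (auto intro!: bdd_belowI[of _ 0])
  then show ?thesis using assms by simp
qed

text \<open>Indexing by the fold size n, with N = K n, builds divisibility in. The law
  \<open>Pn n\<close> may change with n, since uniformity means convergence along every sequence of
  laws.\<close>

locale dml_seq =
  fixes MX :: "'x measure"
    and \<theta>0 :: "'x obs measure \<Rightarrow> real"
    and g0 m0 :: "'x obs measure \<Rightarrow> 'x \<Rightarrow> real"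
    and s :: score and K :: nat and c C q :: real
    and \<delta> \<Delta> :: "nat \<Rightarrow> real"
    and est :: "nat \<Rightarrow> nat set \<Rightarrow> (nat \<Rightarrow> 'x obs) \<Rightarrow> 'x nuis"
    and Pn :: "nat \<Rightarrow> 'x obs measure"
  assumes K: "K \<ge> 2"
    and cpos: "c > 0" "C > 0" "q > 4"
    and \<delta>: "\<forall>N. \<delta> N > 0" "\<delta> \<longlonglongrightarrow> 0"
    and \<Delta>: "\<forall>N. \<Delta> N > 0" "\<Delta> \<longlonglongrightarrow> 0"
    and reg: "\<forall>n. regular MX s c C q \<delta> \<Delta> K est \<theta>0 g0 m0 (Pn n)"
    and est_meas: "\<forall>N J. J \<subseteq> {..<N} \<longrightarrow>
           (\<lambda>(w, x). fst (eta_hat est N J w) x)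
              \<in> borel_measurable (sample N (obs_space MX) \<Otimes>\<^sub>M MX)
         \<and> (\<lambda>(w, x). snd (eta_hat est N J w) x)
              \<in> borel_measurable (sample N (obs_space MX) \<Otimes>\<^sub>M MX)"
begin

text \<open>The errors \<open>L.U\<close> and \<open>L.V\<close> depend on n, whereas
  \<open>L.theta_bound\<close> and \<open>L.moment_bound\<close> are the same for all laws of the
  sequence.\<close>

sublocale L: plr_law "Pn n" MX "\<theta>0 (Pn n)" c C q "g0 (Pn n)" "m0 (Pn n)" for n
  using reg cpos unfolding regular_def Uerr_def[abs_def] Verr_def[abs_def] plr_law_def plr_law_axioms_def
  by simp

abbreviation "\<Omega> \<equiv> \<lambda>n. Omega (K * n) K (Pn n)"
abbreviation "U \<equiv> L.U" abbreviation "V \<equiv> L.V"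

definition "h n \<eta> v = nuis_err s (\<theta>0 (Pn n)) (g0 (Pn n)) \<eta> (Xof v)"
definition "d n \<eta> v = snd \<eta> (Xof v) - m0 (Pn n) (Xof v)"

text \<open>Condition (e) restated for \<open>h\<close> and \<open>d\<close>; the constant \<open>\<kappa>\<close> comes from
\<open>h\<^sup>2 \<le> 2 (l - l0)\<^sup>2 + 2 \<theta>0\<^sup>2 (m - m0)\<^sup>2\<close> and the uniform bound on \<open>\<theta>0\<close>.\<close>

definition "\<kappa> = 2 * (1 + L.theta_bound\<^sup>2)"

definition "good n \<eta> \<longleftrightarrow>
   (\<integral>\<^sup>+v. ennreal ((h n \<eta> v)\<^sup>2) \<partial>Pn n) \<le> ennreal (\<kappa> * (\<delta> (K * n))\<^sup>2) \<and>
   (\<integral>\<^sup>+v. ennreal ((d n \<eta> v)\<^sup>2) \<partial>Pn n) \<le> ennreal ((\<delta> (K * n))\<^sup>2) \<and>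
   (\<integral>\<^sup>+v. ennreal ((h n \<eta> v)\<^sup>2) \<partial>Pn n) * (\<integral>\<^sup>+v. ennreal ((d n \<eta> v)\<^sup>2) \<partial>Pn n)
      \<le> ennreal (\<kappa> * (\<delta> (K * n))\<^sup>2 / real (K * n))"

abbreviation "aux n \<pi> k \<equiv> {..<K * n} - fold (K * n) \<pi> k"
abbreviation "\<eta>h n \<pi> w k \<equiv> eta_hat est (K * n) (aux n \<pi> k) w"

abbreviation nuis_meas :: "'x nuis \<Rightarrow> bool" where
  "nuis_meas \<eta> \<equiv> fst \<eta> \<in> borel_measurable MX \<and> snd \<eta> \<in> borel_measurable MX"

abbreviation vanishes :: "(nat \<times> (nat \<Rightarrow> nat) \<times> (nat \<Rightarrow> 'x obs) \<Rightarrow> real) \<Rightarrow> bool" where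
  "vanishes f \<equiv> (f \<longlongrightarrow> 0) (in_prob \<Omega>)"

lemma kappa_nonneg: "\<kappa> \<ge> 0" by (simp add: \<kappa>_def)

section \<open>Measurability of cross-fitted nuisance errors\<close>

lemma sets_sample: "sets (sample N (Pn n)) = sets (sample N (obs_space MX))"
  unfolding sample_def by (rule sets_PiM_cong) (auto simp: L.sets_P)

lemma space_sample: "space (sample N (Pn n)) = space (sample N (obs_space MX))"
  by (rule sets_eq_imp_space_eq[OF sets_sample])

lemma fold_subset: "fold N \<pi> k \<subseteq> {..<N}" by (auto simp: fold_def)

lemma measurable_sample_component[measurable]:
  "i < N \<Longrightarrow> (\<lambda>w. w i) \<in> measurable (sample N (Pn n)) (Pn n)"
  unfolding sample_def by (rule measurable_component_singleton) simp

lemma eta_pair_measurable: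
  assumes J: "J \<subseteq> {..<N}"
  shows "(\<lambda>p. fst (eta_hat est N J (fst p)) (Xof (snd p))) \<in> borel_measurable (sample N (Pn n) \<Otimes>\<^sub>M Pn n)"
    "(\<lambda>p. snd (eta_hat est N J (fst p)) (Xof (snd p))) \<in> borel_measurable (sample N (Pn n) \<Otimes>\<^sub>M Pn n)"
proof -
  have [measurable]: "(\<lambda>(w, x). fst (eta_hat est N J w) x) \<in> borel_measurable (sample N (Pn n) \<Otimes>\<^sub>M MX)"
    "(\<lambda>(w, x). snd (eta_hat est N J w) x) \<in> borel_measurable (sample N (Pn n) \<Otimes>\<^sub>M MX)"
    using est_meas[rule_format, OF J]
    by (simp_all add: measurable_cong_sets[OF sets_pair_measure_cong[OF sets_sample refl] refl])
  have p: "(\<lambda>p. (fst p, Xof (snd p))) \<in> measurable (sample N (Pn n) \<Otimes>\<^sub>M Pn n) (sample N (Pn n) \<Otimes>\<^sub>M MX)"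
    by measurable
  from measurable_compose[OF p, of "\<lambda>(w, x). fst (eta_hat est N J w) x" borel]
    measurable_compose[OF p, of "\<lambda>(w, x). snd (eta_hat est N J w) x" borel]
  show "(\<lambda>p. fst (eta_hat est N J (fst p)) (Xof (snd p))) \<in> borel_measurable (sample N (Pn n) \<Otimes>\<^sub>M Pn n)"
    "(\<lambda>p. snd (eta_hat est N J (fst p)) (Xof (snd p))) \<in> borel_measurable (sample N (Pn n) \<Otimes>\<^sub>M Pn n)"
    by simp_all
qed

lemma eta_measurable_at[measurable]:
  assumes J: "J \<subseteq> {..<N}" and i: "i < N"
  shows "(\<lambda>w. fst (eta_hat est N J w) (Xof (w i))) \<in> borel_measurable (sample N (Pn n))"
    "(\<lambda>w. snd (eta_hat est N J w) (Xof (w i))) \<in> borel_measurable (sample N (Pn n))"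
proof -
  have p: "(\<lambda>w. (w, w i)) \<in> measurable (sample N (Pn n)) (sample N (Pn n) \<Otimes>\<^sub>M Pn n)"
    using i by measurable
  show "(\<lambda>w. fst (eta_hat est N J w) (Xof (w i))) \<in> borel_measurable (sample N (Pn n))"
    "(\<lambda>w. snd (eta_hat est N J w) (Xof (w i))) \<in> borel_measurable (sample N (Pn n))"
    using measurable_compose[OF p eta_pair_measurable(1)[OF J]] measurable_compose[OF p eta_pair_measurable(2)[OF J]]
    by simp_all
qed

lemma eta_measurable:
  assumes J: "J \<subseteq> {..<N}" and w: "w \<in> space (sample N (Pn n))"
  shows "nuis_meas (eta_hat est N J w)"
proof -
  have p: "(\<lambda>x. (w, x)) \<in> measurable MX (sample N (obs_space MX) \<Otimes>\<^sub>M MX)"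
    using w space_sample by (intro measurable_Pair1') auto
  from measurable_compose[OF p, of "\<lambda>(w, x). fst (eta_hat est N J w) x" borel]
    measurable_compose[OF p, of "\<lambda>(w, x). snd (eta_hat est N J w) x" borel]
    est_meas[rule_format, OF J]
  show ?thesis by simp
qed

lemma nuis_err_measurable:
  assumes [measurable]: "f \<in> measurable M MX"
    and [measurable]: "(\<lambda>x. fst (\<eta> x) (f x)) \<in> borel_measurable M" "(\<lambda>x. snd (\<eta> x) (f x)) \<in> borel_measurable M"
  shows "(\<lambda>x. nuis_err s (\<theta>0 (Pn n)) (g0 (Pn n)) (\<eta> x) (f x)) \<in> borel_measurable M"
  by (cases s) simp_all

lemma hd_measurable:
  assumes m: "nuis_meas \<eta>"
  shows "nuis_err s (\<theta>0 (Pn n)) (g0 (Pn n)) \<eta> \<in> borel_measurable MX" "(\<lambda>x. snd \<eta> x - m0 (Pn n) x) \<in> borel_measurable MX"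
    "h n \<eta> \<in> borel_measurable (Pn n)" "d n \<eta> \<in> borel_measurable (Pn n)"
proof -
  have [measurable]: "fst \<eta> \<in> borel_measurable MX" "snd \<eta> \<in> borel_measurable MX" using m by auto
  show 1[measurable]: "nuis_err s (\<theta>0 (Pn n)) (g0 (Pn n)) \<eta> \<in> borel_measurable MX"
    using nuis_err_measurable[of "\<lambda>x. x" MX "\<lambda>_. \<eta>" n] m by simp
  show "(\<lambda>x. snd \<eta> x - m0 (Pn n) x) \<in> borel_measurable MX" by simp
  show "h n \<eta> \<in> borel_measurable (Pn n)" "d n \<eta> \<in> borel_measurable (Pn n)"
    unfolding h_def[abs_def] d_def[abs_def] by measurable
qed

lemma hd_measurable_at[measurable]:
  assumes J: "J \<subseteq> {..<N}" and i: "i < N"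
  shows "(\<lambda>w. h n (eta_hat est N J w) (w i)) \<in> borel_measurable (sample N (Pn n))"
    "(\<lambda>w. d n (eta_hat est N J w) (w i)) \<in> borel_measurable (sample N (Pn n))"
proof -
  note [measurable] = eta_measurable_at[OF J i] measurable_sample_component[OF i]
  show "(\<lambda>w. h n (eta_hat est N J w) (w i)) \<in> borel_measurable (sample N (Pn n))"
    unfolding h_def by (rule nuis_err_measurable) measurable
  show "(\<lambda>w. d n (eta_hat est N J w) (w i)) \<in> borel_measurable (sample N (Pn n))"
    unfolding d_def by measurable
qed

text \<open>Expressing \<open>good\<close> by nonnegative integrals of jointly measurable functions
  makes its measurability a case of Tonelli. The event in condition (e) is never shown to be
  measurable; it is only compared with this one.\<close>

lemma good_sets:
  assumes J: "J \<subseteq> {..<K * n}"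
  shows "{w\<in>space (sample (K * n) (Pn n)). good n (eta_hat est (K * n) J w)} \<in> sets (sample (K * n) (Pn n))"
proof -
  let ?S = "sample (K * n) (Pn n)"
  note [measurable] = eta_pair_measurable[OF J]
  have [measurable]: "(\<lambda>p. h n (eta_hat est (K * n) J (fst p)) (snd p)) \<in> borel_measurable (?S \<Otimes>\<^sub>M Pn n)"
    unfolding h_def by (rule nuis_err_measurable) measurable
  have [measurable]: "(\<lambda>p. d n (eta_hat est (K * n) J (fst p)) (snd p)) \<in> borel_measurable (?S \<Otimes>\<^sub>M Pn n)"
    unfolding d_def by measurable
  have [measurable]: "(\<lambda>w. \<integral>\<^sup>+v. ennreal ((h n (eta_hat est (K * n) J w) v)\<^sup>2) \<partial>Pn n) \<in> borel_measurable ?S"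
    "(\<lambda>w. \<integral>\<^sup>+v. ennreal ((d n (eta_hat est (K * n) J w) v)\<^sup>2) \<partial>Pn n) \<in> borel_measurable ?S"
    by (intro L.borel_measurable_nn_integral; simp add: case_prod_beta)+
  show ?thesis unfolding good_def by measurable
qed

section \<open>From condition (e) to mean-square bounds on the nuisance errors\<close>

lemma goodD:
  assumes m: "nuis_meas \<eta>" and g: "good n \<eta>"
  shows "integrable (Pn n) (\<lambda>v. (h n \<eta> v)\<^sup>2)" "(\<integral>v. (h n \<eta> v)\<^sup>2 \<partial>Pn n) \<le> \<kappa> * (\<delta> (K * n))\<^sup>2"
    "integrable (Pn n) (\<lambda>v. (d n \<eta> v)\<^sup>2)" "(\<integral>v. (d n \<eta> v)\<^sup>2 \<partial>Pn n) \<le> (\<delta> (K * n))\<^sup>2"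
    "(\<integral>v. (h n \<eta> v)\<^sup>2 \<partial>Pn n) * (\<integral>v. (d n \<eta> v)\<^sup>2 \<partial>Pn n) \<le> \<kappa> * (\<delta> (K * n))\<^sup>2 / real (K * n)"
proof -
  note [measurable] = hd_measurable(3,4)[OF m]
  show i: "integrable (Pn n) (\<lambda>v. (h n \<eta> v)\<^sup>2)" "integrable (Pn n) (\<lambda>v. (d n \<eta> v)\<^sup>2)"
    using g by (auto intro!: integrableI_nonneg simp: good_def intro: le_less_trans)
  show "(\<integral>v. (h n \<eta> v)\<^sup>2 \<partial>Pn n) \<le> \<kappa> * (\<delta> (K * n))\<^sup>2" "(\<integral>v. (d n \<eta> v)\<^sup>2 \<partial>Pn n) \<le> (\<delta> (K * n))\<^sup>2"
    "(\<integral>v. (h n \<eta> v)\<^sup>2 \<partial>Pn n) * (\<integral>v. (d n \<eta> v)\<^sup>2 \<partial>Pn n) \<le> \<kappa> * (\<delta> (K * n))\<^sup>2 / real (K * n)"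
    using g kappa_nonneg unfolding good_def nn_integral_eq_integral[OF i(1) AE_I2[OF zero_le_power2]] nn_integral_eq_integral[OF i(2) AE_I2[OF zero_le_power2]]
    by (simp_all add: ennreal_mult[symmetric] integral_nonneg_AE)
qed

lemma Lnorm_2:
  assumes "f \<in> borel_measurable MX" "Lnorm (lawX MX (Pn n)) 2 f \<le> ennreal b" "b \<ge> 0"
  shows "integrable (Pn n) (\<lambda>v. (f (Xof v))\<^sup>2)"
    "Lnorm (lawX MX (Pn n)) 2 f = ennreal (sqrt (\<integral>v. (f (Xof v))\<^sup>2 \<partial>Pn n))"
proof -
  note [measurable] = assms(1)
  have e: "\<bar>x\<bar> powr 2 = x\<^sup>2" for x :: real by (cases "x = 0") (auto simp: powr_numeral)
  have "integrable (lawX MX (Pn n)) (\<lambda>x. (f x)\<^sup>2)"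
    using Lnorm_leD(1)[OF assms(2,3), unfolded e] by (simp add: lawX_def)
  then show i: "integrable (Pn n) (\<lambda>v. (f (Xof v))\<^sup>2)"
    unfolding lawX_def by (subst (asm) integrable_distr_eq) auto
  have "(\<integral>\<^sup>+x. ennreal (\<bar>f x\<bar> powr 2) \<partial>lawX MX (Pn n)) = ennreal (\<integral>v. (f (Xof v))\<^sup>2 \<partial>Pn n)"
    unfolding e lawX_def using i by (subst nn_integral_distr) (auto simp: nn_integral_eq_integral)
  then show "Lnorm (lawX MX (Pn n)) 2 f = ennreal (sqrt (\<integral>v. (f (Xof v))\<^sup>2 \<partial>Pn n))"
    by (simp add: Lnorm_def integral_nonneg_AE powr_half_sqrt)
qed

text \<open>For score (A), h is the error in g. For score (B), h mixes the errors in l and m, so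
  E[h^2] E[d^2] contains the fourth power of the error norm of m. This is what the additional
  summand in the rate condition for (B) controls.\<close>

lemma good_of_nuisance_good:
  assumes m: "nuis_meas \<eta>" and n: "n > 0"
    and g: "nuisance_good s (lawX MX (Pn n)) C q (\<delta> (K * n)) (K * n) \<eta> (eta0 s \<theta>0 g0 m0 (Pn n))"
  shows "good n \<eta>"
proof -
  have [measurable]: "fst \<eta> \<in> borel_measurable MX" "snd \<eta> \<in> borel_measurable MX" using m by auto
  let ?e = "eta0 s \<theta>0 g0 m0 (Pn n)" and ?N = "K * n" and ?\<theta> = "\<theta>0 (Pn n)"
  define d1 where "d1 = (\<lambda>x. fst \<eta> x - fst ?e x)"
  define d2 where "d2 = (\<lambda>x. snd \<eta> x - snd ?e x)"
  have \<delta>0: "\<delta> ?N \<ge> 0" using \<delta> by (auto intro: less_imp_le)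
  have [measurable]: "d1 \<in> borel_measurable MX" "d2 \<in> borel_measurable MX"
    unfolding d1_def d2_def by (cases s; simp add: eta0_def)+
  have L: "Lnorm (lawX MX (Pn n)) 2 d1 \<le> ennreal (\<delta> ?N)" "Lnorm (lawX MX (Pn n)) 2 d2 \<le> ennreal (\<delta> ?N)"
    using g unfolding nuisance_good_def Let_def d1_def d2_def by auto
  define a where "a = (\<integral>v. (d1 (Xof v))\<^sup>2 \<partial>Pn n)"
  define b where "b = (\<integral>v. (d2 (Xof v))\<^sup>2 \<partial>Pn n)"
  have ab0: "a \<ge> 0" "b \<ge> 0" by (auto simp: a_def b_def)
  note l1 = Lnorm_2[OF _ L(1) \<delta>0, folded a_def, simplified] and l2 = Lnorm_2[OF _ L(2) \<delta>0, folded b_def, simplified]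
  have sq: "sqrt x \<le> y \<Longrightarrow> x \<ge> 0 \<Longrightarrow> x \<le> y\<^sup>2" for x y :: real
    using power_mono[of "sqrt x" y 2] by simp
  have a: "a \<le> (\<delta> ?N)\<^sup>2" and b: "b \<le> (\<delta> ?N)\<^sup>2"
    using L \<delta>0 ab0 unfolding l1(2) l2(2) by (auto intro!: sq)
  have N0: "real ?N > 0" using n K by simp
  \<comment> \<open>For (B) the rate bounds a sum of two nonnegative products, hence each of them;
    the second one yields the bound on b^2.\<close>
  have prod: "sqrt b * sqrt a \<le> \<delta> ?N / sqrt ?N \<and> (s = ScoreB \<longrightarrow> sqrt b * sqrt b \<le> \<delta> ?N / sqrt ?N)"
  proof (cases s)
    case ScoreA
    then have "Lnorm (lawX MX (Pn n)) 2 d2 * Lnorm (lawX MX (Pn n)) 2 d1 \<le> ennreal (\<delta> ?N / sqrt ?N)"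
      using g unfolding nuisance_good_def Let_def d1_def d2_def by auto
    then show ?thesis using ScoreA ab0 \<delta>0 unfolding l1(2) l2(2) by (simp add: ennreal_mult[symmetric])
  next
    case ScoreB
    then have "Lnorm (lawX MX (Pn n)) 2 d2 * (Lnorm (lawX MX (Pn n)) 2 d2 + Lnorm (lawX MX (Pn n)) 2 d1) \<le> ennreal (\<delta> ?N / sqrt ?N)"
      using g unfolding nuisance_good_def Let_def d1_def d2_def by auto
    then have "sqrt b * (sqrt b + sqrt a) \<le> \<delta> ?N / sqrt ?N"
      using ab0 \<delta>0 unfolding l1(2) l2(2) by (simp add: ennreal_mult[symmetric] ennreal_plus[symmetric] del: ennreal_plus)
    moreover have "sqrt b * (sqrt b + sqrt a) = sqrt b * sqrt b + sqrt b * sqrt a" by (rule distrib_left)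
    moreover have "0 \<le> sqrt b * sqrt b" "0 \<le> sqrt b * sqrt a" using ab0 by auto
    ultimately show ?thesis by linarith
  qed
  have r2: "(\<delta> ?N / sqrt ?N)\<^sup>2 = (\<delta> ?N)\<^sup>2 / ?N" using N0 by (simp add: power_divide)
  have ab: "a * b \<le> (\<delta> ?N)\<^sup>2 / ?N"
    using power_mono[OF conjunct1[OF prod], of 2] ab0 unfolding r2 by (simp add: power_mult_distrib mult.commute)
  have bb: "b * b \<le> (\<delta> ?N)\<^sup>2 / ?N" if "s = ScoreB"
    using power_mono[OF conjunct2[OF prod, rule_format, OF that], of 2] ab0 unfolding r2 by (simp add: power2_eq_square)
  define \<Theta> where "\<Theta> = L.theta_bound"
  have \<Theta>: "?\<theta>\<^sup>2 \<le> \<Theta>\<^sup>2" using L.theta_bound[of n] by (simp add: abs_le_square_iff[symmetric] \<Theta>_def)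
  have d_eq: "d n \<eta> v = d2 (Xof v)" for v by (cases s) (simp_all add: d_def d2_def eta0_def)
  have h_eq: "h n \<eta> v = (if s = ScoreA then d1 (Xof v) else d1 (Xof v) - ?\<theta> * d2 (Xof v))" for v
    unfolding h_def d1_def d2_def by (cases s) (simp_all add: eta0_def algebra_simps)
  have h_le: "(h n \<eta> v)\<^sup>2 \<le> 2 * (d1 (Xof v))\<^sup>2 + (if s = ScoreB then 2 * \<Theta>\<^sup>2 * (d2 (Xof v))\<^sup>2 else 0)" for v
  proof (cases s)
    case ScoreB
    have "(d1 (Xof v) - ?\<theta> * d2 (Xof v))\<^sup>2 \<le> 2 * (d1 (Xof v))\<^sup>2 + 2 * (?\<theta>\<^sup>2 * (d2 (Xof v))\<^sup>2)"
      using zero_le_power2[of "d1 (Xof v) + ?\<theta> * d2 (Xof v)"] by (simp add: power2_eq_square algebra_simps)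
    also have "?\<theta>\<^sup>2 * (d2 (Xof v))\<^sup>2 \<le> \<Theta>\<^sup>2 * (d2 (Xof v))\<^sup>2" using \<Theta> by (intro mult_right_mono) auto
    finally show ?thesis unfolding h_eq using ScoreB by simp
  next
    case ScoreA then show ?thesis unfolding h_eq by simp
  qed
  let ?B = "2 * a + (if s = ScoreB then 2 * \<Theta>\<^sup>2 * b else 0)"
  have i3: "integrable (Pn n) (\<lambda>v. if s = ScoreB then 2 * \<Theta>\<^sup>2 * (d2 (Xof v))\<^sup>2 else 0)"
    using l2(1) by (cases "s = ScoreB") auto
  have hB: "(\<integral>\<^sup>+v. ennreal ((h n \<eta> v)\<^sup>2) \<partial>Pn n) \<le> ennreal ?B"
  proof -
    have "(\<integral>\<^sup>+v. ennreal ((h n \<eta> v)\<^sup>2) \<partial>Pn n) \<le> (\<integral>\<^sup>+v. ennreal (2 * (d1 (Xof v))\<^sup>2 + (if s = ScoreB then 2 * \<Theta>\<^sup>2 * (d2 (Xof v))\<^sup>2 else 0)) \<partial>Pn n)"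
      by (intro nn_integral_mono ennreal_leI h_le)
    also have "\<dots> = ennreal (\<integral>v. 2 * (d1 (Xof v))\<^sup>2 + (if s = ScoreB then 2 * \<Theta>\<^sup>2 * (d2 (Xof v))\<^sup>2 else 0) \<partial>Pn n)"
      using l1(1) i3 by (intro nn_integral_eq_integral Bochner_Integration.integrable_add) auto
    also have "(\<integral>v. 2 * (d1 (Xof v))\<^sup>2 + (if s = ScoreB then 2 * \<Theta>\<^sup>2 * (d2 (Xof v))\<^sup>2 else 0) \<partial>Pn n) = ?B"
      using l1(1) l2(1) by (auto simp: a_def b_def)
    finally show ?thesis .
  qed
  have dB: "(\<integral>\<^sup>+v. ennreal ((d n \<eta> v)\<^sup>2) \<partial>Pn n) = ennreal b"
    unfolding d_eq b_def using l2(1) by (intro nn_integral_eq_integral) auto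
  have B1: "?B \<le> \<kappa> * (\<delta> ?N)\<^sup>2"
  proof -
    have "?B \<le> 2 * (\<delta> ?N)\<^sup>2 + 2 * \<Theta>\<^sup>2 * (\<delta> ?N)\<^sup>2"
      using a b by (intro add_mono) (auto intro!: mult_left_mono)
    then show ?thesis by (simp add: \<kappa>_def \<Theta>_def algebra_simps)
  qed
  have B2: "?B * b \<le> \<kappa> * (\<delta> ?N)\<^sup>2 / ?N"
  proof -
    have "?B * b = 2 * (a * b) + (if s = ScoreB then 2 * \<Theta>\<^sup>2 * (b * b) else 0)" by (simp add: algebra_simps)
    also have "\<dots> \<le> 2 * ((\<delta> ?N)\<^sup>2 / ?N) + 2 * \<Theta>\<^sup>2 * ((\<delta> ?N)\<^sup>2 / ?N)"
    proof (intro add_mono)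
      show "2 * (a * b) \<le> 2 * ((\<delta> ?N)\<^sup>2 / ?N)" using ab by (rule mult_left_mono) simp
      show "(if s = ScoreB then 2 * \<Theta>\<^sup>2 * (b * b) else 0) \<le> 2 * \<Theta>\<^sup>2 * ((\<delta> ?N)\<^sup>2 / ?N)"
        using mult_left_mono[OF bb, of "2 * \<Theta>\<^sup>2"] by (cases "s = ScoreB") auto
    qed
    also have "\<dots> = \<kappa> * (\<delta> ?N)\<^sup>2 / ?N" by (simp add: \<kappa>_def \<Theta>_def algebra_simps add_divide_distrib)
    finally show ?thesis .
  qed
  have B0: "0 \<le> ?B" using ab0 by auto
  show ?thesis unfolding good_def dB
  proof (intro conjI)
    show "(\<integral>\<^sup>+v. ennreal ((h n \<eta> v)\<^sup>2) \<partial>Pn n) \<le> ennreal (\<kappa> * (\<delta> ?N)\<^sup>2)"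
      using hB ennreal_leI[OF B1] by (rule order_trans)
    show "ennreal b \<le> ennreal ((\<delta> ?N)\<^sup>2)" using b by (rule ennreal_leI)
    have "(\<integral>\<^sup>+v. ennreal ((h n \<eta> v)\<^sup>2) \<partial>Pn n) * ennreal b \<le> ennreal ?B * ennreal b"
      using hB by (rule mult_right_mono) simp
    also have "\<dots> = ennreal (?B * b)" using B0 ab0 by (simp add: ennreal_mult)
    also have "\<dots> \<le> ennreal (\<kappa> * (\<delta> ?N)\<^sup>2 / ?N)" using B2 by (rule ennreal_leI)
    finally show "(\<integral>\<^sup>+v. ennreal ((h n \<eta> v)\<^sup>2) \<partial>Pn n) * ennreal b \<le> ennreal (\<kappa> * (\<delta> ?N)\<^sup>2 / ?N)" .
  qed
qed

section \<open>Folds of a random partition and their auxiliary samples\<close>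

lemma prob_space_sample: "prob_space (sample N (Pn n))"
  unfolding sample_def by (rule prob_space_PiM) (rule L.prob_space_axioms)

lemma K_pos: "K > 0" using K by simp

lemma Parts_ne: "Parts (K * n) K \<noteq> {}" by (rule Parts_nonempty[OF K_pos])

lemmas uniform_Omega = uniform_pair[OF finite_Parts Parts_ne[of n] prob_space_sample[of "K * n" n], folded Omega_def] for n

lemma prob_space_Omega: "prob_space (\<Omega> n)" by (rule uniform_Omega(1))

definition "bad n J = {w\<in>space (sample (K * n) (Pn n)). \<not> good n (eta_hat est (K * n) J w)}"

lemma bad_sets: "J \<subseteq> {..<K * n} \<Longrightarrow> bad n J \<in> sets (sample (K * n) (Pn n))"
proof -
  assume J: "J \<subseteq> {..<K * n}"
  have "bad n J = space (sample (K * n) (Pn n)) - {w\<in>space (sample (K * n) (Pn n)). good n (eta_hat est (K * n) J w)}"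
    by (auto simp: bad_def)
  then show ?thesis using good_sets[OF J] by simp
qed

text \<open>The failure probability for one fold index, averaged over partitions, equals the one for
  a random subset. For an individual partition it need not be small.\<close>

lemma average_bad:
  assumes n: "n > 0" and k: "k < K"
  shows "(\<Sum>\<pi>\<in>Parts (K * n) K. measure (sample (K * n) (Pn n)) (bad n (aux n \<pi> k))) / card (Parts (K * n) K) \<le> \<Delta> (K * n)"
proof -
  let ?N = "K * n" and ?S = "sample (K * n) (Pn n)" and ?I = "Subs (K * n) n"
  have Nn: "?N div K = n" using K by simp
  obtain \<pi> where "\<pi> \<in> Parts ?N K" using Parts_ne by blast
  then have ne: "?I \<noteq> {}" using fold_in_Subs[of \<pi> ?N K k] k Nn by auto
  note uS = uniform_pair[OF finite_Subs ne prob_space_sample[of ?N n], folded OmegaSub_def]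
  let ?W = "OmegaSub ?N n (Pn n)"
  interpret W: prob_space ?W by (rule uS(1))
  let ?G = "{(I, w) \<in> space ?W. nuisance_good s (lawX MX (Pn n)) C q (\<delta> ?N) ?N
               (eta_hat est ?N ({..<?N} - I) w) (eta0 s \<theta>0 g0 m0 (Pn n))}"
  let ?B = "{(I, w). I \<in> ?I \<and> w \<in> bad n ({..<?N} - I)}"
  have "1 - \<Delta> ?N \<le> measure (OmegaSub ?N (?N div K) (Pn n)) {(I, w) \<in> space (OmegaSub ?N (?N div K) (Pn n)).
       nuisance_good s (lawX MX (Pn n)) C q (\<delta> ?N) ?N
               (eta_hat est ?N ({..<?N} - I) w) (eta0 s \<theta>0 g0 m0 (Pn n))}"
    using reg[rule_format, of n] n K_pos unfolding regular_def
    by (elim conjE, drule_tac x="?N" in spec) (rule mp, assumption, simp)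
  then have mG: "measure ?W ?G \<ge> 1 - \<Delta> ?N" unfolding Nn .
  have Bs: "?B \<in> sets ?W" by (intro uS(3) bad_sets) auto
  have "measure ?W ?B \<le> \<Delta> ?N"
  proof (cases "?G \<in> sets ?W")
    case True
    have disj: "?G \<inter> ?B = {}"
    proof -
      have False if "(I, w) \<in> ?G" "(I, w) \<in> ?B" for I w
        using that good_of_nuisance_good[OF eta_measurable[of "{..<?N} - I" ?N w n] n]
        by (auto simp: bad_def)
      then show ?thesis by auto
    qed
    have "measure ?W ?G + measure ?W ?B = measure ?W (?G \<union> ?B)"
      using True Bs disj by (intro W.finite_measure_Union[symmetric])
    also have "\<dots> \<le> 1" by (rule W.prob_le_1)
    finally show ?thesis using mG by linarith
  next
    case False
    \<comment> \<open>then the measure in condition (e) is the junk value 0, which forces \<open>\<Delta> \<ge> 1\<close>\<close>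
    then have "measure ?W ?G = 0" by (rule measure_notin_sets)
    then show ?thesis using mG W.prob_le_1[of ?B] by linarith
  qed
  also have "measure ?W ?B = (\<Sum>I\<in>?I. measure ?S (bad n ({..<?N} - I))) / card ?I"
    by (intro uS(4) bad_sets) auto
  also have "\<dots> = (\<Sum>\<pi>\<in>Parts ?N K. measure ?S (bad n (aux n \<pi> k))) / card (Parts ?N K)"
    using average_over_folds[OF k, of "\<lambda>I. measure ?S (bad n ({..<?N} - I))" ?N] Parts_ne Nn by simp
  finally show ?thesis .
qed

text \<open>The sample-splitting principle. Given a good auxiliary sample the event has conditional
  probability at most \<open>b\<close>; bad auxiliary samples add \<open>\<Delta> (K * n)\<close>
  after averaging over partitions.\<close>

lemma fold_event_bound:
  assumes n: "n > 0" and k: "k < K" and b: "b \<ge> 0"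
    and A: "\<And>\<pi>. \<pi> \<in> Parts (K * n) K \<Longrightarrow> A \<pi> \<in> sets (sample (K * n) (Pn n))"
    and le: "\<And>\<pi> w. \<pi> \<in> Parts (K * n) K \<Longrightarrow> w \<in> space (sample (K * n) (Pn n)) \<Longrightarrow> good n (\<eta>h n \<pi> w k) \<Longrightarrow>
       emeasure (PiM (fold (K * n) \<pi> k) (\<lambda>_. Pn n)) {y\<in>space (PiM (fold (K * n) \<pi> k) (\<lambda>_. Pn n)).
         merge (fold (K * n) \<pi> k) (aux n \<pi> k) (y, restrict w (aux n \<pi> k)) \<in> A \<pi>} \<le> ennreal b"
  shows "holds_except (\<Omega> n) (b + \<Delta> (K * n)) (\<lambda>(\<pi>, w). w \<notin> A \<pi>)"
proof -
  let ?N = "K * n" and ?S = "sample (K * n) (Pn n)"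
  interpret S: prob_space ?S by (rule prob_space_sample)
  \<comment> \<open>This is the union of \<open>A \<pi>\<close> and the bad event, written as a
    disjoint union because its two parts are bounded for different reasons.\<close>
  define B where "B \<pi> = (A \<pi> - bad n (aux n \<pi> k)) \<union> bad n (aux n \<pi> k)" for \<pi>
  have badS: "bad n (aux n \<pi> k) \<in> sets ?S" for \<pi> by (rule bad_sets) auto
  have AS: "A \<pi> - bad n (aux n \<pi> k) \<in> sets ?S" if "\<pi> \<in> Parts ?N K" for \<pi>
    using A[OF that] badS by auto
  have BS: "B \<pi> \<in> sets ?S" if "\<pi> \<in> Parts ?N K" for \<pi>
    unfolding B_def using AS[OF that] badS by (rule sets.Un)
  have mA: "measure ?S (A \<pi> - bad n (aux n \<pi> k)) \<le> b" if p: "\<pi> \<in> Parts ?N K" for \<pi>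
  proof -
    let ?I = "fold ?N \<pi> k" and ?J = "aux n \<pi> k"
    have "emeasure ?S (A \<pi> - bad n ?J) \<le> ennreal b"
    proof (rule emeasure_sample_le_of_conditional[OF L.prob_space_axioms fold_subset AS[OF p]])
      fix w assume w: "w \<in> space ?S"
      have r: "restrict (merge ?I ?J (y, w)) ?J = restrict w ?J" for y
        by (auto simp: merge_def restrict_def)
      \<comment> \<open>Replacing the observations of the main fold leaves the nuisance estimate
        unchanged, so it acts as a constant in the conditional bound.\<close>
      have e: "eta_hat est ?N ?J (merge ?I ?J (y, w)) = eta_hat est ?N ?J w" for y
        unfolding eta_hat_def r ..
      have sp: "A \<pi> \<subseteq> space ?S" using A[OF p] by (rule sets.sets_into_space)
      show "emeasure (PiM ?I (\<lambda>_. Pn n)) {y\<in>space (PiM ?I (\<lambda>_. Pn n)). merge ?I ?J (y, restrict w ?J) \<in> A \<pi> - bad n ?J} \<le> ennreal b"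
      proof (cases "good n (eta_hat est ?N ?J w)")
        case True
        then have "{y\<in>space (PiM ?I (\<lambda>_. Pn n)). merge ?I ?J (y, restrict w ?J) \<in> A \<pi> - bad n ?J} =
          {y\<in>space (PiM ?I (\<lambda>_. Pn n)). merge ?I ?J (y, restrict w ?J) \<in> A \<pi>}"
          by (auto simp: bad_def e)
        then show ?thesis using le[OF p w True] by simp
      next
        case False
        then have eq: "{y\<in>space (PiM ?I (\<lambda>_. Pn n)). merge ?I ?J (y, restrict w ?J) \<in> A \<pi> - bad n ?J} = {}"
          using sp by (auto simp: bad_def e)
        show ?thesis unfolding eq by simp
      qed
    qed
    then show ?thesis using b by (simp add: S.emeasure_eq_measure)
  qed
  show ?thesis
    unfolding holds_except_def
  proof (intro bexI conjI)
    let ?E = "{(\<pi>, w). \<pi> \<in> Parts ?N K \<and> w \<in> B \<pi>}"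
    show "?E \<in> sets (\<Omega> n)" by (rule uniform_Omega(3)) (rule BS)
    have "measure (\<Omega> n) ?E = (\<Sum>\<pi>\<in>Parts ?N K. measure ?S (B \<pi>)) / card (Parts ?N K)"
      by (rule uniform_Omega(4)) (rule BS)
    also have "\<dots> \<le> (\<Sum>\<pi>\<in>Parts ?N K. b + measure ?S (bad n (aux n \<pi> k))) / card (Parts ?N K)"
    proof (intro divide_right_mono sum_mono)
      fix \<pi> assume p: "\<pi> \<in> Parts ?N K"
      have "measure ?S (B \<pi>) \<le> measure ?S (A \<pi> - bad n (aux n \<pi> k)) + measure ?S (bad n (aux n \<pi> k))"
        unfolding B_def by (rule measure_Un_le[OF AS[OF p] badS])
      then show "measure ?S (B \<pi>) \<le> b + measure ?S (bad n (aux n \<pi> k))" using mA[OF p] by simp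
    qed simp
    also have "\<dots> = b + (\<Sum>\<pi>\<in>Parts ?N K. measure ?S (bad n (aux n \<pi> k))) / card (Parts ?N K)"
      using Parts_ne finite_Parts by (simp add: sum.distrib add_divide_distrib card_gt_0_iff)
    also have "\<dots> \<le> b + \<Delta> ?N" using average_bad[OF n k] by simp
    finally show "measure (\<Omega> n) ?E \<le> b + \<Delta> ?N" .
    show "\<forall>\<omega>\<in>space (\<Omega> n) - ?E. case \<omega> of (\<pi>, w) \<Rightarrow> w \<notin> A \<pi>"
      by (auto simp: uniform_Omega(2) B_def)
  qed
qed

section \<open>Limit theorems for averages over one fold\<close>

definition avg :: "nat \<Rightarrow> (nat \<Rightarrow> 'x nuis \<Rightarrow> 'x obs \<Rightarrow> real) \<Rightarrow> nat \<times> (nat \<Rightarrow> nat) \<times> (nat \<Rightarrow> 'x obs) \<Rightarrow> real" where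
  "avg k H = (\<lambda>(n, \<pi>, w). En (fold (K * n) \<pi> k) w (H n (\<eta>h n \<pi> w k)))"

definition meas_fun :: "(nat \<Rightarrow> 'x nuis \<Rightarrow> 'x obs \<Rightarrow> real) \<Rightarrow> bool" where
  "meas_fun H \<longleftrightarrow> (\<forall>n J i. J \<subseteq> {..<K * n} \<longrightarrow> i < K * n \<longrightarrow>
     (\<lambda>w. H n (eta_hat est (K * n) J w) (w i)) \<in> borel_measurable (sample (K * n) (Pn n)))"

lemma card_fold: "\<pi> \<in> Parts (K * n) K \<Longrightarrow> k < K \<Longrightarrow> card (fold (K * n) \<pi> k) = n"
  using K by (auto simp: Parts_def fold_def)

lemma En_merge: "En I (merge I J (y, x)) f = En I y f"
  unfolding En_def by (auto simp: merge_def intro!: arg_cong2[where f="(/)"] sum.cong)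

lemma avg_measurable:
  assumes H: "meas_fun H"
  shows "(\<lambda>w. En (fold (K * n) \<pi> k) w (H n (\<eta>h n \<pi> w k))) \<in> borel_measurable (sample (K * n) (Pn n))"
  unfolding En_def using H[unfolded meas_fun_def] fold_subset[of "K * n" \<pi> k]
  by (intro borel_measurable_divide borel_measurable_sum) auto

text \<open>The function \<Phi> lets one argument serve both moment bounds: a scaled absolute value
  for Chebyshev, the identity for Markov.\<close>

lemma avg_event:
  fixes \<Phi> :: "real \<Rightarrow> real"
  assumes n: "n > 0" and k: "k < K" and H: "meas_fun H" and b: "b \<ge> 0"
    and \<Phi>: "\<Phi> \<in> borel_measurable borel"
    and le: "\<And>\<eta> I. nuis_meas \<eta> \<Longrightarrow> good n \<eta> \<Longrightarrow> finite I \<Longrightarrow> card I = n \<Longrightarrow>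
       H n \<eta> \<in> borel_measurable (Pn n) \<and>
       emeasure (PiM I (\<lambda>_. Pn n)) {y\<in>space (PiM I (\<lambda>_. Pn n)). e \<le> \<Phi> (En I y (H n \<eta>))} \<le> ennreal b"
  shows "holds_except (\<Omega> n) (b + \<Delta> (K * n)) (\<lambda>\<omega>. \<Phi> (avg k H (n, \<omega>)) < e)"
proof -
  let ?N = "K * n" and ?S = "sample (K * n) (Pn n)"
  define A where "A \<pi> = {w\<in>space ?S. e \<le> \<Phi> (En (fold ?N \<pi> k) w (H n (\<eta>h n \<pi> w k)))}" for \<pi>
  have level: "{w\<in>space M. e \<le> f w} \<in> sets M" if "f \<in> borel_measurable M" for f and M :: "'b measure"
    using that by measurable
  have "holds_except (\<Omega> n) (b + \<Delta> (K * n)) (\<lambda>(\<pi>, w). w \<notin> A \<pi>)"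
  proof (rule fold_event_bound[OF n k b])
    fix \<pi> assume "\<pi> \<in> Parts ?N K"
    show "A \<pi> \<in> sets ?S"
      unfolding A_def by (rule level[OF measurable_compose[OF avg_measurable[OF H] \<Phi>]])
  next
    fix \<pi> w assume p: "\<pi> \<in> Parts ?N K" and w: "w \<in> space ?S" and g: "good n (\<eta>h n \<pi> w k)"
    let ?I = "fold ?N \<pi> k" and ?J = "aux n \<pi> k"
    have r: "restrict (merge ?I ?J (y, w)) ?J = restrict w ?J" for y
      by (auto simp: merge_def restrict_def)
    have e': "eta_hat est ?N ?J (merge ?I ?J (y, w)) = eta_hat est ?N ?J w" for y
      unfolding eta_hat_def r ..
    have fin: "finite ?I" by (rule finite_subset[OF fold_subset]) simp
    have nm: "nuis_meas (\<eta>h n \<pi> w k)" using eta_measurable[of ?J ?N w n] w by auto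
    note H1 = le[OF nm g fin card_fold[OF p k]]
    have "emeasure (PiM ?I (\<lambda>_. Pn n)) {y\<in>space (PiM ?I (\<lambda>_. Pn n)). merge ?I ?J (y, restrict w ?J) \<in> A \<pi>}
      \<le> emeasure (PiM ?I (\<lambda>_. Pn n)) {y\<in>space (PiM ?I (\<lambda>_. Pn n)). e \<le> \<Phi> (En ?I y (H n (\<eta>h n \<pi> w k)))}"
    proof (rule emeasure_mono)
      have [measurable]: "H n (\<eta>h n \<pi> w k) \<in> borel_measurable (Pn n)" using H1 by auto
      have En_m: "(\<lambda>y. En ?I y (H n (\<eta>h n \<pi> w k))) \<in> borel_measurable (PiM ?I (\<lambda>_. Pn n))"
        unfolding En_def by measurable
      show "{y\<in>space (PiM ?I (\<lambda>_. Pn n)). e \<le> \<Phi> (En ?I y (H n (\<eta>h n \<pi> w k)))} \<in> sets (PiM ?I (\<lambda>_. Pn n))"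
        by (rule level[OF measurable_compose[OF En_m \<Phi>]])
    qed (auto simp: A_def En_merge e')
    also have "\<dots> \<le> ennreal b" using H1 by simp
    finally show "emeasure (PiM ?I (\<lambda>_. Pn n)) {y\<in>space (PiM ?I (\<lambda>_. Pn n)). merge ?I ?J (y, restrict w ?J) \<in> A \<pi>} \<le> ennreal b" .
  qed
  then show ?thesis
    by (rule holds_except_mono) (auto simp: A_def avg_def uniform_Omega(2))
qed

lemma avg_event_L2:
  assumes n: "n > 0" and k: "k < K" and H: "meas_fun H" and e: "e > 0"
    and 1: "\<And>\<eta>. nuis_meas \<eta> \<Longrightarrow> good n \<eta> \<Longrightarrow>
       H n \<eta> \<in> borel_measurable (Pn n) \<and> integrable (Pn n) (\<lambda>v. (H n \<eta> v)\<^sup>2) \<and> (\<integral>v. H n \<eta> v \<partial>Pn n) = 0 \<and>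
       (\<integral>v. (H n \<eta> v)\<^sup>2 \<partial>Pn n) \<le> b"
    and b: "b \<ge> 0"
  shows "holds_except (\<Omega> n) (b / e\<^sup>2 + \<Delta> (K * n)) (\<lambda>\<omega>. \<bar>sqrt n * avg k H (n, \<omega>)\<bar> < e)"
proof -
  have "holds_except (\<Omega> n) (b / e\<^sup>2 + \<Delta> (K * n)) (\<lambda>\<omega>. sqrt n * \<bar>avg k H (n, \<omega>)\<bar> < e)"
  proof (rule avg_event[OF n k H])
    fix \<eta> and I :: "nat set" assume "nuis_meas \<eta>" "good n \<eta>" and I: "finite I" "card I = n"
    note H1 = 1[OF this(1,2)]
    show "H n \<eta> \<in> borel_measurable (Pn n) \<and>
       emeasure (PiM I (\<lambda>_. Pn n)) {y\<in>space (PiM I (\<lambda>_. Pn n)). e \<le> sqrt n * \<bar>En I y (H n \<eta>)\<bar>} \<le> ennreal (b / e\<^sup>2)"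
      using PiM_chebyshev[OF L.prob_space_axioms I(1) _ _ _ _ e, where f="H n \<eta>" and b=b] H1 I(2) by simp
  qed (use b in auto)
  then show ?thesis by (simp add: abs_mult)
qed

lemma avg_event_L1:
  assumes n: "n > 0" and k: "k < K" and H: "meas_fun H" and e: "e > 0"
    and 1: "\<And>\<eta>. nuis_meas \<eta> \<Longrightarrow> good n \<eta> \<Longrightarrow> integrable (Pn n) (H n \<eta>) \<and> (\<integral>v. \<bar>H n \<eta> v\<bar> \<partial>Pn n) \<le> b"
    and b: "b \<ge> 0"
  shows "holds_except (\<Omega> n) (b / e + \<Delta> (K * n)) (\<lambda>\<omega>. avg k (\<lambda>n \<eta> v. \<bar>H n \<eta> v\<bar>) (n, \<omega>) < e)"
proof (rule avg_event[OF n k _ _ measurable_ident_sets[OF refl]])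
  show "meas_fun (\<lambda>n \<eta> v. \<bar>H n \<eta> v\<bar>)"
    using H unfolding meas_fun_def by (intro allI impI borel_measurable_abs) simp
  fix \<eta> and I :: "nat set" assume "nuis_meas \<eta>" "good n \<eta>" and I: "finite I"
  note H1 = 1[OF this(1,2)]
  then show "(\<lambda>v. \<bar>H n \<eta> v\<bar>) \<in> borel_measurable (Pn n) \<and>
     emeasure (PiM I (\<lambda>_. Pn n)) {y\<in>space (PiM I (\<lambda>_. Pn n)). e \<le> En I y (\<lambda>v. \<bar>H n \<eta> v\<bar>)} \<le> ennreal (b / e)"
    using PiM_markov[OF L.prob_space_axioms I _ _ e, where f="H n \<eta>" and b=b] by auto
qed (use b e in auto)

lemma K_mult_at_top: "filterlim (\<lambda>n. K * n) at_top sequentially"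
  using K_pos by (intro filterlim_subseq) (auto simp: strict_mono_def)

lemma Delta_tendsto: "(\<lambda>n. \<Delta> (K * n)) \<longlonglongrightarrow> 0"
  using filterlim_compose[OF \<Delta>(2) K_mult_at_top] .

lemma delta_tendsto: "(\<lambda>n. \<delta> (K * n)) \<longlonglongrightarrow> 0"
  using filterlim_compose[OF \<delta>(2) K_mult_at_top] .

lemma avg_L2_tendsto:
  assumes k: "k < K" and H: "meas_fun H"
    and 1: "\<And>n \<eta>. n > 0 \<Longrightarrow> nuis_meas \<eta> \<Longrightarrow> good n \<eta> \<Longrightarrow>
       H n \<eta> \<in> borel_measurable (Pn n) \<and> integrable (Pn n) (\<lambda>v. (H n \<eta> v)\<^sup>2) \<and> (\<integral>v. H n \<eta> v \<partial>Pn n) = 0 \<and>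
       (\<integral>v. (H n \<eta> v)\<^sup>2 \<partial>Pn n) \<le> b n"
    and b: "b \<longlonglongrightarrow> 0" "\<And>n. b n \<ge> 0"
  shows "vanishes (\<lambda>x. sqrt (fst x) * avg k H x)"
proof (rule tendsto_in_prob_I)
  fix e r :: real assume er: "e > 0" "r > 0"
  have "(\<lambda>n. b n / e\<^sup>2 + \<Delta> (K * n)) \<longlonglongrightarrow> 0 / e\<^sup>2 + 0"
    using er by (intro tendsto_intros b Delta_tendsto) auto
  then have "\<forall>\<^sub>F n in sequentially. b n / e\<^sup>2 + \<Delta> (K * n) < r" using er by (intro order_tendstoD) auto
  with eventually_gt_at_top[of 0]
  show "\<forall>\<^sub>F n in sequentially. holds_except (\<Omega> n) r (\<lambda>\<omega>. \<bar>sqrt (fst (n, \<omega>)) * avg k H (n, \<omega>)\<bar> < e)"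
  proof eventually_elim
    case (elim n)
    from avg_event_L2[OF elim(1) k H er(1) 1[OF elim(1)] b(2)] show ?case
      by (rule holds_except_mono) (use elim in auto)
  qed
qed

lemma avg_L2_tight:
  assumes k: "k < K" and H: "meas_fun H"
    and 1: "\<And>n \<eta>. n > 0 \<Longrightarrow> nuis_meas \<eta> \<Longrightarrow> good n \<eta> \<Longrightarrow>
       H n \<eta> \<in> borel_measurable (Pn n) \<and> integrable (Pn n) (\<lambda>v. (H n \<eta> v)\<^sup>2) \<and> (\<integral>v. H n \<eta> v \<partial>Pn n) = 0 \<and>
       (\<integral>v. (H n \<eta> v)\<^sup>2 \<partial>Pn n) \<le> b"
    and b: "b \<ge> 0"
  shows "tight_prob \<Omega> (\<lambda>x. sqrt (fst x) * avg k H x)"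
  unfolding tight_prob_def
proof (intro allI impI)
  fix r :: real assume r: "r > 0"
  \<comment> \<open>Chosen to make b / e^2 = (r / 2) b / (b + 1), which is below r / 2; the other
    half of r pays for \<Delta>.\<close>
  define e where "e = sqrt (2 * (b + 1) / r)"
  have e: "e > 0" "b / e\<^sup>2 < r / 2"
    using b r by (auto simp: e_def divide_simps)
  have "\<forall>\<^sub>F n in sequentially. \<Delta> (K * n) < r / 2" using r by (intro order_tendstoD[OF Delta_tendsto]) auto
  with eventually_gt_at_top[of 0]
  have "\<forall>\<^sub>F n in sequentially. holds_except (\<Omega> n) r (\<lambda>\<omega>. \<bar>sqrt (fst (n, \<omega>)) * avg k H (n, \<omega>)\<bar> \<le> e)"
  proof eventually_elim
    case (elim n)
    have "b / e\<^sup>2 + \<Delta> (K * n) \<le> r" using elim(2) e(2) by linarith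
    with avg_event_L2[OF elim(1) k H e(1) 1[OF elim(1)] b] show ?case
      by (rule holds_except_mono) auto
  qed
  then show "\<exists>B. \<forall>\<^sub>F n in sequentially. holds_except (\<Omega> n) r (\<lambda>\<omega>. \<bar>sqrt (fst (n, \<omega>)) * avg k H (n, \<omega>)\<bar> \<le> B)" by blast
qed

lemma avg_nonneg: "(\<And>n \<eta> v. 0 \<le> H n \<eta> v) \<Longrightarrow> 0 \<le> avg k H x"
  by (cases x) (simp add: avg_def En_def divide_nonneg_nonneg sum_nonneg)

lemma avg_L1_tendsto:
  assumes k: "k < K" and H: "meas_fun H"
    and 1: "\<And>n \<eta>. n > 0 \<Longrightarrow> nuis_meas \<eta> \<Longrightarrow> good n \<eta> \<Longrightarrow>
       integrable (Pn n) (H n \<eta>) \<and> (\<integral>v. \<bar>H n \<eta> v\<bar> \<partial>Pn n) \<le> b n"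
    and b: "b \<longlonglongrightarrow> 0" "\<And>n. b n \<ge> 0"
  shows "vanishes (avg k (\<lambda>n \<eta> v. \<bar>H n \<eta> v\<bar>))"
proof (rule tendsto_in_prob_I)
  fix e r :: real assume er: "e > 0" "r > 0"
  have "(\<lambda>n. b n / e + \<Delta> (K * n)) \<longlonglongrightarrow> 0 / e + 0"
    using er by (intro tendsto_intros b Delta_tendsto) auto
  then have "\<forall>\<^sub>F n in sequentially. b n / e + \<Delta> (K * n) < r" using er by (intro order_tendstoD) auto
  with eventually_gt_at_top[of 0]
  show "\<forall>\<^sub>F n in sequentially. holds_except (\<Omega> n) r (\<lambda>\<omega>. \<bar>avg k (\<lambda>n \<eta> v. \<bar>H n \<eta> v\<bar>) (n, \<omega>)\<bar> < e)"
  proof eventually_elim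
    case (elim n)
    from avg_event_L1[OF elim(1) k H er(1) 1[OF elim(1)] b(2)] show ?case
      by (rule holds_except_mono) (use elim avg_nonneg[of "\<lambda>n \<eta> v. \<bar>H n \<eta> v\<bar>" k] in auto)
  qed
qed

section \<open>Calculus of fold averages\<close>

lemma meas_fun_basic:
  "meas_fun h" "meas_fun d" "meas_fun (\<lambda>n _. U n)" "meas_fun (\<lambda>n _. V n)" "meas_fun (\<lambda>_ _. Dof)" "meas_fun (\<lambda>n _ _. a n)"
  unfolding meas_fun_def by (auto intro: hd_measurable_at intro!: measurable_compose[OF measurable_sample_component])

lemma meas_fun_ops:
  assumes "meas_fun F" "meas_fun G"
  shows "meas_fun (\<lambda>n \<eta> v. F n \<eta> v + G n \<eta> v)" "meas_fun (\<lambda>n \<eta> v. F n \<eta> v - G n \<eta> v)" "meas_fun (\<lambda>n \<eta> v. F n \<eta> v * G n \<eta> v)"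
    "meas_fun (\<lambda>n \<eta> v. F n \<eta> v / G n \<eta> v)"
  using assms unfolding meas_fun_def
  by (intro allI impI borel_measurable_add borel_measurable_diff borel_measurable_times borel_measurable_divide; simp)+

lemma meas_fun_pow: "meas_fun F \<Longrightarrow> meas_fun (\<lambda>n \<eta> v. (F n \<eta> v) ^ p)"
  unfolding meas_fun_def by (intro allI impI borel_measurable_power; simp)

lemma meas_fun_trunc: "meas_fun F \<Longrightarrow> meas_fun (\<lambda>n \<eta> v. if F n \<eta> v \<le> a n then F n \<eta> v else 0)"
  unfolding meas_fun_def
proof (intro allI impI)
  fix n J i assume F: "\<forall>n J i. J \<subseteq> {..<K * n} \<longrightarrow> i < K * n \<longrightarrow>
      (\<lambda>w. F n (eta_hat est (K * n) J w) (w i)) \<in> borel_measurable (sample (K * n) (Pn n))"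
    and Ji: "J \<subseteq> {..<K * n}" "i < K * n"
  have [measurable]: "(\<lambda>w. F n (eta_hat est (K * n) J w) (w i)) \<in> borel_measurable (sample (K * n) (Pn n))"
    using F Ji by simp
  show "(\<lambda>w. if F n (eta_hat est (K * n) J w) (w i) \<le> a n then F n (eta_hat est (K * n) J w) (w i) else 0)
      \<in> borel_measurable (sample (K * n) (Pn n))"
    by measurable
qed

lemmas meas_fun_intros = meas_fun_basic meas_fun_ops meas_fun_pow

lemma avg_add: "avg k (\<lambda>n \<eta> v. F n \<eta> v + G n \<eta> v) x = avg k F x + avg k G x"
  and avg_diff: "avg k (\<lambda>n \<eta> v. F n \<eta> v - G n \<eta> v) x = avg k F x - avg k G x"
  and avg_cmult: "avg k (\<lambda>n \<eta> v. a n * F n \<eta> v) x = a (fst x) * avg k F x"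
  and avg_cdiv: "avg k (\<lambda>n \<eta> v. F n \<eta> v / a n) x = avg k F x / a (fst x)"
  and avg_uminus: "avg k (\<lambda>n \<eta> v. - F n \<eta> v) x = - avg k F x"
  by (cases x; simp add: avg_def En_def sum.distrib sum_subtractf sum_distrib_left[symmetric] sum_negf
    sum_divide_distrib[symmetric] add_divide_distrib diff_divide_distrib)+

lemma avg_mono: "(\<And>n \<eta> v. F n \<eta> v \<le> G n \<eta> v) \<Longrightarrow> avg k F x \<le> avg k G x"
  by (cases x) (simp add: avg_def En_def divide_right_mono sum_mono)

lemma avg_abs: "\<bar>avg k F x\<bar> \<le> avg k (\<lambda>n \<eta> v. \<bar>F n \<eta> v\<bar>) x"
  by (cases x) (simp add: avg_def En_def divide_right_mono sum_abs)

lemma space_Omega_D: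
  assumes "snd x \<in> space (\<Omega> (fst x))"
  shows "fst (snd x) \<in> Parts (K * fst x) K" "snd (snd x) \<in> space (sample (K * fst x) (obs_space MX))"
  using assms by (cases x; auto simp: uniform_Omega(2) space_sample)+

lemma avg_const: "snd x \<in> space (\<Omega> (fst x)) \<Longrightarrow> fst x > 0 \<Longrightarrow> k < K \<Longrightarrow> avg k (\<lambda>n \<eta> v. a n) x = a (fst x)"
  using card_fold[of "fst (snd x)" "fst x" k] space_Omega_D[of x]
  by (cases x) (simp add: avg_def En_def)

lemma avg_square_le:
  assumes x: "snd x \<in> space (\<Omega> (fst x))" and k: "k < K"
  shows "avg k (\<lambda>n \<eta> v. (F n \<eta> v)\<^sup>2) x / fst x \<le> (avg k (\<lambda>n \<eta> v. \<bar>F n \<eta> v\<bar>) x)\<^sup>2"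
proof -
  obtain n \<pi> w where xe: "x = (n, \<pi>, w)" by (cases x) auto
  have "card (fold (K * n) \<pi> k) = n" using card_fold[OF _ k] space_Omega_D[OF x] by (simp add: xe)
  moreover have "finite (fold (K * n) \<pi> k)" by (rule finite_subset[OF fold_subset]) simp
  ultimately show ?thesis
    using sum_squares_le_square_sum[of "fold (K * n) \<pi> k" "\<lambda>i. F n (\<eta>h n \<pi> w k) (w i)"]
    by (simp add: xe avg_def En_def power_divide power2_eq_square[of "real n"] divide_right_mono divide_divide_eq_left)
qed

lemma eventually_space: "eventually (\<lambda>x. fst x > 0 \<and> snd x \<in> space (\<Omega> (fst x))) (in_prob \<Omega>)"
  by (rule eventually_in_prob_everywhere) (auto intro: eventually_mono[OF eventually_gt_at_top[of 0]])

lemma tendsto_of_seq: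
  assumes "a \<longlonglongrightarrow> (l::real)" shows "((\<lambda>x. a (fst x)) \<longlongrightarrow> l) (in_prob \<Omega>)"
proof (rule tendstoI)
  fix e :: real assume "e > 0"
  then show "eventually (\<lambda>x. dist (a (fst x)) l < e) (in_prob \<Omega>)"
    by (intro eventually_in_prob_everywhere eventually_mono[OF tendstoD[OF assms]]) auto
qed

lemma tight_of_bounded: "(\<And>n. \<bar>a n\<bar> \<le> B) \<Longrightarrow> tight_prob \<Omega> (\<lambda>x. a (fst x))"
  by (rule tight_prob_bounded[of _ B]) (simp add: always_eventually)

section \<open>Orthogonal and product remainders of the score\<close>

lemma hV:
  assumes m: "nuis_meas \<eta>" and g: "good n \<eta>"
  shows "integrable (Pn n) (\<lambda>v. (h n \<eta> v * V n v)\<^sup>2)" "(\<integral>v. (h n \<eta> v * V n v)\<^sup>2 \<partial>Pn n) \<le> C * (\<kappa> * (\<delta> (K * n))\<^sup>2)"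
    "(\<integral>v. h n \<eta> v * V n v \<partial>Pn n) = 0"
proof -
  note f = L.fV[OF hd_measurable(1)[OF m, of n], folded h_def, OF goodD(1)[OF m g]]
  show "integrable (Pn n) (\<lambda>v. (h n \<eta> v * V n v)\<^sup>2)" "(\<integral>v. h n \<eta> v * V n v \<partial>Pn n) = 0" by (rule f)+
  have "C * (\<integral>v. (h n \<eta> v)\<^sup>2 \<partial>Pn n) \<le> C * (\<kappa> * (\<delta> (K * n))\<^sup>2)"
    using goodD(2)[OF m g] cpos by (intro mult_left_mono) auto
  with f(2) show "(\<integral>v. (h n \<eta> v * V n v)\<^sup>2 \<partial>Pn n) \<le> C * (\<kappa> * (\<delta> (K * n))\<^sup>2)" by (rule order_trans)
qed

lemma Ud:
  assumes m: "nuis_meas \<eta>" and g: "good n \<eta>"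
  shows "integrable (Pn n) (\<lambda>v. (U n v * d n \<eta> v)\<^sup>2)" "(\<integral>v. (U n v * d n \<eta> v)\<^sup>2 \<partial>Pn n) \<le> C * (\<delta> (K * n))\<^sup>2"
    "(\<integral>v. U n v * d n \<eta> v \<partial>Pn n) = 0"
proof -
  note f = L.fU[OF hd_measurable(2)[OF m, of n], folded d_def, OF goodD(3)[OF m g]]
  show "integrable (Pn n) (\<lambda>v. (U n v * d n \<eta> v)\<^sup>2)" "(\<integral>v. U n v * d n \<eta> v \<partial>Pn n) = 0" by (rule f)+
  have "C * (\<integral>v. (d n \<eta> v)\<^sup>2 \<partial>Pn n) \<le> C * (\<delta> (K * n))\<^sup>2"
    using goodD(4)[OF m g] cpos by (intro mult_left_mono) auto
  with f(2) show "(\<integral>v. (U n v * d n \<eta> v)\<^sup>2 \<partial>Pn n) \<le> C * (\<delta> (K * n))\<^sup>2" by (rule order_trans)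
qed

lemma integral_abs_mult_le:
  assumes "a \<in> borel_measurable (Pn n)" "b \<in> borel_measurable (Pn n)" "integrable (Pn n) (\<lambda>v. (a v)\<^sup>2)" "integrable (Pn n) (\<lambda>v. (b v)\<^sup>2)"
    and le: "(\<integral>v. (a v)\<^sup>2 \<partial>Pn n) * (\<integral>v. (b v)\<^sup>2 \<partial>Pn n) \<le> B"
  shows "integrable (Pn n) (\<lambda>v. a v * b v)" "(\<integral>v. \<bar>a v * b v\<bar> \<partial>Pn n) \<le> sqrt B"
proof -
  show "integrable (Pn n) (\<lambda>v. a v * b v)" using L.integrable_mult_of_squares[OF assms(1-4)] .
  have "(\<integral>v. \<bar>a v * b v\<bar> \<partial>Pn n)\<^sup>2 \<le> B" using L.cauchy_schwarz[OF assms(1-4)] le by (rule order_trans)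
  then show "(\<integral>v. \<bar>a v * b v\<bar> \<partial>Pn n) \<le> sqrt B" by (rule real_le_rsqrt)
qed

lemma bound_tendsto: "(\<lambda>n. a * (\<delta> (K * n))\<^sup>2) \<longlonglongrightarrow> 0" "(\<lambda>n. sqrt (a * (\<delta> (K * n))\<^sup>2)) \<longlonglongrightarrow> 0"
proof -
  have "(\<lambda>n. a * (\<delta> (K * n))\<^sup>2) \<longlonglongrightarrow> a * 0\<^sup>2" by (intro tendsto_intros delta_tendsto)
  then show *: "(\<lambda>n. a * (\<delta> (K * n))\<^sup>2) \<longlonglongrightarrow> 0" by simp
  show "(\<lambda>n. sqrt (a * (\<delta> (K * n))\<^sup>2)) \<longlonglongrightarrow> 0" using tendsto_real_sqrt[OF *] by simp
qed

text \<open>Neyman orthogonality at work: h is a function of X, so h V is centred and its variance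
  is of order \<delta>^2. Multiplication by sqrt n is affordable without any rate for
  \<delta>.\<close>

lemma hV_tendsto:
  assumes k: "k < K"
  shows "vanishes (\<lambda>x. sqrt (fst x) * avg k (\<lambda>n \<eta> v. h n \<eta> v * V n v) x)"
    "vanishes (avg k (\<lambda>n \<eta> v. (h n \<eta> v * V n v)\<^sup>2))"
proof -
  have b: "(\<lambda>n. C * (\<kappa> * (\<delta> (K * n))\<^sup>2)) \<longlonglongrightarrow> 0" "\<And>n. C * (\<kappa> * (\<delta> (K * n))\<^sup>2) \<ge> 0"
    using bound_tendsto(1)[of "C * \<kappa>"] kappa_nonneg cpos by (auto simp: mult.assoc)
  show "vanishes (\<lambda>x. sqrt (fst x) * avg k (\<lambda>n \<eta> v. h n \<eta> v * V n v) x)"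
    using hd_measurable(3) hV by (intro avg_L2_tendsto[OF k _ _ b] meas_fun_intros) auto
  show "vanishes (avg k (\<lambda>n \<eta> v. (h n \<eta> v * V n v)\<^sup>2))"
    using avg_L1_tendsto[OF k _ _ b, of "\<lambda>n \<eta> v. (h n \<eta> v * V n v)\<^sup>2", OF meas_fun_pow] meas_fun_ops(3)[OF meas_fun_basic(1,4)] hV by auto
qed

lemma Ud_tendsto:
  assumes k: "k < K"
  shows "vanishes (\<lambda>x. sqrt (fst x) * avg k (\<lambda>n \<eta> v. U n v * d n \<eta> v) x)"
    "vanishes (avg k (\<lambda>n \<eta> v. (U n v * d n \<eta> v)\<^sup>2))"
proof -
  have b: "(\<lambda>n. C * (\<delta> (K * n))\<^sup>2) \<longlonglongrightarrow> 0" "\<And>n. C * (\<delta> (K * n))\<^sup>2 \<ge> 0"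
    using bound_tendsto(1)[of "C"] cpos by auto
  show "vanishes (\<lambda>x. sqrt (fst x) * avg k (\<lambda>n \<eta> v. U n v * d n \<eta> v) x)"
    using hd_measurable(4) Ud by (intro avg_L2_tendsto[OF k _ _ b] meas_fun_intros) auto
  show "vanishes (avg k (\<lambda>n \<eta> v. (U n v * d n \<eta> v)\<^sup>2))"
    using avg_L1_tendsto[OF k _ _ b, of "\<lambda>n \<eta> v. (U n v * d n \<eta> v)\<^sup>2", OF meas_fun_pow] meas_fun_ops(3)[OF meas_fun_basic(3,2)] Ud by auto
qed

text \<open>The product of both nuisance errors has no cancellation, so the scaling by sqrt n has to
  be met by the product rate in condition (e).\<close>

lemma hd_tendsto:
  assumes k: "k < K"
  shows "vanishes (\<lambda>x. sqrt (fst x) * avg k (\<lambda>n \<eta> v. \<bar>h n \<eta> v * d n \<eta> v\<bar>) x)"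
proof -
  \<comment> \<open>The rate is stated for N = K n but the scaling uses n, which leaves the factor 1
    / K under the root.\<close>
  let ?b = "\<lambda>n. sqrt (\<kappa> / K * (\<delta> (K * n))\<^sup>2)"
  have b: "?b \<longlonglongrightarrow> 0" "\<And>n. ?b n \<ge> 0" using bound_tendsto(2)[of "\<kappa> / K"] kappa_nonneg by auto
  have "vanishes (avg k (\<lambda>n \<eta> v. \<bar>sqrt n * (h n \<eta> v * d n \<eta> v)\<bar>))"
  proof (rule avg_L1_tendsto[OF k _ _ b])
    show "meas_fun (\<lambda>n \<eta> v. sqrt n * (h n \<eta> v * d n \<eta> v))" by (intro meas_fun_intros)
    fix n \<eta> assume n: "n > 0" and m: "nuis_meas \<eta>" and g: "good n \<eta>"
    note * = integral_abs_mult_le[OF hd_measurable(3,4)[OF m] goodD(1,3,5)[OF m g]]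
    have "sqrt n * (\<integral>v. \<bar>h n \<eta> v * d n \<eta> v\<bar> \<partial>Pn n) \<le> sqrt n * sqrt (\<kappa> * (\<delta> (K * n))\<^sup>2 / real (K * n))"
      using * by (intro mult_left_mono) auto
    also have "\<dots> = ?b n" using n by (simp add: real_sqrt_mult[symmetric])
    finally show "integrable (Pn n) (\<lambda>v. sqrt n * (h n \<eta> v * d n \<eta> v)) \<and> (\<integral>v. \<bar>sqrt n * (h n \<eta> v * d n \<eta> v)\<bar> \<partial>Pn n) \<le> ?b n"
      using *(1) by (simp add: abs_mult)
  qed
  then show ?thesis by (simp add: abs_mult[of "sqrt _"] avg_cmult[abs_def])
qed

lemma d_tendsto:
  assumes k: "k < K"
  shows "vanishes (avg k (\<lambda>n \<eta> v. \<bar>Dof v * d n \<eta> v\<bar>))"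
    "vanishes (avg k (\<lambda>n \<eta> v. \<bar>V n v * d n \<eta> v\<bar>))"
    "vanishes (avg k (\<lambda>n \<eta> v. \<bar>(d n \<eta> v)\<^sup>2\<bar>))"
proof -
  let ?B = "1 + C powr q"
  have B: "0 \<le> ?B" by (simp add: add_nonneg_nonneg)
  show "vanishes (avg k (\<lambda>n \<eta> v. \<bar>Dof v * d n \<eta> v\<bar>))"
  proof (rule avg_L1_tendsto[OF k _ _ bound_tendsto(2)[of ?B]])
    fix n \<eta> assume m: "nuis_meas \<eta>" and g: "good n \<eta>"
    show "integrable (Pn n) (\<lambda>v. Dof v * d n \<eta> v) \<and> (\<integral>v. \<bar>Dof v * d n \<eta> v\<bar> \<partial>Pn n) \<le> sqrt (?B * (\<delta> (K * n))\<^sup>2)"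
      using integral_abs_mult_le[OF L.measurable_obs(2) hd_measurable(4)[OF m] L.square_moments(3) goodD(3)[OF m g] mult_mono[OF L.square_moments(4) goodD(4)[OF m g]]] B
      by simp
  qed (use B in \<open>auto intro!: meas_fun_intros\<close>)
  show "vanishes (avg k (\<lambda>n \<eta> v. \<bar>V n v * d n \<eta> v\<bar>))"
  proof (rule avg_L1_tendsto[OF k _ _ bound_tendsto(2)[of C]])
    fix n \<eta> assume m: "nuis_meas \<eta>" and g: "good n \<eta>"
    show "integrable (Pn n) (\<lambda>v. V n v * d n \<eta> v) \<and> (\<integral>v. \<bar>V n v * d n \<eta> v\<bar> \<partial>Pn n) \<le> sqrt (C * (\<delta> (K * n))\<^sup>2)"
      using integral_abs_mult_le[OF L.measurable_UV(2) hd_measurable(4)[OF m] L.V2 goodD(3)[OF m g] mult_mono[OF L.integral_V2(2) goodD(4)[OF m g]]] cpos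
      by simp
  qed (use cpos in \<open>auto intro!: meas_fun_intros\<close>)
  show "vanishes (avg k (\<lambda>n \<eta> v. \<bar>(d n \<eta> v)\<^sup>2\<bar>))"
    using goodD(3,4) by (intro avg_L1_tendsto[OF k _ _ bound_tendsto(1)[of 1]] meas_fun_intros) auto
qed

lemma UV_tight: "k < K \<Longrightarrow> tight_prob \<Omega> (\<lambda>x. sqrt (fst x) * avg k (\<lambda>n \<eta> v. U n v * V n v) x)"
  using L.UV_moments(1,2) L.integral_UV L.bounds_nonneg(4)
  by (intro avg_L2_tight[where b="L.moment_bound"] meas_fun_intros) auto

text \<open>Identities that divide by the fold size or count a fold hold only for n > 0 and genuine
  partitions; limits do not see the other points.\<close>

lemma tendsto_transform_space:
  assumes f: "(f \<longlongrightarrow> (l::real)) (in_prob \<Omega>)" and eq: "\<And>x. fst x > 0 \<Longrightarrow> snd x \<in> space (\<Omega> (fst x)) \<Longrightarrow> f x = g x"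
  shows "(g \<longlongrightarrow> l) (in_prob \<Omega>)"
  using f by (rule Lim_transform_eventually) (auto intro: eventually_mono[OF eventually_space] eq)

text \<open>Second moments may grow, as long as they are o(n). This generality is what the truncated
  squares of U V call for.\<close>

lemma avg_law_of_large_numbers:
  assumes k: "k < K" and F: "meas_fun (\<lambda>n _. F n)" "\<And>n. F n \<in> borel_measurable (Pn n)"
    and 2: "\<And>n. integrable (Pn n) (\<lambda>v. (F n v)\<^sup>2)" "\<And>n. n > 0 \<Longrightarrow> (\<integral>v. (F n v)\<^sup>2 \<partial>Pn n) / n \<le> b n"
    and b: "b \<longlonglongrightarrow> 0" "\<And>n. b n \<ge> 0"
  shows "vanishes (\<lambda>x. avg k (\<lambda>n _. F n) x - (\<integral>v. F (fst x) v \<partial>Pn (fst x)))"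
proof -
  let ?\<mu> = "\<lambda>n. \<integral>v. F n v \<partial>Pn n"
  have F1: "integrable (Pn n) (F n)" for n using L.square_integrable_imp_integrable[OF F(2) 2(1)] .
  \<comment> \<open>Dividing by sqrt n cancels the scaling in \<open>avg_L2_tendsto\<close> and
    turns the variance bound into variance / n.\<close>
  have "vanishes (\<lambda>x. sqrt (fst x) * avg k (\<lambda>n \<eta> v. (F n v - ?\<mu> n) / sqrt n) x)"
  proof (rule avg_L2_tendsto[OF k _ _ b])
    show "meas_fun (\<lambda>n \<eta> v. (F n v - ?\<mu> n) / sqrt n)" by (intro meas_fun_intros F)
    fix n :: nat assume n: "n > 0"
    have i: "integrable (Pn n) (\<lambda>v. (F n v - ?\<mu> n)\<^sup>2)"
      using 2(1)[of n] F1[of n] by (simp add: power2_diff)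
    have "(\<integral>v. (F n v - ?\<mu> n)\<^sup>2 \<partial>Pn n) = (\<integral>v. (F n v)\<^sup>2 \<partial>Pn n) - (?\<mu> n)\<^sup>2"
      using 2(1)[of n] F1[of n] by (rule L.variance_eq[rotated])
    then have le: "(\<integral>v. (F n v - ?\<mu> n)\<^sup>2 \<partial>Pn n) \<le> (\<integral>v. (F n v)\<^sup>2 \<partial>Pn n)" by simp
    have "(\<integral>v. (F n v - ?\<mu> n)\<^sup>2 \<partial>Pn n) / n \<le> b n"
      using le 2(2)[OF n] n by (meson divide_right_mono of_nat_0_le_iff order_trans)
    then show "(\<lambda>v. (F n v - ?\<mu> n) / sqrt n) \<in> borel_measurable (Pn n) \<and> integrable (Pn n) (\<lambda>v. ((F n v - ?\<mu> n) / sqrt n)\<^sup>2) \<and>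
        (\<integral>v. (F n v - ?\<mu> n) / sqrt n \<partial>Pn n) = 0 \<and> (\<integral>v. ((F n v - ?\<mu> n) / sqrt n)\<^sup>2 \<partial>Pn n) \<le> b n"
      using i F1[of n] F(2)[of n] by (simp add: power_divide L.prob_space)
  qed
  then show ?thesis
  proof (rule tendsto_transform_space)
    fix x :: "nat \<times> (nat \<Rightarrow> nat) \<times> (nat \<Rightarrow> 'x obs)" assume x: "fst x > 0" "snd x \<in> space (\<Omega> (fst x))"
    show "sqrt (fst x) * avg k (\<lambda>n \<eta> v. (F n v - ?\<mu> n) / sqrt n) x = avg k (\<lambda>n _. F n) x - ?\<mu> (fst x)"
      using x by (simp add: avg_cdiv[of k "\<lambda>n \<eta> v. F n v - ?\<mu> n" "\<lambda>n. sqrt (real n)"] avg_diff[of k "\<lambda>n _. F n" "\<lambda>n _ _. ?\<mu> n"] avg_const[OF x(2,1) k])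
  qed
qed

section \<open>Limits of the slope and of the squared leading term\<close>

lemma inverse_n_tendsto: "(\<lambda>n. a / real n) \<longlonglongrightarrow> 0"
  by (rule lim_const_over_n)

text \<open>Minus the limiting slope of either score. With \<open>\<tau>\<close>, the standard
  deviation of U V, the asymptotic standard deviation is \<open>\<tau> n / J n\<close>.\<close>

definition "J n = (\<integral>v. (V n v)\<^sup>2 \<partial>Pn n)"
definition "\<tau> n = sqrt (\<integral>v. (U n v * V n v)\<^sup>2 \<partial>Pn n)"

lemma J_bounds: "c \<le> J n" "J n \<le> C" "0 < J n"
  using L.integral_V2[of n] cpos by (auto simp: J_def)

lemma tau_bounds: "c\<^sup>2 \<le> \<tau> n" "0 < \<tau> n" "(\<tau> n)\<^sup>2 = (\<integral>v. (U n v * V n v)\<^sup>2 \<partial>Pn n)" "\<tau> n \<le> sqrt L.moment_bound"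
proof -
  show 1: "c\<^sup>2 \<le> \<tau> n" unfolding \<tau>_def using L.integral_UV2_lower[of n] by (intro real_le_rsqrt) simp
  have "0 < c\<^sup>2" using cpos by simp
  with 1 show "0 < \<tau> n" by (rule less_le_trans[rotated])
  show "(\<tau> n)\<^sup>2 = (\<integral>v. (U n v * V n v)\<^sup>2 \<partial>Pn n)" by (simp add: \<tau>_def)
  show "\<tau> n \<le> sqrt L.moment_bound" unfolding \<tau>_def using L.UV_moments(2) by (rule real_sqrt_le_mono)
qed

lemma psi_a_A: "psi_a ScoreA v \<eta> = - (Dof v * V n v) + Dof v * d n \<eta> v"
  and psi_a_B: "psi_a ScoreB v \<eta> = - (V n v * V n v) + 2 * (V n v * d n \<eta> v) - (d n \<eta> v)\<^sup>2"
  by (cases \<eta>; simp add: L.V_def d_def power2_eq_square algebra_simps)+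

lemma psi_eq: "psi s v \<theta> \<eta> = (U n v - h n \<eta> v) * (V n v - d n \<eta> v) + (\<theta> - \<theta>0 (Pn n)) * psi_a s v \<eta>"
  unfolding h_def d_def by (cases s; cases \<eta>) (simp_all add: L.V_def L.U_def power2_eq_square algebra_simps)

lemma tendsto_avg_of_abs:
  assumes "vanishes (avg k (\<lambda>n \<eta> v. \<bar>F n \<eta> v\<bar>))"
  shows "vanishes (avg k F)"
  by (rule Lim_null_comparison[OF _ assms]) (simp add: avg_abs)

text \<open>The leading part of the slope is - D V for (A) and - V^2 for (B). Both have mean -
  E[V^2], and the terms containing d vanish.\<close>

lemma psi_a_tendsto:
  assumes k: "k < K"
  shows "vanishes (\<lambda>x. avg k (\<lambda>n \<eta> v. psi_a s v \<eta>) x + J (fst x))"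
proof -
  let ?B = "L.moment_bound"
  have b: "(\<lambda>n. ?B / real n) \<longlonglongrightarrow> 0" "\<And>n. ?B / real n \<ge> 0"
    using inverse_n_tendsto L.bounds_nonneg(4) by auto
  have DV: "vanishes (\<lambda>x. avg k (\<lambda>n _ v. Dof v * V n v) x - J (fst x))"
    using avg_law_of_large_numbers[OF k meas_fun_ops(3)[OF meas_fun_basic(5,4)] _ L.UV_moments(5) divide_right_mono[OF L.UV_moments(6)] b]
    by (simp add: L.integral_DV J_def)
  have VV: "vanishes (\<lambda>x. avg k (\<lambda>n _ v. V n v * V n v) x - J (fst x))"
    using avg_law_of_large_numbers[OF k meas_fun_ops(3)[OF meas_fun_basic(4,4)] _ L.UV_moments(7) divide_right_mono[OF L.UV_moments(8)] b]
    by (simp add: J_def power2_eq_square[of "V _ _"])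
  note d0 = d_tendsto[OF k, THEN tendsto_avg_of_abs]
  show ?thesis
  proof (cases s)
    case ScoreA
    have eq: "avg k (\<lambda>n \<eta> v. psi_a s v \<eta>) x = - avg k (\<lambda>n _ v. Dof v * V n v) x + avg k (\<lambda>n \<eta> v. Dof v * d n \<eta> v) x" for x
      unfolding avg_add[symmetric] avg_uminus[symmetric]
      by (cases x) (simp add: avg_def psi_a_A[of _ _ "fst x"] ScoreA)
    show ?thesis unfolding eq using tendsto_add[OF tendsto_minus[OF DV] d0(1)] by (simp add: algebra_simps)
  next
    case ScoreB
    have eq: "avg k (\<lambda>n \<eta> v. psi_a s v \<eta>) x = - avg k (\<lambda>n _ v. V n v * V n v) x + 2 * avg k (\<lambda>n \<eta> v. V n v * d n \<eta> v) x - avg k (\<lambda>n \<eta> v. (d n \<eta> v)\<^sup>2) x" for x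
      unfolding avg_add[symmetric] avg_uminus[symmetric] avg_diff[symmetric] avg_cmult[where a="\<lambda>_. 2", symmetric]
      by (cases x) (simp add: avg_def psi_a_B[of _ _ "fst x"] ScoreB)
    show ?thesis unfolding eq using tendsto_diff[OF tendsto_add[OF tendsto_minus[OF VV] tendsto_mult[OF tendsto_const[of 2] d0(2)]] d0(3)]
      by (simp add: algebra_simps)
  qed
qed

text \<open>This average is going to be multiplied by the squared estimation error, which is O_P(1 /
  n), so growth slower than n suffices. The terms with D^2 d^2 and d^4 then reduce to first-order
  averages by \<open>avg_square_le\<close>.\<close>

lemma psi_a_square_tendsto:
  assumes k: "k < K"
  shows "vanishes (\<lambda>x. avg k (\<lambda>n \<eta> v. (psi_a s v \<eta>)\<^sup>2) x / fst x)"
proof -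
  let ?B = "L.moment_bound"
  have b: "(\<lambda>n. ?B / real n) \<longlonglongrightarrow> 0" "\<And>n. ?B / real n \<ge> 0"
    using inverse_n_tendsto L.bounds_nonneg(4) by auto
  have DV: "vanishes (avg k (\<lambda>n _ v. (Dof v * V n v)\<^sup>2 / n))"
    using avg_L1_tendsto[OF k _ _ b, of "\<lambda>n _ v. (Dof v * V n v)\<^sup>2 / n"] L.UV_moments(5) divide_right_mono[OF L.UV_moments(6)]
      meas_fun_ops(4)[OF meas_fun_pow[OF meas_fun_ops(3)[OF meas_fun_basic(5,4)]] meas_fun_basic(6)]
    by simp
  have VV: "vanishes (avg k (\<lambda>n _ v. (V n v * V n v)\<^sup>2 / n))"
    using avg_L1_tendsto[OF k _ _ b, of "\<lambda>n _ v. (V n v * V n v)\<^sup>2 / n"] L.UV_moments(7) divide_right_mono[OF L.UV_moments(8)]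
      meas_fun_ops(4)[OF meas_fun_pow[OF meas_fun_ops(3)[OF meas_fun_basic(4,4)]] meas_fun_basic(6)]
    by simp
  have sq: "vanishes (\<lambda>x. avg k (\<lambda>n \<eta> v. (F n \<eta> v)\<^sup>2 / n) x)"
    if "vanishes (avg k (\<lambda>n \<eta> v. \<bar>F n \<eta> v\<bar>))" for F
  proof (rule Lim_null_comparison)
    show "vanishes (\<lambda>x. (avg k (\<lambda>n \<eta> v. \<bar>F n \<eta> v\<bar>) x)\<^sup>2)" using tendsto_power[OF that, of 2] by simp
    show "eventually (\<lambda>x. norm (avg k (\<lambda>n \<eta> v. (F n \<eta> v)\<^sup>2 / n) x) \<le> (avg k (\<lambda>n \<eta> v. \<bar>F n \<eta> v\<bar>) x)\<^sup>2) (in_prob \<Omega>)"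
      using eventually_space
    proof eventually_elim
      case (elim x)
      have "0 \<le> avg k (\<lambda>n \<eta> v. (F n \<eta> v)\<^sup>2 / n) x" by (rule avg_nonneg) simp
      then show ?case using avg_square_le[of x k F] elim k by (simp add: avg_cdiv[where a=real])
    qed
  qed
  note d0 = d_tendsto[OF k, THEN sq]
  \<comment> \<open>The constants come from (a + b)^2 \<le> 2 a^2 + 2 b^2, applied once for (A) and
    twice for (B), where the square of \<open>psi_a\<close> is (V - d)^4.\<close>
  let ?R = "case s of ScoreA \<Rightarrow> (\<lambda>x. 2 * avg k (\<lambda>n _ v. (Dof v * V n v)\<^sup>2 / n) x + 2 * avg k (\<lambda>n \<eta> v. (Dof v * d n \<eta> v)\<^sup>2 / n) x)
    | ScoreB \<Rightarrow> (\<lambda>x. 8 * avg k (\<lambda>n _ v. (V n v * V n v)\<^sup>2 / n) x + 8 * avg k (\<lambda>n \<eta> v. ((d n \<eta> v)\<^sup>2)\<^sup>2 / n) x)"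
  have R0: "vanishes ?R"
  proof (cases s)
    case ScoreA
    show ?thesis using tendsto_add[OF tendsto_mult[OF tendsto_const[of 2] DV] tendsto_mult[OF tendsto_const[of 2] d0(1)]] by (simp add: ScoreA)
  next
    case ScoreB
    show ?thesis using tendsto_add[OF tendsto_mult[OF tendsto_const[of 8] VV] tendsto_mult[OF tendsto_const[of 8] d0(3)]] by (simp add: ScoreB)
  qed
  show ?thesis
  proof (rule Lim_null_comparison[OF always_eventually R0], rule allI)
    fix x :: "nat \<times> (nat \<Rightarrow> nat) \<times> (nat \<Rightarrow> 'x obs)"
    have 2: "(- a + b)\<^sup>2 \<le> 2 * a\<^sup>2 + 2 * b\<^sup>2" for a b :: real
      using zero_le_power2[of "a + b"] by (simp add: power2_eq_square algebra_simps)
    have 8: "(- (a * a) + 2 * (a * b) - b\<^sup>2)\<^sup>2 \<le> 8 * (a * a)\<^sup>2 + 8 * (b\<^sup>2)\<^sup>2" for a b :: real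
    proof -
      have "(a - b)\<^sup>2 \<le> 2 * a\<^sup>2 + 2 * b\<^sup>2" using 2[of "-a" "-b"] by simp
      then have "((a - b)\<^sup>2)\<^sup>2 \<le> (2 * a\<^sup>2 + 2 * b\<^sup>2)\<^sup>2" by (intro power_mono) auto
      also have "\<dots> = 4 * (- (- a\<^sup>2) + b\<^sup>2)\<^sup>2" by (simp add: power2_eq_square algebra_simps)
      also have "\<dots> \<le> 4 * (2 * (a\<^sup>2)\<^sup>2 + 2 * (b\<^sup>2)\<^sup>2)" using 2[of "- a\<^sup>2" "b\<^sup>2"] by simp
      also have "((a - b)\<^sup>2)\<^sup>2 = (- (a * a) + 2 * (a * b) - b\<^sup>2)\<^sup>2" by (simp add: power2_eq_square algebra_simps)
      finally show ?thesis by (simp add: power2_eq_square)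
    qed
    have "0 \<le> avg k (\<lambda>n \<eta> v. (psi_a s v \<eta>)\<^sup>2 / n) x" by (rule avg_nonneg) simp
    moreover have "avg k (\<lambda>n \<eta> v. (psi_a s v \<eta>)\<^sup>2 / n) x \<le> ?R x"
    proof (cases s)
      case ScoreA
      have "(psi_a s v \<eta>)\<^sup>2 / n \<le> 2 * ((Dof v * V n v)\<^sup>2 / n) + 2 * ((Dof v * d n \<eta> v)\<^sup>2 / n)" for n \<eta> v
        using divide_right_mono[OF 2[of "Dof v * V n v" "Dof v * d n \<eta> v"], of "real n"]
        by (simp add: psi_a_A[of v \<eta> n] ScoreA add_divide_distrib)
      then have "avg k (\<lambda>n \<eta> v. (psi_a s v \<eta>)\<^sup>2 / n) x \<le> avg k (\<lambda>n \<eta> v. 2 * ((Dof v * V n v)\<^sup>2 / n) + 2 * ((Dof v * d n \<eta> v)\<^sup>2 / n)) x"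
        by (rule avg_mono)
      then show ?thesis unfolding avg_add avg_cmult[where a="\<lambda>_. 2"] by (simp add: ScoreA)
    next
      case ScoreB
      have "(psi_a s v \<eta>)\<^sup>2 / n \<le> 8 * ((V n v * V n v)\<^sup>2 / n) + 8 * (((d n \<eta> v)\<^sup>2)\<^sup>2 / n)" for n \<eta> v
        using divide_right_mono[OF 8[of "V n v" "d n \<eta> v"], of "real n"]
        by (simp add: psi_a_B[of v \<eta> n] ScoreB add_divide_distrib)
      then have "avg k (\<lambda>n \<eta> v. (psi_a s v \<eta>)\<^sup>2 / n) x \<le> avg k (\<lambda>n \<eta> v. 8 * ((V n v * V n v)\<^sup>2 / n) + 8 * (((d n \<eta> v)\<^sup>2)\<^sup>2 / n)) x"
        by (rule avg_mono)
      then show ?thesis unfolding avg_add avg_cmult[where a="\<lambda>_. 8"] by (simp add: ScoreB)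
    qed
    ultimately show "norm (avg k (\<lambda>n \<eta> v. (psi_a s v \<eta>)\<^sup>2) x / fst x) \<le> ?R x"
      by (simp add: avg_cdiv[where a=real])
  qed
qed

text \<open>Only moments of order \<open>q / 4 > 1\<close> of \<open>(U V)\<^sup>2\<close> are available, so the law of large
numbers is obtained by truncating at level \<open>sqrt n\<close>.\<close>

lemma UV_square_tendsto:
  assumes k: "k < K"
  shows "vanishes (\<lambda>x. avg k (\<lambda>n _ v. (U n v * V n v)\<^sup>2) x - (\<tau> (fst x))\<^sup>2)"
proof -
  let ?B = "L.moment_bound" and ?Z = "\<lambda>n v. (U n v * V n v)\<^sup>2"
  define Z1 where "Z1 n v = (if ?Z n v \<le> sqrt (real n) then ?Z n v else 0)" for n v
  define Z2 where "Z2 n v = ?Z n v - Z1 n v" for n v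
  \<comment> \<open>Where y = (U V)^2 exceeds sqrt n, y is at most y powr (q / 4) times (sqrt n)
    powr (1 - q / 4). Rewriting the root halves the exponent and gives n powr (- r).\<close>
  define r where "r = (q / 4 - 1) / 2"
  have r: "r > 0" using cpos by (simp add: r_def)
  have B: "?B \<ge> 0" by (rule L.bounds_nonneg)
  have mZ: "meas_fun (\<lambda>n _. ?Z n)" by (intro meas_fun_intros)
  have mZ1: "meas_fun (\<lambda>n _. Z1 n)" unfolding Z1_def[abs_def] by (rule meas_fun_trunc[OF mZ])
  have mZ2: "meas_fun (\<lambda>n _. Z2 n)" unfolding Z2_def[abs_def] by (intro meas_fun_intros mZ1)
  have [measurable]: "Z1 n \<in> borel_measurable (Pn n)" "Z2 n \<in> borel_measurable (Pn n)" for n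
    unfolding Z1_def[abs_def] Z2_def[abs_def] by measurable
  have Z1: "0 \<le> Z1 n v" "Z1 n v \<le> sqrt n" "Z1 n v \<le> ?Z n v" for n v by (auto simp: Z1_def)
  have Z1i: "integrable (Pn n) (Z1 n)" "integrable (Pn n) (\<lambda>v. (Z1 n v)\<^sup>2)" for n
  proof -
    show "integrable (Pn n) (Z1 n)"
      using Z1 by (intro L.integrable_const_bound[where B="sqrt (real n)"]) auto
    show "integrable (Pn n) (\<lambda>v. (Z1 n v)\<^sup>2)"
      using Z1 by (intro L.integrable_const_bound[where B="(sqrt (real n))\<^sup>2"] AE_I2) (auto intro: power_mono simp del: real_sqrt_pow2_iff real_sqrt_pow2)
  qed
  \<comment> \<open>The truncated variable is at most sqrt n, so its square is at most sqrt n times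
    (U V)^2; the second moment divided by n is then of order 1 / sqrt n.\<close>
  have Z1sq: "(\<integral>v. (Z1 n v)\<^sup>2 \<partial>Pn n) / n \<le> ?B / sqrt n" if n: "n > 0" for n
  proof -
    have "(\<integral>v. (Z1 n v)\<^sup>2 \<partial>Pn n) \<le> (\<integral>v. sqrt n * ?Z n v \<partial>Pn n)"
      using Z1i(2)[of n] L.UV_moments(1)[of n] Z1[of n]
      by (intro integral_mono) (auto simp: power2_eq_square[of "Z1 _ _"] intro!: mult_mono)
    also have "\<dots> \<le> sqrt n * ?B" using L.UV_moments(2)[of n] by (simp add: mult_left_mono)
    finally have "(\<integral>v. (Z1 n v)\<^sup>2 \<partial>Pn n) / n \<le> sqrt n * ?B / n" by (rule divide_right_mono) simp
    also have "\<dots> = ?B / sqrt n" using n by (simp add: field_simps)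
    finally show ?thesis .
  qed
  have b1: "(\<lambda>n. ?B / sqrt (real n)) \<longlonglongrightarrow> 0"
    by (intro tendsto_divide_0[OF tendsto_const] filterlim_at_top_imp_at_infinity filterlim_compose[OF sqrt_at_top filterlim_real_sequentially])
  have A1: "vanishes (\<lambda>x. avg k (\<lambda>n _. Z1 n) x - (\<integral>v. Z1 (fst x) v \<partial>Pn (fst x)))"
    using B by (intro avg_law_of_large_numbers[OF k mZ1 _ Z1i(2) Z1sq b1]) auto
  have Z2i: "integrable (Pn n) (Z2 n)" for n
    unfolding Z2_def[abs_def] using Z1i(1)[of n] L.UV_moments(1)[of n] by simp
  have Z2: "0 \<le> Z2 n v" for n v using Z1(3)[of n v] by (simp add: Z2_def)
  have Z2le: "(\<integral>v. Z2 n v \<partial>Pn n) \<le> ?B * n powr (- r)" if n: "n > 0" for n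
  proof -
    have "(\<integral>v. Z2 n v \<partial>Pn n) \<le> (\<integral>v. n powr (- r) * \<bar>U n v * V n v\<bar> powr (q / 2) \<partial>Pn n)"
    proof (rule integral_mono)
      fix v
      show "Z2 n v \<le> n powr (- r) * \<bar>U n v * V n v\<bar> powr (q / 2)"
      proof (cases "?Z n v \<le> sqrt n")
        case True then show ?thesis by (simp add: Z2_def Z1_def)
      next
        case False
        define y where "y = ?Z n v"
        have y: "y > sqrt (real n)" "y > 0" using False n by (auto simp: y_def not_le intro: less_trans[rotated])
        have e1: "\<bar>U n v * V n v\<bar> powr (q / 2) = y powr (q / 4)"
        proof -
          have "\<bar>U n v * V n v\<bar> = sqrt y" by (simp add: y_def)
          also have "\<dots> = y powr (1 / 2)" using y by (simp add: powr_half_sqrt)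
          finally show ?thesis using y by (simp add: powr_powr)
        qed
        have e2: "n powr (- r) = (sqrt (real n)) powr (- (q / 4 - 1))"
        proof -
          have er: "- r = 1 / 2 * (- (q / 4 - 1))" by (simp add: r_def field_simps)
          show ?thesis unfolding er powr_powr[symmetric] using powr_half_sqrt[of "real n"] by simp
        qed
        have "Z2 n v = y" using False by (simp add: Z2_def Z1_def y_def)
        also have "y = y powr (q / 4) * y powr (- (q / 4 - 1))" using y by (simp add: powr_add[symmetric])
        also have "\<dots> \<le> y powr (q / 4) * (sqrt (real n)) powr (- (q / 4 - 1))"
          using y n cpos by (intro mult_left_mono powr_mono2') auto
        finally show ?thesis unfolding e1 e2 mult.commute[of "sqrt (real n) powr _"] .
      qed
    qed (use Z2i L.UV_moments(3) in auto)
    also have "\<dots> \<le> n powr (- r) * ?B" using L.UV_moments(4)[of n] by (simp add: mult_left_mono)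
    finally show ?thesis by (simp add: mult.commute)
  qed
  have "(\<lambda>n. ?B * real n powr (- r)) \<longlonglongrightarrow> ?B * 0"
    using r by (intro tendsto_intros tendsto_neg_powr filterlim_real_sequentially) auto
  then have b2: "(\<lambda>n. ?B * real n powr (- r)) \<longlonglongrightarrow> 0" by simp
  have A2: "vanishes (avg k (\<lambda>n _. Z2 n))"
    using avg_L1_tendsto[OF k mZ2 _ b2] Z2i Z2le Z2 B by simp
  have "(\<lambda>n. \<integral>v. Z2 n v \<partial>Pn n) \<longlonglongrightarrow> 0"
  proof (rule Lim_null_comparison[OF _ b2])
    show "\<forall>\<^sub>F n in sequentially. norm (\<integral>v. Z2 n v \<partial>Pn n) \<le> ?B * real n powr (- r)"
      using eventually_gt_at_top[of 0] by eventually_elim (use Z2 Z2le in \<open>auto simp: integral_nonneg_AE\<close>)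
  qed
  from tendsto_diff[OF tendsto_add[OF A1 A2] tendsto_of_seq[OF this]]
  have "vanishes (\<lambda>x. avg k (\<lambda>n _. Z1 n) x - (\<integral>v. Z1 (fst x) v \<partial>Pn (fst x)) + avg k (\<lambda>n _. Z2 n) x - (\<integral>v. Z2 (fst x) v \<partial>Pn (fst x)))"
    by simp
  moreover have "avg k (\<lambda>n _. Z1 n) x - (\<integral>v. Z1 (fst x) v \<partial>Pn (fst x)) + avg k (\<lambda>n _. Z2 n) x - (\<integral>v. Z2 (fst x) v \<partial>Pn (fst x))
    = avg k (\<lambda>n _. ?Z n) x - (\<tau> (fst x))\<^sup>2" for x
  proof -
    have "avg k (\<lambda>n _. ?Z n) x = avg k (\<lambda>n _ v. Z1 n v + Z2 n v) x" by (simp add: Z2_def)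
    also have "\<dots> = avg k (\<lambda>n _. Z1 n) x + avg k (\<lambda>n _. Z2 n) x" by (rule avg_add)
    finally have 1: "avg k (\<lambda>n _. ?Z n) x = avg k (\<lambda>n _. Z1 n) x + avg k (\<lambda>n _. Z2 n) x" .
    have "(\<integral>v. Z1 (fst x) v \<partial>Pn (fst x)) + (\<integral>v. Z2 (fst x) v \<partial>Pn (fst x)) = (\<integral>v. Z1 (fst x) v + Z2 (fst x) v \<partial>Pn (fst x))"
      using Z1i Z2i by simp
    also have "\<dots> = (\<tau> (fst x))\<^sup>2" by (simp add: Z2_def tau_bounds(3))
    finally show ?thesis using 1 by simp
  qed
  ultimately show ?thesis by simp
qed

section \<open>Linearization of the moment equations\<close>

definition "sc k = avg k (\<lambda>n \<eta> v. psi s v (\<theta>0 (Pn n)) \<eta>)"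
definition "ac k = avg k (\<lambda>n \<eta> v. psi_a s v \<eta>)"
definition "Wc k = avg k (\<lambda>n _ v. U n v * V n v)"

lemma fold_score_eq:
  "fold_score s est (K * n) \<pi> w k t = sc k (n, \<pi>, w) + ac k (n, \<pi>, w) * (t - \<theta>0 (Pn n))"
proof -
  have "psi s v t \<eta> = psi s v (\<theta>0 (Pn n)) \<eta> + (t - \<theta>0 (Pn n)) * psi_a s v \<eta>" for v :: "'x obs" and \<eta>
    by (simp add: psi_eq[of v _ \<eta> n])
  then have "fold_score s est (K * n) \<pi> w k t
      = En (fold (K * n) \<pi> k) w (\<lambda>v. psi s v (\<theta>0 (Pn n)) (\<eta>h n \<pi> w k) + (t - \<theta>0 (Pn n)) * psi_a s v (\<eta>h n \<pi> w k))"
    by (simp add: fold_score_def)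
  then show ?thesis
    by (simp add: sc_def ac_def avg_def En_def sum.distrib sum_distrib_left[symmetric] add_divide_distrib mult.commute)
qed

text \<open>Expanding (U - h)(V - d) leaves U V and three remainders: two are centred by
  orthogonality, the third is the product of errors.\<close>

lemma sc_tendsto:
  assumes k: "k < K"
  shows "vanishes (\<lambda>x. sqrt (fst x) * sc k x - sqrt (fst x) * Wc k x)"
proof -
  have hd0: "vanishes (\<lambda>x. sqrt (fst x) * avg k (\<lambda>n \<eta> v. h n \<eta> v * d n \<eta> v) x)"
    by (rule Lim_null_comparison[OF always_eventually hd_tendsto[OF k]]) (simp add: abs_mult[of "sqrt _"] mult_left_mono avg_abs)
  have p: "psi s v (\<theta>0 (Pn n)) \<eta> = U n v * V n v - h n \<eta> v * V n v - U n v * d n \<eta> v + h n \<eta> v * d n \<eta> v" for n v \<eta>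
    by (simp add: psi_eq[of v _ \<eta> n] algebra_simps)
  have eq: "sc k x = Wc k x - avg k (\<lambda>n \<eta> v. h n \<eta> v * V n v) x - avg k (\<lambda>n \<eta> v. U n v * d n \<eta> v) x + avg k (\<lambda>n \<eta> v. h n \<eta> v * d n \<eta> v) x" for x
    unfolding sc_def Wc_def avg_diff[symmetric] avg_add[symmetric] p ..
  have "sqrt (fst x) * sc k x - sqrt (fst x) * Wc k x = - (sqrt (fst x) * avg k (\<lambda>n \<eta> v. h n \<eta> v * V n v) x)
     - sqrt (fst x) * avg k (\<lambda>n \<eta> v. U n v * d n \<eta> v) x + sqrt (fst x) * avg k (\<lambda>n \<eta> v. h n \<eta> v * d n \<eta> v) x" for x :: "nat \<times> (nat \<Rightarrow> nat) \<times> (nat \<Rightarrow> 'x obs)"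
    unfolding eq by (simp add: algebra_simps)
  then show ?thesis
    using tendsto_add[OF tendsto_diff[OF tendsto_minus[OF hV_tendsto(1)[OF k]] Ud_tendsto(1)[OF k]] hd0] by simp
qed

lemma tight_inverse_J: "tight_prob \<Omega> (\<lambda>x. 1 / J (fst x))"
proof (rule tight_of_bounded)
  show "\<bar>1 / J n\<bar> \<le> 1 / c" for n using J_bounds[of n] cpos by (simp add: frac_le)
qed

lemma tight_div_J: "tight_prob \<Omega> f \<Longrightarrow> tight_prob \<Omega> (\<lambda>x. f x / J (fst x))"
  using tight_prob_mult[OF _ tight_inverse_J] by simp

lemma ac_tendsto:
  assumes k: "k < K"
  shows "((\<lambda>x. - ac k x / J (fst x)) \<longlongrightarrow> 1) (in_prob \<Omega>)"
proof -
  have "((\<lambda>x. 1 - 1 / J (fst x) * (ac k x + J (fst x))) \<longlongrightarrow> 1 - 0) (in_prob \<Omega>)"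
    using psi_a_tendsto[OF k] unfolding ac_def[symmetric]
    by (intro tendsto_diff tendsto_const tendsto_zero_mult_tight tight_inverse_J)
  moreover have "1 - 1 / J (fst x) * (ac k x + J (fst x)) = - ac k x / J (fst x)" for x
    using J_bounds(3)[of "fst x"] by (simp add: field_simps)
  ultimately show ?thesis by simp
qed

lemma Wc_tight: "k < K \<Longrightarrow> tight_prob \<Omega> (\<lambda>x. sqrt (fst x) * Wc k x)"
  unfolding Wc_def by (rule UV_tight)

text \<open>Stability of the root of S + A t = 0 when A is close to - J. It is applied fold by fold
  for DML1 and to the averaged equation for DML2, so both inherit the same linear term. The residual
  bound is conditional on A being nonzero, as only then a root is guaranteed.\<close>

lemma approximate_root_tendsto:
  assumes A: "((\<lambda>x. - A x / J (fst x)) \<longlongrightarrow> 1) (in_prob \<Omega>)"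
    and S: "vanishes (\<lambda>x. sqrt (fst x) * S x - sqrt (fst x) * W x)"
    and W: "tight_prob \<Omega> (\<lambda>x. sqrt (fst x) * W x)"
    and \<epsilon>: "(\<lambda>n. sqrt (real n) * \<epsilon> n) \<longlonglongrightarrow> 0"
    and t: "eventually (\<lambda>x. A x \<noteq> 0 \<longrightarrow> \<bar>S x + A x * t x\<bar> \<le> \<epsilon> (fst x)) (in_prob \<Omega>)"
  shows "vanishes (\<lambda>x. sqrt (fst x) * t x - sqrt (fst x) * W x / J (fst x))"
proof (rule Lim_null_comparison)
  let ?a = "\<lambda>x. - A x / J (fst x)" and ?r = "\<lambda>x. sqrt (real (fst x))"
  let ?B = "\<lambda>x. (\<bar>?r x * S x - ?r x * W x\<bar> + ?r x * \<epsilon> (fst x)) * (2 / c) + \<bar>?r x * W x / J (fst x) * (1 / ?a x - 1)\<bar>"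
  have "vanishes (\<lambda>x. ?r x * W x / J (fst x) * (1 / ?a x - 1))"
  proof (rule tendsto_zero_mult_tight[OF tight_div_J[OF W]])
    have "((\<lambda>x. 1 / ?a x - 1) \<longlongrightarrow> 1 / 1 - 1) (in_prob \<Omega>)" by (intro tendsto_intros A) auto
    then show "vanishes (\<lambda>x. 1 / ?a x - 1)" by simp
  qed
  then have "(?B \<longlongrightarrow> (\<bar>0\<bar> + 0) * (2 / c) + \<bar>0\<bar>) (in_prob \<Omega>)"
    by (intro tendsto_intros S tendsto_of_seq[OF \<epsilon>])
  then show "vanishes ?B" by simp
  \<comment> \<open>On this event the slope is nonzero, which activates the residual bound, and - A
    \<ge> c / 2, which is the origin of the factor 2 / c.\<close>
  have "eventually (\<lambda>x. 1 / 2 < ?a x) (in_prob \<Omega>)" using A by (rule order_tendstoD) simp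
  with t show "eventually (\<lambda>x. norm (?r x * t x - ?r x * W x / J (fst x)) \<le> ?B x) (in_prob \<Omega>)"
  proof eventually_elim
    case (elim x)
    define a where "a = ?a x" define j where "j = J (fst x)"
    have j: "c \<le> j" "0 < j" using J_bounds by (auto simp: j_def)
    have a: "1 / 2 < a" using elim(2) by (simp add: a_def)
    have Aeq: "A x = - (j * a)" using j by (simp add: a_def j_def)
    then have "A x \<noteq> 0" using a j by auto
    then have le: "\<bar>S x + A x * t x\<bar> \<le> \<epsilon> (fst x)" using elim(1) by simp
    have ja: "j * a \<ge> c / 2"
      using mult_mono[OF j(1) less_imp_le[OF a]] j a cpos by simp
    have ja0: "j * a > 0" using a j by simp
    define D where "D = ?r x * S x - ?r x * W x - ?r x * (S x + A x * t x)"
    define E where "E = ?r x * W x / j * (1 / a - 1)"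
    \<comment> \<open>Solving for t with A = - j a: \<open>D\<close> collects the error of the score
      and the residual, \<open>E\<close> the effect of replacing the slope by its limit.\<close>
    have eq: "?r x * t x - ?r x * W x / j = D / (j * a) + E"
      using a j unfolding Aeq D_def E_def by (simp add: field_simps)
    have "\<bar>?r x * (S x + A x * t x)\<bar> \<le> ?r x * \<epsilon> (fst x)"
      using le by (simp add: abs_mult mult_left_mono)
    then have D: "\<bar>D\<bar> \<le> \<bar>?r x * S x - ?r x * W x\<bar> + ?r x * \<epsilon> (fst x)"
      unfolding D_def by linarith
    have "\<bar>D / (j * a)\<bar> = \<bar>D\<bar> / (j * a)" using ja0 by (simp add: abs_divide)
    also have "\<dots> \<le> (\<bar>?r x * S x - ?r x * W x\<bar> + ?r x * \<epsilon> (fst x)) / (c / 2)"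
      using D ja cpos by (intro frac_le) auto
    finally have "\<bar>D / (j * a) + E\<bar> \<le> (\<bar>?r x * S x - ?r x * W x\<bar> + ?r x * \<epsilon> (fst x)) * (2 / c) + \<bar>E\<bar>"
      using abs_triangle_ineq[of "D / (j * a)" E] by simp
    then show ?case unfolding eq[symmetric] unfolding E_def a_def j_def real_norm_def .
  qed
qed

section \<open>The leading term and its central limit theorem\<close>

lemma sigma0_eq: "sigma0 \<theta>0 g0 m0 (Pn n) = \<tau> n / J n"
proof -
  have e: "Verr m0 (Pn n) = V n" "Uerr \<theta>0 g0 (Pn n) = U n"
    by (auto simp: Verr_def Uerr_def L.U_def L.V_def)
  show ?thesis using J_bounds(3)[of n]
    by (simp add: sigma0_def e \<tau>_def J_def real_sqrt_divide power_mult_distrib mult.commute)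
qed

definition "Wm x = (\<Sum>k<K. Wc k x) / real K"
text \<open>The sum runs over all observations and ignores the partition: after summation over folds
  the leading term shows no trace of cross-fitting.\<close>

definition "Z n = (\<lambda>(\<pi>::nat \<Rightarrow> nat, w). (\<Sum>i<K * n. U n (w i) * V n (w i) / \<tau> n) / sqrt (K * n))"

lemma Wm_tight: "tight_prob \<Omega> (\<lambda>x. sqrt (fst x) * Wm x)"
proof -
  have "tight_prob \<Omega> (\<lambda>x. \<Sum>k\<in>F. sqrt (fst x) * Wc k x)" if "finite F" "F \<subseteq> {..<K}" for F
    using that
  proof (induction F)
    case empty
    then show ?case using tight_of_bounded[of "\<lambda>_. 0" 0] by simp
  next
    case (insert k F)
    then show ?case using tight_prob_add[OF Wc_tight[of k]] by simp
  qed
  from tight_prob_mult[OF this[of "{..<K}"] tight_of_bounded[of "\<lambda>_. 1 / K" "1 / K"]]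
  show ?thesis by (simp add: Wm_def sum_distrib_left)
qed

lemma sum_over_folds:
  assumes "\<pi> \<in> Parts N K"
  shows "(\<Sum>k<K. \<Sum>i\<in>fold N \<pi> k. f i) = (\<Sum>i<N. (f i :: real))"
  unfolding fold_def using assms by (intro sum.group) (auto simp: Parts_def)

lemma Z_eq:
  assumes x: "snd x \<in> space (\<Omega> (fst x))" "fst x > 0"
  shows "Z (fst x) (snd x) = sqrt (K * fst x) * Wm x / \<tau> (fst x)"
proof -
  obtain n \<pi> w where xe: "x = (n, \<pi>, w)" by (cases x) auto
  have p: "\<pi> \<in> Parts (K * n) K" and n: "n > 0" using space_Omega_D[OF x(1)] x(2) by (auto simp: xe)
  let ?f = "\<lambda>i. U n (w i) * V n (w i)"
  have "Wm x = (\<Sum>k<K. (\<Sum>i\<in>fold (K * n) \<pi> k. ?f i) / n) / K"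
    using card_fold[OF p] by (simp add: Wm_def Wc_def xe avg_def En_def)
  also have "\<dots> = (\<Sum>i<K * n. ?f i) / (K * n)"
    by (simp add: sum_divide_distrib[symmetric] sum_over_folds[OF p] mult.commute)
  finally have W: "Wm x = (\<Sum>i<K * n. ?f i) / (K * n)" .
  have "sqrt (K * n) / (K * n) = 1 / sqrt (K * n)"
    using n K_pos by (simp add: real_sqrt_mult field_simps)
  have "Z (fst x) (snd x) = (\<Sum>i<K * n. ?f i) / \<tau> n * (1 / sqrt (K * n))"
    by (simp add: xe Z_def sum_divide_distrib[symmetric])
  also have "\<dots> = (\<Sum>i<K * n. ?f i) / \<tau> n * (sqrt (K * n) / (K * n))"
    by (simp only: \<open>sqrt (K * n) / (K * n) = 1 / sqrt (K * n)\<close>)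
  also have "\<dots> = sqrt (K * fst x) * Wm x / \<tau> (fst x)"
    unfolding W by (simp add: xe mult_ac)
  finally show ?thesis .
qed

lemma Z_tight: "tight_prob \<Omega> (\<lambda>x. Z (fst x) (snd x))"
proof -
  have "tight_prob \<Omega> (\<lambda>x. sqrt (fst x) * Wm x * (sqrt K / \<tau> (fst x)))"
  proof (rule tight_prob_mult[OF Wm_tight])
    have "\<bar>sqrt K / \<tau> n\<bar> \<le> sqrt K / c\<^sup>2" for n
      using tau_bounds(1,2)[of n] cpos by (simp add: frac_le)
    then show "tight_prob \<Omega> (\<lambda>x. sqrt K / \<tau> (fst x))" by (rule tight_of_bounded)
  qed
  then have T: "tight_prob \<Omega> (\<lambda>x. sqrt (K * fst x) * Wm x / \<tau> (fst x))"
    by (simp add: real_sqrt_mult mult_ac)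
  have "vanishes (\<lambda>x. Z (fst x) (snd x) - sqrt (K * fst x) * Wm x / \<tau> (fst x))"
    by (rule tendsto_transform_space[OF tendsto_const]) (simp add: Z_eq)
  from tight_prob_add[OF tight_prob_tendsto[OF this] T] show ?thesis by simp
qed

lemma Z_weak_conv: "weak_conv_m (\<lambda>n. distr (\<Omega> n) borel (Z n)) std_normal_distribution"
  and Z_measurable: "Z n \<in> borel_measurable (\<Omega> n)"
proof -
  let ?g = "\<lambda>n w. (\<Sum>i<K * n. U n (w i) * V n (w i) / \<tau> n) / sqrt (K * n)"
  have gm: "?g n \<in> borel_measurable (sample (K * n) (Pn n))" for n by measurable
  show Zm: "Z n \<in> borel_measurable (\<Omega> n)" for n
    unfolding Z_def by (rule uniform_Omega(5)) (rule gm)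
  \<comment> \<open>As \<open>Z n\<close> does not depend on the partition, averaging over
    partitions leaves its distribution function equal to the one on the sample alone.\<close>
  have "cdf (distr (\<Omega> n) borel (Z n)) x = cdf (distr (sample (K * n) (Pn n)) borel (?g n)) x" for n x
  proof -
    let ?B = "?g n -` {..x} \<inter> space (sample (K * n) (Pn n))"
    have "cdf (distr (\<Omega> n) borel (Z n)) x = measure (\<Omega> n) (Z n -` {..x} \<inter> space (\<Omega> n))"
      unfolding cdf_def using Zm by (intro measure_distr) auto
    also have "Z n -` {..x} \<inter> space (\<Omega> n) = {(\<pi>, w). \<pi> \<in> Parts (K * n) K \<and> w \<in> ?B}"
      by (auto simp: uniform_Omega(2) Z_def)
    also have "measure (\<Omega> n) \<dots> = (\<Sum>\<pi>\<in>Parts (K * n) K. measure (sample (K * n) (Pn n)) ?B) / card (Parts (K * n) K)"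
      by (rule uniform_Omega(4)) (rule measurable_sets[OF gm], simp)
    also have "\<dots> = measure (sample (K * n) (Pn n)) ?B"
      using Parts_ne finite_Parts by (simp add: card_gt_0_iff)
    also have "\<dots> = cdf (distr (sample (K * n) (Pn n)) borel (?g n)) x"
      unfolding cdf_def using gm by (intro measure_distr[symmetric]) auto
    finally show ?thesis .
  qed
  then have eq: "cdf (distr (\<Omega> n) borel (Z n)) = cdf (distr (sample (K * n) (Pn n)) borel (?g n))" for n by (rule ext)
  have "weak_conv_m (\<lambda>n. distr (PiM {..<K * n} (\<lambda>_. Pn n)) borel (\<lambda>w. (\<Sum>i<K * n. U n (w i) * V n (w i) / \<tau> n) / sqrt (real (K * n)))) std_normal_distribution"
  \<comment> \<open>The Lyapunov exponent is q / 2 > 2; the lower bound \<open>c\<^sup>2\<close> on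
    \<tau> makes the standardized moments uniformly bounded.\<close>
  proof (rule triangular_clt[where p="q / 2" and B="L.moment_bound / (c\<^sup>2) powr (q / 2)" and f="\<lambda>n v. U n v * V n v / \<tau> n" and N="\<lambda>n. K * n" and Q=Pn])
    fix n
    show "prob_space (Pn n)" by (rule L.prob_space_axioms)
    show "(\<lambda>v. U n v * V n v / \<tau> n) \<in> borel_measurable (Pn n)" by measurable
    show "(\<integral>v. U n v * V n v / \<tau> n \<partial>Pn n) = 0" using L.integral_UV by simp
    show "integrable (Pn n) (\<lambda>v. (U n v * V n v / \<tau> n)\<^sup>2)" using L.UV_moments(1) by (simp add: power_divide)
    show "(\<integral>v. (U n v * V n v / \<tau> n)\<^sup>2 \<partial>Pn n) = 1"
      using tau_bounds(2)[of n] by (simp add: power_divide tau_bounds(3)[symmetric])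
    have e: "\<bar>U n v * V n v / \<tau> n\<bar> powr (q / 2) = \<bar>U n v * V n v\<bar> powr (q / 2) / \<tau> n powr (q / 2)" for v
      using tau_bounds(2)[of n] by (simp add: abs_divide powr_divide)
    show "integrable (Pn n) (\<lambda>v. \<bar>U n v * V n v / \<tau> n\<bar> powr (q / 2))"
      unfolding e using L.UV_moments(3) by simp
    show "(\<integral>v. \<bar>U n v * V n v / \<tau> n\<bar> powr (q / 2) \<partial>Pn n) \<le> L.moment_bound / (c\<^sup>2) powr (q / 2)"
      unfolding e using L.UV_moments(4)[of n] L.bounds_nonneg(4) tau_bounds(1)[of n] cpos
      by (simp, intro frac_le) (auto intro!: powr_mono2)
  qed (use cpos K_mult_at_top in auto)
  then show "weak_conv_m (\<lambda>n. distr (\<Omega> n) borel (Z n)) std_normal_distribution"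
    unfolding weak_conv_m_def eq by (simp add: sample_def)
qed

end

text \<open>The disjunction admits either construction of the estimator, so everything after the
  expansion in \<open>err_tendsto\<close> is proved once for both.\<close>

locale dml_estimator = dml_seq MX \<theta>0 g0 m0 s K c C q \<delta> \<Delta> est Pn
  for MX :: "'x measure" and \<theta>0 g0 m0 s K c C q \<delta> \<Delta> est Pn +
  fixes \<epsilon> :: "nat \<Rightarrow> real" and th :: "nat \<Rightarrow> (nat \<Rightarrow> nat) \<Rightarrow> (nat \<Rightarrow> 'x obs) \<Rightarrow> real"
  assumes th_meas: "\<forall>N \<pi>. \<pi> \<in> Parts N K \<longrightarrow> th N \<pi> \<in> borel_measurable (sample N (obs_space MX))"
    and \<epsilon>: "\<forall>N. \<epsilon> N \<ge> 0" "(\<lambda>N. \<epsilon> N / (\<delta> N / sqrt (real N))) \<longlonglongrightarrow> 0"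
    and dml: "(\<forall>N \<pi> w. K dvd N \<and> \<pi> \<in> Parts N K \<and> w \<in> space (sample N (obs_space MX)) \<longrightarrow>
           is_DML1 s est K (\<epsilon> N) N \<pi> w (th N \<pi> w)) \<or>
       (\<forall>N \<pi> w. K dvd N \<and> \<pi> \<in> Parts N K \<and> w \<in> space (sample N (obs_space MX)) \<longrightarrow>
           is_DML2 s est K (\<epsilon> N) N \<pi> w (th N \<pi> w))"
begin

section \<open>Expansion of the estimation error\<close>

definition "err x = (case x of (n, \<pi>, w) \<Rightarrow> th (K * n) \<pi> w - \<theta>0 (Pn n))"

lemma eps_tendsto: "(\<lambda>n. sqrt (real n) * \<epsilon> (K * n)) \<longlonglongrightarrow> 0"
proof -
  have "(\<lambda>N. \<epsilon> N / (\<delta> N / sqrt (real N)) * \<delta> N) \<longlonglongrightarrow> 0 * 0" by (intro tendsto_intros \<epsilon> \<delta>)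
  from filterlim_compose[OF this K_mult_at_top]
  have "(\<lambda>n. \<epsilon> (K * n) / (\<delta> (K * n) / sqrt (real (K * n))) * \<delta> (K * n) / sqrt K) \<longlonglongrightarrow> 0 * 0 / sqrt K"
    using K_pos by (intro tendsto_divide tendsto_const) auto
  moreover have "\<epsilon> (K * n) / (\<delta> (K * n) / sqrt (real (K * n))) * \<delta> (K * n) / sqrt K = sqrt (real n) * \<epsilon> (K * n)" for n
    using \<delta>(1)[rule_format, of "K * n"] K_pos by (simp add: real_sqrt_mult)
  ultimately show ?thesis by simp
qed

text \<open>DML1 averages the expansions of K approximate roots, DML2 expands the approximate root
  of the averaged equation. Since every slope tends to the same - J, the linear terms agree;
  first-order equivalence is a consequence.\<close>

lemma err_tendsto: "vanishes (\<lambda>x. sqrt (fst x) * err x - sqrt (fst x) * Wm x / J (fst x))"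
  using dml
proof
  assume 1: "\<forall>N \<pi> w. K dvd N \<and> \<pi> \<in> Parts N K \<and> w \<in> space (sample N (obs_space MX)) \<longrightarrow>
           is_DML1 s est K (\<epsilon> N) N \<pi> w (th N \<pi> w)"
  have "\<exists>f. snd x \<in> space (\<Omega> (fst x)) \<longrightarrow> (\<forall>k<K. ac k x \<noteq> 0 \<longrightarrow> \<bar>sc k x + ac k x * f k\<bar> \<le> \<epsilon> (K * fst x)) \<and> err x = (\<Sum>k<K. f k) / K" for x
  proof (cases "snd x \<in> space (\<Omega> (fst x))")
    case True
    obtain n \<pi> w where xe: "x = (n, \<pi>, w)" by (cases x) auto
    have "is_DML1 s est K (\<epsilon> (K * n)) (K * n) \<pi> w (th (K * n) \<pi> w)"
      using 1 space_Omega_D[OF True] by (simp add: xe)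
    then obtain tk where tk: "\<And>k. k < K \<Longrightarrow> \<bar>sc k x + ac k x * (tk k - \<theta>0 (Pn n))\<bar> \<le> (INF t. \<bar>sc k x + ac k x * (t - \<theta>0 (Pn n))\<bar>) + \<epsilon> (K * n)"
      "th (K * n) \<pi> w = (\<Sum>k<K. tk k) / K"
      unfolding is_DML1_def fold_score_eq xe[symmetric] by blast
    show ?thesis
    proof (intro exI[of _ "\<lambda>k. tk k - \<theta>0 (Pn n)"] impI conjI allI)
      fix k assume "k < K" "ac k x \<noteq> 0"
      then show "\<bar>sc k x + ac k x * (tk k - \<theta>0 (Pn n))\<bar> \<le> \<epsilon> (K * fst x)"
        using tk(1)[of k] INF_affine_eq_0[of "ac k x" "sc k x" "\<theta>0 (Pn n)"] by (simp add: xe)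
    next
      show "err x = (\<Sum>k<K. tk k - \<theta>0 (Pn n)) / K"
        using tk(2) K_pos by (simp add: err_def xe sum_subtractf diff_divide_distrib)
    qed
  qed auto
  \<comment> \<open>The fold-wise solutions exist only pointwise and are selected by choice, without
    control of measurability in the sample. Convergence in \<open>in_prob\<close> tolerates
    this.\<close>
  then obtain f where f: "\<And>x. snd x \<in> space (\<Omega> (fst x)) \<Longrightarrow> (\<forall>k<K. ac k x \<noteq> 0 \<longrightarrow> \<bar>sc k x + ac k x * f x k\<bar> \<le> \<epsilon> (K * fst x))"
    "\<And>x. snd x \<in> space (\<Omega> (fst x)) \<Longrightarrow> err x = (\<Sum>k<K. f x k) / K" by metis
  have "vanishes (\<lambda>x. sqrt (fst x) * f x k - sqrt (fst x) * Wc k x / J (fst x))" if k: "k < K" for k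
  proof (rule approximate_root_tendsto[OF ac_tendsto[OF k] sc_tendsto[OF k] Wc_tight[OF k] eps_tendsto])
    show "eventually (\<lambda>x. ac k x \<noteq> 0 \<longrightarrow> \<bar>sc k x + ac k x * f x k\<bar> \<le> \<epsilon> (K * fst x)) (in_prob \<Omega>)"
      by (rule eventually_mono[OF eventually_space]) (use f k in auto)
  qed
  then have "((\<lambda>x. (\<Sum>k<K. sqrt (fst x) * f x k - sqrt (fst x) * Wc k x / J (fst x)) / K) \<longlongrightarrow> (\<Sum>k<K. 0) / K) (in_prob \<Omega>)"
    using K_pos by (intro tendsto_divide tendsto_sum tendsto_const) auto
  then have "vanishes (\<lambda>x. (\<Sum>k<K. sqrt (fst x) * f x k - sqrt (fst x) * Wc k x / J (fst x)) / K)" by simp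
  then show ?thesis
    by (rule tendsto_transform_space)
       (simp add: f(2) Wm_def sum_subtractf sum_distrib_left[symmetric] sum_divide_distrib[symmetric] diff_divide_distrib)
next
  assume 2: "\<forall>N \<pi> w. K dvd N \<and> \<pi> \<in> Parts N K \<and> w \<in> space (sample N (obs_space MX)) \<longrightarrow>
           is_DML2 s est K (\<epsilon> N) N \<pi> w (th N \<pi> w)"
  let ?A = "\<lambda>x. (\<Sum>k<K. ac k x) / K" and ?S = "\<lambda>x. (\<Sum>k<K. sc k x) / K"
  have sum_eq: "(\<Sum>k<K. sc k x + ac k x * (t - t0)) / K = ?S x + ?A x * (t - t0)" for x t t0
    by (simp add: sum.distrib sum_distrib_right[symmetric] add_divide_distrib)
  show ?thesis
  proof (rule approximate_root_tendsto[OF _ _ Wm_tight eps_tendsto])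
    have "((\<lambda>x. (\<Sum>k<K. - ac k x / J (fst x)) / K) \<longlongrightarrow> (\<Sum>k<K. 1) / K) (in_prob \<Omega>)"
      using K_pos ac_tendsto by (intro tendsto_divide tendsto_sum tendsto_const) auto
    then show "((\<lambda>x. - ?A x / J (fst x)) \<longlongrightarrow> 1) (in_prob \<Omega>)"
      using K_pos by (simp add: sum_negf sum_divide_distrib[symmetric] mult.commute)
    have "((\<lambda>x. (\<Sum>k<K. sqrt (fst x) * sc k x - sqrt (fst x) * Wc k x) / K) \<longlongrightarrow> (\<Sum>k<K. 0) / K) (in_prob \<Omega>)"
      using K_pos sc_tendsto by (intro tendsto_divide tendsto_sum tendsto_const) auto
    then show "vanishes (\<lambda>x. sqrt (fst x) * ?S x - sqrt (fst x) * Wm x)"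
      by (simp add: Wm_def sum_subtractf sum_distrib_left[symmetric] diff_divide_distrib)
    show "eventually (\<lambda>x. ?A x \<noteq> 0 \<longrightarrow> \<bar>?S x + ?A x * err x\<bar> \<le> \<epsilon> (K * fst x)) (in_prob \<Omega>)"
      using eventually_space
    proof eventually_elim
      case (elim x)
      obtain n \<pi> w where xe: "x = (n, \<pi>, w)" by (cases x) auto
      have "is_DML2 s est K (\<epsilon> (K * n)) (K * n) \<pi> w (th (K * n) \<pi> w)"
        using 2 space_Omega_D[of x] elim by (simp add: xe)
      then have "\<bar>?S x + ?A x * err x\<bar> \<le> (INF t. \<bar>?S x + ?A x * (t - \<theta>0 (Pn n))\<bar>) + \<epsilon> (K * n)"
        unfolding is_DML2_def fold_score_eq xe[symmetric] sum_eq by (simp add: err_def xe)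
      then show ?case using INF_affine_eq_0[of "?A x" "?S x" "\<theta>0 (Pn n)"] by (auto simp: xe)
    qed
  qed
qed

definition "T x = sqrt (K * fst x) * err x / (\<tau> (fst x) / J (fst x))"

lemma T_minus_Z: "vanishes (\<lambda>x. T x - Z (fst x) (snd x))"
proof -
  have "\<bar>sqrt K * J n / \<tau> n\<bar> \<le> sqrt K * C / c\<^sup>2" for n
    using J_bounds[of n] tau_bounds(1,2)[of n] cpos by (simp, intro frac_le mult_left_mono) auto
  then have "tight_prob \<Omega> (\<lambda>x. sqrt K * J (fst x) / \<tau> (fst x))" by (rule tight_of_bounded)
  from tendsto_zero_mult_tight[OF this err_tendsto] show ?thesis
  proof (rule tendsto_transform_space)
    fix x :: "nat \<times> (nat \<Rightarrow> nat) \<times> (nat \<Rightarrow> 'x obs)" assume x: "fst x > 0" "snd x \<in> space (\<Omega> (fst x))"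
    show "sqrt K * J (fst x) / \<tau> (fst x) * (sqrt (fst x) * err x - sqrt (fst x) * Wm x / J (fst x)) = T x - Z (fst x) (snd x)"
      using J_bounds(3)[of "fst x"] tau_bounds(2)[of "fst x"]
      by (simp add: Z_eq[OF x(2,1)] T_def real_sqrt_mult field_simps)
  qed
qed

lemma T_tight: "tight_prob \<Omega> T"
  using tight_prob_add[OF tight_prob_tendsto[OF T_minus_Z] Z_tight] by simp

lemma err_tight: "tight_prob \<Omega> (\<lambda>x. sqrt (fst x) * err x)"
  using tight_prob_add[OF tight_prob_tendsto[OF err_tendsto] tight_div_J[OF Wm_tight]] by simp

lemma th_measurable: "(\<lambda>(\<pi>, w). th (K * n) \<pi> w) \<in> borel_measurable (\<Omega> n)"
  by (rule uniform_Omega(5)) (use th_meas in \<open>simp add: measurable_cong_sets[OF sets_sample refl]\<close>)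

section \<open>Consistency of the variance estimator\<close>

definition "psi_sq k x = (case x of (n, \<pi>, w) \<Rightarrow>
   En (fold (K * n) \<pi> k) w (\<lambda>v. (psi s v (th (K * n) \<pi> w) (\<eta>h n \<pi> w k))\<^sup>2))"

text \<open>The estimated score is U V plus a perturbation of vanishing empirical mean square, and
  \<open>En_square_perturb\<close> reduces the claim to the law of large numbers for (U
  V)^2.\<close>

lemma psi_sq_tendsto:
  assumes k: "k < K"
  shows "vanishes (\<lambda>x. psi_sq k x - (\<tau> (fst x))\<^sup>2)"
proof -
  let ?UV = "avg k (\<lambda>n _ v. (U n v * V n v)\<^sup>2)"
  \<comment> \<open>Bound for the mean square of the perturbation: three nuisance terms and one from
    estimating \<theta>, with factor 4 for the square of a sum of four.\<close>
  define \<rho> where "\<rho> x = 4 * (avg k (\<lambda>n \<eta> v. (h n \<eta> v * V n v)\<^sup>2) x + avg k (\<lambda>n \<eta> v. (U n v * d n \<eta> v)\<^sup>2) x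
     + avg k (\<lambda>n \<eta> v. (h n \<eta> v * d n \<eta> v)\<^sup>2) x + (err x)\<^sup>2 * avg k (\<lambda>n \<eta> v. (psi_a s v \<eta>)\<^sup>2) x)" for x
  have "vanishes (avg k (\<lambda>n \<eta> v. (h n \<eta> v * d n \<eta> v)\<^sup>2))"
  proof (rule Lim_null_comparison)
    show "vanishes (\<lambda>x. (sqrt (fst x) * avg k (\<lambda>n \<eta> v. \<bar>h n \<eta> v * d n \<eta> v\<bar>) x)\<^sup>2)"
      using tendsto_power[OF hd_tendsto[OF k], of 2] by simp
    show "eventually (\<lambda>x. norm (avg k (\<lambda>n \<eta> v. (h n \<eta> v * d n \<eta> v)\<^sup>2) x)
        \<le> (sqrt (fst x) * avg k (\<lambda>n \<eta> v. \<bar>h n \<eta> v * d n \<eta> v\<bar>) x)\<^sup>2) (in_prob \<Omega>)"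
      using eventually_space
    proof eventually_elim
      case (elim x)
      have "0 \<le> avg k (\<lambda>n \<eta> v. (h n \<eta> v * d n \<eta> v)\<^sup>2) x" by (rule avg_nonneg) simp
      then show ?case using avg_square_le[of x k "\<lambda>n \<eta> v. h n \<eta> v * d n \<eta> v"] elim k
        by (simp add: power_mult_distrib[of "sqrt _"] divide_le_eq mult.commute)
    qed
  qed
  moreover have "vanishes (\<lambda>x. (err x)\<^sup>2 * avg k (\<lambda>n \<eta> v. (psi_a s v \<eta>)\<^sup>2) x)"
    using tendsto_zero_mult_tight[OF tight_prob_mult[OF err_tight err_tight] psi_a_square_tendsto[OF k]]
  proof (rule tendsto_transform_space)
    fix x :: "nat \<times> (nat \<Rightarrow> nat) \<times> (nat \<Rightarrow> 'x obs)" assume x: "fst x > 0"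
    let ?r = "sqrt (real (fst x))" and ?A = "avg k (\<lambda>n \<eta> v. (psi_a s v \<eta>)\<^sup>2) x"
    have "?r * err x * (?r * err x) * (?A / fst x) = (?r * ?r) / fst x * ((err x)\<^sup>2 * ?A)"
      by (simp only: power2_eq_square times_divide_eq_right times_divide_eq_left mult_ac)
    then show "?r * err x * (?r * err x) * (?A / fst x) = (err x)\<^sup>2 * ?A" using x by simp
  qed
  ultimately have "(\<rho> \<longlongrightarrow> 4 * (0 + 0 + 0 + 0)) (in_prob \<Omega>)"
    unfolding \<rho>_def[abs_def] by (intro tendsto_intros hV_tendsto Ud_tendsto k)
  then have \<rho>0: "vanishes \<rho>" by simp
  have UVt: "tight_prob \<Omega> ?UV"
  proof -
    have "tight_prob \<Omega> (\<lambda>x. (\<tau> (fst x))\<^sup>2)"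
      using L.UV_moments(2) by (intro tight_of_bounded[of _ L.moment_bound]) (simp add: tau_bounds(3))
    from tight_prob_add[OF tight_prob_tendsto[OF UV_square_tendsto[OF k]] this] show ?thesis by simp
  qed
  have "((\<lambda>x. 2 * sqrt (?UV x * \<rho> x) + \<rho> x) \<longlongrightarrow> 2 * sqrt 0 + 0) (in_prob \<Omega>)"
    by (intro tendsto_intros tendsto_zero_mult_tight[OF UVt] \<rho>0)
  then have B0: "vanishes (\<lambda>x. 2 * sqrt (?UV x * \<rho> x) + \<rho> x)" by simp
  have "vanishes (\<lambda>x. psi_sq k x - ?UV x)"
  proof (rule Lim_null_comparison[OF always_eventually B0], rule allI)
    fix x :: "nat \<times> (nat \<Rightarrow> nat) \<times> (nat \<Rightarrow> 'x obs)"
    obtain n \<pi> w where xe: "x = (n, \<pi>, w)" by (cases x) auto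
    let ?I = "fold (K * n) \<pi> k" and ?\<eta> = "\<eta>h n \<pi> w k"
    define r where "r v = - (h n ?\<eta> v * V n v) - U n v * d n ?\<eta> v + h n ?\<eta> v * d n ?\<eta> v + err x * psi_a s v ?\<eta>" for v
    have psi: "psi s v (th (K * n) \<pi> w) ?\<eta> = U n v * V n v + r v" for v
      by (simp add: psi_eq[of v _ ?\<eta> n] r_def err_def xe algebra_simps)
    have four: "(- a - b + c + e)\<^sup>2 \<le> 4 * (a\<^sup>2 + b\<^sup>2 + c\<^sup>2 + e\<^sup>2)" for a b c e :: real
    proof -
      have "0 \<le> (a - b)\<^sup>2 + (a + c)\<^sup>2 + (a + e)\<^sup>2 + (b + c)\<^sup>2 + (b + e)\<^sup>2 + (c - e)\<^sup>2"
        by (intro add_nonneg_nonneg) auto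
      then show ?thesis by (simp add: power2_eq_square algebra_simps)
    qed
    have "En ?I w (\<lambda>v. (r v)\<^sup>2) \<le> En ?I w (\<lambda>v. 4 * ((h n ?\<eta> v * V n v)\<^sup>2 + (U n v * d n ?\<eta> v)\<^sup>2 + (h n ?\<eta> v * d n ?\<eta> v)\<^sup>2 + (err x * psi_a s v ?\<eta>)\<^sup>2))"
      unfolding r_def by (intro En_mono four)
    also have "\<dots> = \<rho> x"
      by (simp add: \<rho>_def xe avg_def En_def sum.distrib sum_distrib_left[symmetric] add_divide_distrib power_mult_distrib[of "err _"])
    finally have r_le: "En ?I w (\<lambda>v. (r v)\<^sup>2) \<le> \<rho> x" .
    have UV: "?UV x = En ?I w (\<lambda>v. (U n v * V n v)\<^sup>2)" by (simp add: avg_def xe)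
    have UV0: "0 \<le> ?UV x" by (rule avg_nonneg) simp
    have "\<bar>psi_sq k x - ?UV x\<bar> \<le> 2 * sqrt (?UV x * En ?I w (\<lambda>v. (r v)\<^sup>2)) + En ?I w (\<lambda>v. (r v)\<^sup>2)"
      unfolding UV using En_square_perturb[of ?I w "\<lambda>v. U n v * V n v" r] by (simp add: psi_sq_def xe psi[unfolded xe])
    also have "\<dots> \<le> 2 * sqrt (?UV x * \<rho> x) + \<rho> x"
      using r_le UV0 by (intro add_mono mult_left_mono real_sqrt_le_mono) auto
    finally show "norm (psi_sq k x - ?UV x) \<le> 2 * sqrt (?UV x * \<rho> x) + \<rho> x" by simp
  qed
  from tendsto_add[OF this UV_square_tendsto[OF k]] show ?thesis by simp
qed

definition "sh x = (case x of (n, \<pi>, w) \<Rightarrow> sigma_hat s est K (K * n) \<pi> w (th (K * n) \<pi> w))"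

lemma sh_eq: "sh x = sqrt (((\<Sum>k<K. psi_sq k x) / K) / ((\<Sum>k<K. ac k x) / K)\<^sup>2)"
  by (cases x) (simp add: sh_def sigma_hat_def Let_def psi_sq_def ac_def avg_def)

text \<open>Numerator and slope are divided by \<open>(\<tau> n)\<^sup>2\<close> and
  \<open>J n\<close>, so the limit becomes the constant 1 although the variance moves with the law.
  The sign of the slope disappears in the square.\<close>

lemma sigma_ratio_tendsto: "((\<lambda>x. sh x / (\<tau> (fst x) / J (fst x))) \<longlongrightarrow> 1) (in_prob \<Omega>)"
proof -
  have tau_t: "tight_prob \<Omega> (\<lambda>x. 1 / (\<tau> (fst x))\<^sup>2)"
  proof -
    have "\<bar>1 / (\<tau> n)\<^sup>2\<bar> \<le> 1 / (c\<^sup>2)\<^sup>2" for n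
      using tau_bounds(1,2)[of n] cpos by (simp, intro frac_le power_mono[of "c\<^sup>2" "\<tau> n" 2, simplified]) auto
    then show ?thesis by (rule tight_of_bounded)
  qed
  have S: "((\<lambda>x. psi_sq k x / (\<tau> (fst x))\<^sup>2) \<longlongrightarrow> 1) (in_prob \<Omega>)" if k: "k < K" for k
  proof -
    have "((\<lambda>x. 1 / (\<tau> (fst x))\<^sup>2 * (psi_sq k x - (\<tau> (fst x))\<^sup>2) + 1) \<longlongrightarrow> 0 + 1) (in_prob \<Omega>)"
      by (intro tendsto_add tendsto_const tendsto_zero_mult_tight[OF tau_t] psi_sq_tendsto k)
    moreover have "1 / (\<tau> (fst x))\<^sup>2 * (psi_sq k x - (\<tau> (fst x))\<^sup>2) + 1 = psi_sq k x / (\<tau> (fst x))\<^sup>2" for x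
      using tau_bounds(2)[of "fst x"] by (simp add: field_simps)
    ultimately show ?thesis by simp
  qed
  have "((\<lambda>x. sqrt (((\<Sum>k<K. psi_sq k x / (\<tau> (fst x))\<^sup>2) / K) / ((\<Sum>k<K. - ac k x / J (fst x)) / K)\<^sup>2))
      \<longlongrightarrow> sqrt (((\<Sum>k<K. 1) / K) / ((\<Sum>k<K. 1) / K)\<^sup>2)) (in_prob \<Omega>)"
    using K_pos S ac_tendsto by (intro tendsto_intros) auto
  moreover have "sqrt (((\<Sum>k<K. psi_sq k x / (\<tau> (fst x))\<^sup>2) / K) / ((\<Sum>k<K. - ac k x / J (fst x)) / K)\<^sup>2) = sh x / (\<tau> (fst x) / J (fst x))" for x
  proof -
    let ?P = "\<Sum>k<K. psi_sq k x" and ?A = "\<Sum>k<K. ac k x"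
    have "((\<Sum>k<K. psi_sq k x / (\<tau> (fst x))\<^sup>2) / K) / ((\<Sum>k<K. - ac k x / J (fst x)) / K)\<^sup>2
       = (?P / K / (?A / K)\<^sup>2) / (\<tau> (fst x) / J (fst x))\<^sup>2"
      by (simp add: sum_divide_distrib[symmetric] sum_negf power_divide divide_simps)
    then show ?thesis using tau_bounds(2)[of "fst x"] J_bounds(3)[of "fst x"]
      by (simp only: sh_eq real_sqrt_divide real_sqrt_abs) simp
  qed
  ultimately show ?thesis using K_pos by simp
qed

definition "Th x = sqrt (K * fst x) * err x / sh x"

lemma Th_minus_Z: "vanishes (\<lambda>x. Th x - Z (fst x) (snd x))"
proof -
  let ?R = "\<lambda>x. sh x / (\<tau> (fst x) / J (fst x))"
  have "((\<lambda>x. 1 / ?R x - 1) \<longlongrightarrow> 1 / 1 - 1) (in_prob \<Omega>)"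
    by (intro tendsto_intros sigma_ratio_tendsto) auto
  then have "vanishes (\<lambda>x. T x * (1 / ?R x - 1))"
    by (intro tendsto_zero_mult_tight[OF T_tight]) simp
  from tendsto_add[OF this T_minus_Z] have "vanishes (\<lambda>x. T x * (1 / ?R x - 1) + (T x - Z (fst x) (snd x)))"
    by simp
  \<comment> \<open>The identity includes \<open>sh x = 0\<close>: division by zero makes both
    \<open>Th x\<close> and 1 / \<open>?R x\<close> equal to 0.\<close>
  moreover have "T x * (1 / ?R x - 1) + (T x - Z (fst x) (snd x)) = Th x - Z (fst x) (snd x)" for x
    using tau_bounds(2)[of "fst x"] J_bounds(3)[of "fst x"]
    by (cases "sh x = 0") (simp_all add: T_def Th_def field_simps)
  ultimately show ?thesis by (simp only:)
qed

section \<open>Measurability and weak convergence of the standardized estimators\<close>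

lemma meas_fun_psi_a: "meas_fun (\<lambda>n \<eta> v. psi_a s v \<eta>)"
proof (cases s)
  case ScoreA
  have "meas_fun (\<lambda>n \<eta> v. Dof v * d n \<eta> v - Dof v * V n v)" by (intro meas_fun_intros)
  also have "(\<lambda>n \<eta> v. Dof v * d n \<eta> v - Dof v * V n v) = (\<lambda>n \<eta> v. psi_a s v \<eta>)"
  proof (intro ext)
    show "Dof v * d n \<eta> v - Dof v * V n v = psi_a s v \<eta>" for n \<eta> and v :: "'x obs"
      by (simp add: ScoreA psi_a_A[of v \<eta> n])
  qed
  finally show ?thesis .
next
  case ScoreB
  have "meas_fun (\<lambda>n \<eta> v. 2 * (V n v * d n \<eta> v) - V n v * V n v - (d n \<eta> v)\<^sup>2)"
    by (intro meas_fun_ops meas_fun_pow meas_fun_basic(1-5) meas_fun_basic(6)[of "\<lambda>_. 2"])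
  also have "(\<lambda>n \<eta> v. 2 * (V n v * d n \<eta> v) - V n v * V n v - (d n \<eta> v)\<^sup>2) = (\<lambda>n \<eta> v. psi_a s v \<eta>)"
  proof (intro ext)
    show "2 * (V n v * d n \<eta> v) - V n v * V n v - (d n \<eta> v)\<^sup>2 = psi_a s v \<eta>" for n \<eta> and v :: "'x obs"
      by (simp add: ScoreB psi_a_B[of v \<eta> n])
  qed
  finally show ?thesis .
qed

lemma sh_measurable: "(\<lambda>(\<pi>, w). sigma_hat s est K (K * n) \<pi> w (th (K * n) \<pi> w)) \<in> borel_measurable (\<Omega> n)"
proof (rule uniform_Omega(5))
  fix \<pi> assume p: "\<pi> \<in> Parts (K * n) K"
  let ?S = "sample (K * n) (Pn n)"
  have [measurable]: "th (K * n) \<pi> \<in> borel_measurable ?S"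
    using th_meas p by (simp add: measurable_cong_sets[OF sets_sample refl])
  have pa: "(\<lambda>w. psi_a s (w i) (\<eta>h n \<pi> w k)) \<in> borel_measurable ?S" if "i < K * n" for i k
    using meas_fun_psi_a that unfolding meas_fun_def by auto
  have ps: "(\<lambda>w. (psi s (w i) (th (K * n) \<pi> w) (\<eta>h n \<pi> w k))\<^sup>2) \<in> borel_measurable ?S" if i: "i < K * n" for i k
  proof -
    note [measurable] = pa[OF i, of k] hd_measurable_at[of "aux n \<pi> k" "K * n" i n, OF _ i] measurable_sample_component[OF i]
    show ?thesis unfolding psi_eq[of _ _ _ n] by measurable
  qed
  have "(\<lambda>w. En (fold (K * n) \<pi> k) w (\<lambda>v. psi_a s v (\<eta>h n \<pi> w k))) \<in> borel_measurable ?S" for k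
    by (intro measurable_En pa) (auto simp: fold_def)
  moreover have "(\<lambda>w. En (fold (K * n) \<pi> k) w (\<lambda>v. (psi s v (th (K * n) \<pi> w) (\<eta>h n \<pi> w k))\<^sup>2)) \<in> borel_measurable ?S" for k
    by (intro measurable_En ps) (auto simp: fold_def)
  ultimately show "(\<lambda>w. sigma_hat s est K (K * n) \<pi> w (th (K * n) \<pi> w)) \<in> borel_measurable ?S"
    unfolding sigma_hat_def Let_def by measurable
qed

lemma weak_conv_sigma0:
  "weak_conv_m (\<lambda>n. distr (\<Omega> n) borel (\<lambda>(\<pi>, w). sqrt (real (K * n)) * (th (K * n) \<pi> w - \<theta>0 (Pn n)) / sigma0 \<theta>0 g0 m0 (Pn n))) std_normal_distribution"
proof (rule slutsky[OF prob_space_Omega _ Z_measurable Z_weak_conv])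
  show "(\<lambda>(\<pi>, w). sqrt (real (K * n)) * (th (K * n) \<pi> w - \<theta>0 (Pn n)) / sigma0 \<theta>0 g0 m0 (Pn n)) \<in> borel_measurable (\<Omega> n)" for n
    using th_measurable[of n] unfolding case_prod_beta' by measurable
  show "vanishes (\<lambda>(n, \<omega>). (case \<omega> of (\<pi>, w) \<Rightarrow> sqrt (real (K * n)) * (th (K * n) \<pi> w - \<theta>0 (Pn n)) / sigma0 \<theta>0 g0 m0 (Pn n)) - Z n \<omega>)"
    using T_minus_Z by (simp add: T_def err_def sigma0_eq case_prod_beta')
qed

lemma weak_conv_sigma_hat:
  "weak_conv_m (\<lambda>n. distr (\<Omega> n) borel (\<lambda>(\<pi>, w). sqrt (real (K * n)) * (th (K * n) \<pi> w - \<theta>0 (Pn n)) / sigma_hat s est K (K * n) \<pi> w (th (K * n) \<pi> w))) std_normal_distribution"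
proof (rule slutsky[OF prob_space_Omega _ Z_measurable Z_weak_conv])
  show "(\<lambda>(\<pi>, w). sqrt (real (K * n)) * (th (K * n) \<pi> w - \<theta>0 (Pn n)) / sigma_hat s est K (K * n) \<pi> w (th (K * n) \<pi> w)) \<in> borel_measurable (\<Omega> n)" for n
    using th_measurable[of n] sh_measurable[of n] unfolding case_prod_beta' by measurable
  show "vanishes (\<lambda>(n, \<omega>). (case \<omega> of (\<pi>, w) \<Rightarrow> sqrt (real (K * n)) * (th (K * n) \<pi> w - \<theta>0 (Pn n)) / sigma_hat s est K (K * n) \<pi> w (th (K * n) \<pi> w)) - Z n \<omega>)"
    using Th_minus_Z by (simp add: Th_def err_def sh_def case_prod_beta')
qed

end

subsection \<open>Quantiles of the standard normal distribution\<close>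

text \<open>A positive density charges every interval of positive length. Strictness gives the
  uniqueness behind the definite description in \<open>Phi_inv\<close>.\<close>

lemma Phi_strict_mono: "x < y \<Longrightarrow> Phi x < Phi y"
proof -
  assume xy: "x < y"
  interpret real_distribution std_normal_distribution by (rule real_dist_normal_dist)
  have "measure std_normal_distribution {x<..y} \<noteq> 0"
  proof
    assume "measure std_normal_distribution {x<..y} = 0"
    then have "emeasure std_normal_distribution {x<..y} = 0" by (simp add: emeasure_eq_measure)
    then have "(\<integral>\<^sup>+t. ennreal (std_normal_density t) * indicator {x<..y} t \<partial>lborel) = 0"
      by (simp add: emeasure_density)
    then have "AE t in lborel. ennreal (std_normal_density t) * indicator {x<..y} t = 0"
      by (subst (asm) nn_integral_0_iff_AE) auto
    then have "AE t in lborel. t \<notin> {x<..y}"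
    proof eventually_elim
      case (elim t)
      have "std_normal_density t > 0" by (rule normal_density_pos) simp
      with elim show ?case by (auto split: split_indicator_asm)
    qed
    then have "emeasure lborel {t. x < t \<and> t \<le> y} = 0"
      by (subst (asm) AE_iff_measurable[OF _ refl]) auto
    moreover have "{t. x < t \<and> t \<le> y} = {x<..y}" by auto
    ultimately have "emeasure lborel {x<..y} = 0" by (simp only:)
    then show False using xy by simp
  qed
  then have "measure std_normal_distribution {x<..y} > 0" by (simp add: zero_less_measure_iff)
  then show ?thesis unfolding Phi_def using cdf_diff_eq[OF xy] by linarith
qed

lemma std_normal_atom: "measure std_normal_distribution {x} = 0"
  by (simp add: measure_def emeasure_density nn_integral_null_set)

lemma Phi_uminus: "Phi (- x) = 1 - Phi x"
proof -
  interpret real_distribution std_normal_distribution by (rule real_dist_normal_dist)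
  have "emeasure std_normal_distribution {..-x} = (\<integral>\<^sup>+t. ennreal (std_normal_density t) * indicator {..-x} t \<partial>lborel)"
    by (simp add: emeasure_density)
  also have "\<dots> = (\<integral>\<^sup>+t. ennreal (std_normal_density (- t)) * indicator {..-x} (- t) \<partial>lborel)"
    by (subst nn_integral_real_affine[where c="-1" and t=0]) auto
  also have "\<dots> = (\<integral>\<^sup>+t. ennreal (std_normal_density t) * indicator {x..} t \<partial>lborel)"
    by (intro nn_integral_cong) (auto simp: std_normal_density_def split: split_indicator)
  also have "\<dots> = emeasure std_normal_distribution {x..}" by (simp add: emeasure_density)
  finally have 1: "Phi (- x) = measure std_normal_distribution {x..}"
    by (simp add: Phi_def cdf_def measure_def)
  have "measure std_normal_distribution ({..x} \<union> {x..}) = measure std_normal_distribution {..x} + measure std_normal_distribution ({x..} - {..x})"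
    by (rule finite_measure_Union') auto
  moreover have "measure std_normal_distribution ({x..} - {x}) = measure std_normal_distribution {x..} - measure std_normal_distribution {x}"
    by (rule finite_measure_Diff) auto
  moreover have "{x..} - {..x} = {x..} - {x}" by auto
  moreover have "{..x} \<union> {x..} = space std_normal_distribution" by auto
  ultimately show ?thesis using 1 prob_space std_normal_atom[of x] by (simp add: Phi_def cdf_def)
qed

lemma Phi_inv:
  assumes p: "0 < p" "p < 1"
  shows "Phi (Phi_inv p) = p"
proof -
  interpret real_distribution std_normal_distribution by (rule real_dist_normal_dist)
  have "\<exists>t. Phi t = p"
  proof -
    obtain b where b: "Phi b > p"
      using eventually_happens[OF order_tendstoD(1)[OF cdf_lim_at_top_prob p(2)]] by (auto simp: Phi_def)
    obtain a where a: "Phi a < p"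
      using eventually_happens[OF order_tendstoD(2)[OF cdf_lim_at_bot p(1)]] by (auto simp: Phi_def)
    have "a \<le> b" using a b Phi_strict_mono[of b a] by linarith
    then show ?thesis
      using IVT[of Phi a p b] a b isCont_cdf_std_normal by (auto simp: Phi_def)
  qed
  then obtain t where t: "Phi t = p" by blast
  have "t' = t" if "Phi t' = p" for t'
  proof (rule ccontr)
    assume "t' \<noteq> t"
    then have "Phi t < Phi t' \<or> Phi t' < Phi t" by (auto simp: neq_iff intro: Phi_strict_mono)
    then show False using that t by simp
  qed
  with t show ?thesis unfolding Phi_inv_def by (rule theI[where P="\<lambda>t. Phi t = p"])
qed

lemma std_normal_interval:
  assumes \<alpha>: "0 < \<alpha>" "\<alpha> < 1"
  defines "z \<equiv> Phi_inv (1 - \<alpha> / 2)"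
  shows "measure std_normal_distribution {-z..z} = 1 - \<alpha>"
proof -
  interpret real_distribution std_normal_distribution by (rule real_dist_normal_dist)
  have z: "Phi z = 1 - \<alpha> / 2" unfolding z_def using \<alpha> by (intro Phi_inv) auto
  then have mz: "Phi (- z) = \<alpha> / 2" by (simp add: Phi_uminus)
  then have "Phi (- z) < Phi z" using z \<alpha> by simp
  then have "- z < z" using Phi_strict_mono[of z "- z"] by (cases z "- z" rule: linorder_cases) auto
  then have eq: "{-z..z} = {-z} \<union> {-z<..z}" by auto
  have "measure std_normal_distribution {-z..z} = measure std_normal_distribution {-z} + measure std_normal_distribution {-z<..z}"
    unfolding eq by (rule finite_measure_Union) auto
  also have "\<dots> = Phi z - Phi (- z)"
    unfolding Phi_def using cdf_diff_eq[OF \<open>- z < z\<close>] std_normal_atom by simp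
  finally show ?thesis using z mz by simp
qed

text \<open>Strict positivity of s matters: for s = 0 the interval is a point, while the studentized
  statistic is 0 by default.\<close>

lemma studentized_iff:
  fixes t a z s N :: real
  assumes "0 < s" "0 < N"
  shows "t - z * s / N \<le> a \<longleftrightarrow> N * (t - a) / s \<le> z" "a \<le> t + z * s / N \<longleftrightarrow> - z \<le> N * (t - a) / s"
  using assms by (simp_all add: field_simps)

subsection \<open>Coverage\<close>

context dml_estimator begin

definition "covered \<alpha> n = {(\<pi>, w) \<in> space (\<Omega> n).
    let N = K * n; t = th N \<pi> w; r = Phi_inv (1 - \<alpha> / 2) * sigma_hat s est K N \<pi> w t / sqrt (real N)
    in t - r \<le> \<theta>0 (Pn n) \<and> \<theta>0 (Pn n) \<le> t + r}"

text \<open>Coverage agrees with the event that the studentized statistic lies in [-z, z] wherever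
  the variance estimate is positive. The ratio limit confines the remaining points to a set of
  vanishing probability.\<close>

lemma coverage_tendsto:
  assumes \<alpha>: "0 < \<alpha>" "\<alpha> < 1"
  shows "(\<lambda>n. measure (\<Omega> n) (covered \<alpha> n)) \<longlonglongrightarrow> 1 - \<alpha>"
proof -
  interpret Om: prob_space "\<Omega> n" for n by (rule prob_space_Omega)
  define z where "z = Phi_inv (1 - \<alpha> / 2)"
  define Y where "Y n = (\<lambda>(\<pi>, w). sqrt (real (K * n)) * (th (K * n) \<pi> w - \<theta>0 (Pn n)) / sigma_hat s est K (K * n) \<pi> w (th (K * n) \<pi> w))" for n
  have th_m[measurable]: "(\<lambda>x. th (K * n) (fst x) (snd x)) \<in> borel_measurable (\<Omega> n)"
    and sh_m[measurable]: "(\<lambda>x. sigma_hat s est K (K * n) (fst x) (snd x) (th (K * n) (fst x) (snd x))) \<in> borel_measurable (\<Omega> n)" for n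
    using th_measurable[of n] sh_measurable[of n] by (simp_all add: case_prod_beta')
  have Ym[measurable]: "Y n \<in> borel_measurable (\<Omega> n)" for n
    unfolding Y_def case_prod_beta' by measurable
  have cov: "covered \<alpha> n \<in> sets (\<Omega> n)" for n
    unfolding covered_def case_prod_beta' Let_def prod.collapse by measurable
  define D where "D n = Y n -` {-z..z} \<inter> space (\<Omega> n)" for n
  have Ds: "D n \<in> sets (\<Omega> n)" for n unfolding D_def by (rule measurable_sets[OF Ym]) simp
  have "(\<lambda>n. measure (distr (\<Omega> n) borel (Y n)) {-z..z}) \<longlonglongrightarrow> measure std_normal_distribution {-z..z}"
  proof (rule weak_conv_imp_continuity_set_conv[OF _ real_dist_normal_dist])
    show "real_distribution (distr (\<Omega> n) borel (Y n))" for n by (rule Om.real_distribution_distr) simp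
    show "weak_conv_m (\<lambda>n. distr (\<Omega> n) borel (Y n)) std_normal_distribution"
      unfolding Y_def by (rule weak_conv_sigma_hat)
    \<comment> \<open>Weak convergence yields convergence of probabilities only for sets with null
      boundary, here at most two points.\<close>
    have "frontier {-z..z} \<subseteq> {-z, z}" by (auto simp: frontier_def interior_atLeastAtMost_real)
    then have "emeasure std_normal_distribution (frontier {-z..z}) \<le> emeasure std_normal_distribution {-z, z}"
      by (intro emeasure_mono) auto
    also have "\<dots> = 0"
      by (simp add: emeasure_density nn_integral_null_set finite_imp_null_set_lborel)
    finally show "emeasure std_normal_distribution (frontier {-z..z}) = 0" by simp
  qed simp
  moreover have "measure (distr (\<Omega> n) borel (Y n)) {-z..z} = measure (\<Omega> n) (D n)" for n
    unfolding D_def by (rule measure_distr) auto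
  ultimately have lim: "(\<lambda>n. measure (\<Omega> n) (D n)) \<longlonglongrightarrow> 1 - \<alpha>"
    using std_normal_interval[OF \<alpha>] by (simp add: z_def)
  have pos: "eventually (\<lambda>x. 1 / 2 < sh x / (\<tau> (fst x) / J (fst x))) (in_prob \<Omega>)"
    using sigma_ratio_tendsto by (rule order_tendstoD) simp
  show ?thesis
  proof (rule tendstoI)
    fix e :: real assume "e > 0"
    then have e: "e / 2 > 0" by simp
    from eventually_in_probD[OF pos e] tendstoD[OF lim e] eventually_gt_at_top[of 0]
    show "\<forall>\<^sub>F n in sequentially. dist (measure (\<Omega> n) (covered \<alpha> n)) (1 - \<alpha>) < e"
    proof eventually_elim
      case (elim n)
      then obtain A where A: "A \<in> sets (\<Omega> n)" "measure (\<Omega> n) A \<le> e / 2"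
        "\<And>\<omega>. \<omega> \<in> space (\<Omega> n) - A \<Longrightarrow> 1 / 2 < sh (n, \<omega>) / (\<tau> n / J n)" by (auto simp: holds_except_def)
      have iff: "\<omega> \<in> covered \<alpha> n \<longleftrightarrow> \<omega> \<in> D n" if \<omega>: "\<omega> \<in> space (\<Omega> n) - A" for \<omega>
      proof -
        obtain \<pi> w where we: "\<omega> = (\<pi>, w)" by (cases \<omega>)
        let ?t = "th (K * n) \<pi> w" and ?s = "sigma_hat s est K (K * n) \<pi> w (th (K * n) \<pi> w)" and ?N = "sqrt (real (K * n))"
        define \<rho> where "\<rho> = \<tau> n / J n"
        have \<rho>: "0 < \<rho>" using tau_bounds(2) J_bounds(3) by (simp add: \<rho>_def)
        have "1 / 2 < ?s / \<rho>" using A(3)[OF \<omega>] unfolding sh_def we prod.case \<rho>_def .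
        then have "0 < ?s / \<rho>" by linarith
        then have s: "0 < ?s" using \<rho> by (simp add: zero_less_divide_iff)
        have N: "?N > 0" using elim(3) K_pos by simp
        have "?t - z * ?s / ?N \<le> \<theta>0 (Pn n) \<longleftrightarrow> ?N * (?t - \<theta>0 (Pn n)) / ?s \<le> z"
          "\<theta>0 (Pn n) \<le> ?t + z * ?s / ?N \<longleftrightarrow> - z \<le> ?N * (?t - \<theta>0 (Pn n)) / ?s"
          using studentized_iff[OF s N] by blast+
        then show ?thesis using \<omega> unfolding covered_def D_def Y_def Let_def z_def[symmetric]
          by (auto simp: we)
      qed
      have sub: "covered \<alpha> n \<subseteq> D n \<union> A" "D n \<subseteq> covered \<alpha> n \<union> A"
        using iff sets.sets_into_space[OF cov] sets.sets_into_space[OF Ds] by blast+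
      have "measure (\<Omega> n) (covered \<alpha> n) \<le> measure (\<Omega> n) (D n) + measure (\<Omega> n) A"
        by (rule order_trans[OF Om.finite_measure_mono[OF sub(1)] measure_Un_le]) (use A Ds in auto)
      moreover have "measure (\<Omega> n) (D n) \<le> measure (\<Omega> n) (covered \<alpha> n) + measure (\<Omega> n) A"
        by (rule order_trans[OF Om.finite_measure_mono[OF sub(2)] measure_Un_le]) (use A cov in auto)
      ultimately show ?case using elim(2) A(2) unfolding dist_real_def by linarith
    qed
  qed
qed

end

theorem theorem4p1:
  fixes MX :: "'x measure"
    and \<P> :: "'x obs measure set"
    and \<theta>0 :: "'x obs measure \<Rightarrow> real"
    and g0 m0 :: "'x obs measure \<Rightarrow> 'x \<Rightarrow> real"
    and s :: score and K :: nat and c C q \<alpha> :: real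
    and \<delta> \<Delta> \<epsilon> :: "nat \<Rightarrow> real"
    and est :: "nat \<Rightarrow> nat set \<Rightarrow> (nat \<Rightarrow> 'x obs) \<Rightarrow> 'x nuis"
    and th1 th2 :: "nat \<Rightarrow> (nat \<Rightarrow> nat) \<Rightarrow> (nat \<Rightarrow> 'x obs) \<Rightarrow> real"
  assumes K: "K \<ge> 2"
    and cpos: "c > 0" "C > 0" "q > 4"
    and \<delta>: "\<forall>N. \<delta> N > 0" "\<delta> \<longlonglongrightarrow> 0"
    and \<Delta>: "\<forall>N. \<Delta> N > 0" "\<Delta> \<longlonglongrightarrow> 0"
    and \<epsilon>: "\<forall>N. \<epsilon> N \<ge> 0" "(\<lambda>N. \<epsilon> N / (\<delta> N / sqrt (real N))) \<longlonglongrightarrow> 0"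
    and reg: "\<forall>P\<in>\<P>. regular MX s c C q \<delta> \<Delta> K est \<theta>0 g0 m0 P"
    and est_meas: "\<forall>N J. J \<subseteq> {..<N} \<longrightarrow>
           (\<lambda>(w, x). fst (eta_hat est N J w) x)
              \<in> borel_measurable (sample N (obs_space MX) \<Otimes>\<^sub>M MX)
         \<and> (\<lambda>(w, x). snd (eta_hat est N J w) x)
              \<in> borel_measurable (sample N (obs_space MX) \<Otimes>\<^sub>M MX)"
    and th_meas: "\<forall>N \<pi>. \<pi> \<in> Parts N K \<longrightarrow>
           th1 N \<pi> \<in> borel_measurable (sample N (obs_space MX))
         \<and> th2 N \<pi> \<in> borel_measurable (sample N (obs_space MX))"
    and dml1: "\<forall>N \<pi> w. K dvd N \<and> \<pi> \<in> Parts N K \<and> w \<in> space (sample N (obs_space MX)) \<longrightarrow>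
           is_DML1 s est K (\<epsilon> N) N \<pi> w (th1 N \<pi> w)"
    and dml2: "\<forall>N \<pi> w. K dvd N \<and> \<pi> \<in> Parts N K \<and> w \<in> space (sample N (obs_space MX)) \<longrightarrow>
           is_DML2 s est K (\<epsilon> N) N \<pi> w (th2 N \<pi> w)"
    and \<alpha>: "0 < \<alpha>" "\<alpha> < 1"
  shows
    "(\<forall>Pn. (\<forall>n. Pn n \<in> \<P>) \<longrightarrow>
       (\<forall>e>0. (\<lambda>n. measure (Omega (K * n) K (Pn n))
                 {(\<pi>, w) \<in> space (Omega (K * n) K (Pn n)).
                    sqrt (real (K * n)) * \<bar>th1 (K * n) \<pi> w - th2 (K * n) \<pi> w\<bar> > e})
              \<longlonglongrightarrow> 0)) \<and>
(\<forall>th\<in>{th1, th2}. \<forall>Pn. (\<forall>n. Pn n \<in> \<P>) \<longrightarrow>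
       weak_conv_m
         (\<lambda>n. distr (Omega (K * n) K (Pn n)) borel
                (\<lambda>(\<pi>, w). sqrt (real (K * n)) * (th (K * n) \<pi> w - \<theta>0 (Pn n))
                             / sigma0 \<theta>0 g0 m0 (Pn n)))
         std_normal_distribution) \<and>
(\<forall>th\<in>{th1, th2}. \<forall>Pn. (\<forall>n. Pn n \<in> \<P>) \<longrightarrow>
       weak_conv_m
         (\<lambda>n. distr (Omega (K * n) K (Pn n)) borel
                (\<lambda>(\<pi>, w). sqrt (real (K * n)) * (th (K * n) \<pi> w - \<theta>0 (Pn n))
                             / sigma_hat s est K (K * n) \<pi> w (th (K * n) \<pi> w)))
         std_normal_distribution) \<and>
(\<forall>th\<in>{th1, th2}. \<forall>e>0. eventually (\<lambda>n. \<forall>P\<in>\<P>.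
        \<bar>measure (Omega (K * n) K P)
           {(\<pi>, w) \<in> space (Omega (K * n) K P).
              let N = K * n; t = th N \<pi> w;
                  r = Phi_inv (1 - \<alpha> / 2) * sigma_hat s est K N \<pi> w t / sqrt (real N)
              in t - r \<le> \<theta>0 P \<and> \<theta>0 P \<le> t + r}
         - (1 - \<alpha>)\<bar> < e) sequentially)"
proof -
  have est': "dml_estimator MX \<theta>0 g0 m0 s K c C q \<delta> \<Delta> est Pn \<epsilon> th" if "th \<in> {th1, th2}" "\<forall>n. Pn n \<in> \<P>" for th Pn
    using that K cpos \<delta> \<Delta> \<epsilon> reg est_meas th_meas dml1 dml2
    unfolding dml_estimator_def dml_seq_def dml_estimator_axioms_def by auto
  show ?thesis
  proof (intro conjI allI ballI impI)
    fix Pn :: "nat \<Rightarrow> 'x obs measure" and e :: real assume P: "\<forall>n. Pn n \<in> \<P>" and e: "e > 0"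
    interpret E1: dml_estimator MX \<theta>0 g0 m0 s K c C q \<delta> \<Delta> est Pn \<epsilon> th1 by (rule est') (use P in auto)
    interpret E2: dml_estimator MX \<theta>0 g0 m0 s K c C q \<delta> \<Delta> est Pn \<epsilon> th2 by (rule est') (use P in auto)
    let ?O = "\<lambda>n. Omega (K * n) K (Pn n)"
    \<comment> \<open>Both expansions have the same linear term, which cancels in the difference;
      the factor sqrt K later converts the scaling from n to N.\<close>
    let ?d = "\<lambda>x. sqrt (real (fst x)) * E1.err x - sqrt (real (fst x)) * E2.err x"
    have "(?d \<longlongrightarrow> 0 - 0) (in_prob ?O)"
      using tendsto_diff[OF E1.err_tendsto E2.err_tendsto] by simp
    then have "((\<lambda>x. sqrt (real K) * ?d x) \<longlongrightarrow> sqrt (real K) * (0 - 0)) (in_prob ?O)"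
      by (intro tendsto_mult tendsto_const)
    then have "((\<lambda>x. sqrt (real K) * ?d x) \<longlongrightarrow> 0) (in_prob ?O)" by simp
    from tendsto_in_prob_zeroD[OF E1.prob_space_Omega this e]
    have lim: "(\<lambda>n. measure (?O n) {\<omega> \<in> space (?O n). \<bar>sqrt (real K) * ?d (n, \<omega>)\<bar> > e}) \<longlonglongrightarrow> 0" .
    have eq: "{\<omega> \<in> space (?O n). \<bar>sqrt (real K) * ?d (n, \<omega>)\<bar> > e}
       = {(\<pi>, w) \<in> space (?O n). sqrt (real (K * n)) * \<bar>th1 (K * n) \<pi> w - th2 (K * n) \<pi> w\<bar> > e}" for n
    proof -
      have "\<bar>sqrt (real K) * ?d (n, \<pi>, w)\<bar> = sqrt (real (K * n)) * \<bar>th1 (K * n) \<pi> w - th2 (K * n) \<pi> w\<bar>" for \<pi> w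
        by (simp add: E1.err_def E2.err_def right_diff_distrib[symmetric] abs_mult real_sqrt_mult)
      then show ?thesis by auto
    qed
    show "(\<lambda>n. measure (?O n) {(\<pi>, w) \<in> space (?O n). sqrt (real (K * n)) * \<bar>th1 (K * n) \<pi> w - th2 (K * n) \<pi> w\<bar> > e}) \<longlonglongrightarrow> 0"
      using lim unfolding eq .
  next
    fix th and Pn :: "nat \<Rightarrow> 'x obs measure" assume th: "th \<in> {th1, th2}" and P: "\<forall>n. Pn n \<in> \<P>"
    interpret dml_estimator MX \<theta>0 g0 m0 s K c C q \<delta> \<Delta> est Pn \<epsilon> th by (rule est'[OF th P])
    show "weak_conv_m (\<lambda>n. distr (Omega (K * n) K (Pn n)) borel (\<lambda>(\<pi>, w). sqrt (real (K * n)) * (th (K * n) \<pi> w - \<theta>0 (Pn n)) / sigma0 \<theta>0 g0 m0 (Pn n))) std_normal_distribution"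
      by (rule weak_conv_sigma0)
    show "weak_conv_m (\<lambda>n. distr (Omega (K * n) K (Pn n)) borel (\<lambda>(\<pi>, w). sqrt (real (K * n)) * (th (K * n) \<pi> w - \<theta>0 (Pn n)) / sigma_hat s est K (K * n) \<pi> w (th (K * n) \<pi> w))) std_normal_distribution"
      by (rule weak_conv_sigma_hat)
  next
    fix th and e :: real assume th: "th \<in> {th1, th2}" and e: "e > 0"
    define cov where "cov n P = measure (Omega (K * n) K P)
           {(\<pi>, w) \<in> space (Omega (K * n) K P).
              let N = K * n; t = th N \<pi> w;
                  r = Phi_inv (1 - \<alpha> / 2) * sigma_hat s est K N \<pi> w t / sqrt (real N)
              in t - r \<le> \<theta>0 P \<and> \<theta>0 P \<le> t + r}" for n P
    have "eventually (\<lambda>n. \<forall>P\<in>\<P>. \<bar>cov n P - (1 - \<alpha>)\<bar> < e) sequentially"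
    proof (cases "\<P> = {}")
      case False
      then obtain P0 where P0: "P0 \<in> \<P>" by blast
      \<comment> \<open>If some law violates the bound at n, \<open>Pn n\<close> is such a law,
        otherwise an arbitrary member of the class. Convergence along this one sequence rules out
        violations for all large n.\<close>
      define Pn where "Pn n = (if \<exists>P\<in>\<P>. \<not> \<bar>cov n P - (1 - \<alpha>)\<bar> < e then SOME P. P \<in> \<P> \<and> \<not> \<bar>cov n P - (1 - \<alpha>)\<bar> < e else P0)" for n
      have bad: "Pn n \<in> \<P> \<and> ((\<exists>P\<in>\<P>. \<not> \<bar>cov n P - (1 - \<alpha>)\<bar> < e) \<longrightarrow> \<not> \<bar>cov n (Pn n) - (1 - \<alpha>)\<bar> < e)" for n
      proof (cases "\<exists>P\<in>\<P>. \<not> \<bar>cov n P - (1 - \<alpha>)\<bar> < e")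
        case True
        then have "\<exists>P. P \<in> \<P> \<and> \<not> \<bar>cov n P - (1 - \<alpha>)\<bar> < e" by blast
        from someI_ex[OF this] True show ?thesis by (simp add: Pn_def)
      qed (use P0 in \<open>auto simp: Pn_def\<close>)
      interpret dml_estimator MX \<theta>0 g0 m0 s K c C q \<delta> \<Delta> est Pn \<epsilon> th by (rule est'[OF th]) (use bad in blast)
      have "(\<lambda>n. cov n (Pn n)) \<longlonglongrightarrow> 1 - \<alpha>"
        using coverage_tendsto[OF \<alpha>] by (simp add: cov_def covered_def)
      from tendstoD[OF this e] show ?thesis
        by eventually_elim (use bad in \<open>auto simp: dist_real_def\<close>)
    qed simp
    then show "\<forall>\<^sub>F n in sequentially. \<forall>P\<in>\<P>.
        \<bar>measure (Omega (K * n) K P)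
           {(\<pi>, w) \<in> space (Omega (K * n) K P).
              let N = K * n; t = th N \<pi> w;
                  r = Phi_inv (1 - \<alpha> / 2) * sigma_hat s est K N \<pi> w t / sqrt (real N)
              in t - r \<le> \<theta>0 P \<and> \<theta>0 P \<le> t + r}
         - (1 - \<alpha>)\<bar> < e"
      unfolding cov_def .
  qed
qed

end
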